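(* Let $\mathcal{A}$ be an abelian category with enough injectives and let $(\mathcal{W},\mathcal{F})$ be a fixed injective cotorsion pair in $\mathcal{A}$. (1) Left admissible subcategories $\mathcal{F}'/\!\sim$ of $\mathcal{F}/\!\sim$ are in bijective correspondence with injective cotorsion pairs $(\mathcal{W}',\mathcal{F}')$ in $\mathcal{A}$ with $\mathcal{F}'\subseteq\mathcal{F}$. (2) Admissible subcategories $\mathcal{F}'/\!\sim$ of $\mathcal{F}/\!\sim$ are in bijective correspondence with pairs consisting of two injective cotorsion pairs $(\mathcal{W}',\mathcal{F}')$ and $(\mathcal{W}'',\mathcal{F}'')$ in $\mathcal{A}$ satisfying $\mathcal{F}''\subseteq\mathcal{F}$ and $\mathcal{W}''\cap\mathcal{F}=\mathcal{F}'$. In both cases the subcategory and the cotorsion pair(s) correspond to each other via the same class $\mathcal{F}'$.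
   Context: A pair $(\mathcal{X},\mathcal{Y})$ of classes of objects of $\mathcal{A}$ is a cotorsion pair if $\mathcal{Y}=\{Y:\operatorname{Ext}^1_{\mathcal{A}}(X,Y)=0\ \forall X\in\mathcal{X}\}$ and $\mathcal{X}=\{X:\operatorname{Ext}^1_{\mathcal{A}}(X,Y)=0\ \forall Y\in\mathcal{Y}\}$. It is complete if for every object $A$ there are short exact sequences $0\to Y\to X\to A\to 0$ and $0\to A\to Y'\to X'\to 0$ with $X,X'\in\mathcal{X}$, $Y,Y'\in\mathcal{Y}$. A class is thick if it is closed under direct summands and satisfies two-out-of-three on short exact sequences. An injective cotorsion pair is a complete cotorsion pair $(\mathcal{W},\mathcal{F})$ with $\mathcal{W}$ thick and $\mathcal{W}\cap\mathcal{F}$ the class of injective objects. For an injective cotorsion pair $(\mathcal{W},\mathcal{F})$, $\mathcal{F}$ is a Frobenius category with projective-injectives the injective objects of $\mathcal{A}$, and $\mathcal{F}/\!\sim$ is its triangulated stable category (morphisms modulo those factoring through an injective object). A thick subcategory of $\mathcal{F}/\!\sim$ is a full triangulated subcategory closed under isomorphism and retracts; it is written $\mathcal{F}'/\!\sim$, where $\mathcal{F}'\subseteq\mathcal{F}$ is the class of its objects. A thick subcategory is left admissible if its inclusion functor has a left adjoint, and admissible if its inclusion functor has both a left and a right adjoint. *)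

theory Defs
  imports "HOL-Algebra.Group"
begin

section \<open>Categories\<close>

text \<open>
  Objects and arrows are taken from two arbitrary types; composition, domain etc. are only
  constrained on the carriers \<^term>\<open>Obj\<close> and \<^term>\<open>Arr\<close>. A class of objects is a set of
  elements of the object type, and no smallness assumption is made on hom-sets.
\<close>

record ('o, 'm) cat =
  Obj  :: "'o set"
  Arr  :: "'m set"
  Dom  :: "'m \<Rightarrow> 'o"
  Cod  :: "'m \<Rightarrow> 'o"
  Id   :: "'o \<Rightarrow> 'm"
  Comp :: "'m \<Rightarrow> 'm \<Rightarrow> 'm" (infixl "\<cdot>\<index>" 70)

definition Hom :: "('o, 'm, 'z) cat_scheme \<Rightarrow> 'o \<Rightarrow> 'o \<Rightarrow> 'm set" where
  "Hom C X Y = {f \<in> Arr C. Dom C f = X \<and> Cod C f = Y}"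

locale category =
  fixes C :: "('o, 'm, 'z) cat_scheme" (structure)
  assumes Dom_in_Obj: "f \<in> Arr C \<Longrightarrow> Dom C f \<in> Obj C"
    and Cod_in_Obj: "f \<in> Arr C \<Longrightarrow> Cod C f \<in> Obj C"
    and Id_in_Hom: "X \<in> Obj C \<Longrightarrow> Id C X \<in> Hom C X X"
    and Comp_in_Hom: "\<lbrakk>f \<in> Hom C X Y; g \<in> Hom C Y Z\<rbrakk> \<Longrightarrow> g \<cdot> f \<in> Hom C X Z"
    and Comp_assoc: "\<lbrakk>f \<in> Hom C X Y; g \<in> Hom C Y Z; h \<in> Hom C Z W\<rbrakk>
          \<Longrightarrow> h \<cdot> (g \<cdot> f) = (h \<cdot> g) \<cdot> f"
    and Id_left: "f \<in> Hom C X Y \<Longrightarrow> Id C Y \<cdot> f = f"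
    and Id_right: "f \<in> Hom C X Y \<Longrightarrow> f \<cdot> Id C X = f"

definition mono_arr :: "('o, 'm, 'z) cat_scheme \<Rightarrow> 'm \<Rightarrow> bool" where
  "mono_arr C f \<longleftrightarrow> f \<in> Arr C \<and>
     (\<forall>W. \<forall>g \<in> Hom C W (Dom C f). \<forall>h \<in> Hom C W (Dom C f).
        f \<cdot>\<^bsub>C\<^esub> g = f \<cdot>\<^bsub>C\<^esub> h \<longrightarrow> g = h)"

definition epi_arr :: "('o, 'm, 'z) cat_scheme \<Rightarrow> 'm \<Rightarrow> bool" where
  "epi_arr C f \<longleftrightarrow> f \<in> Arr C \<and>
     (\<forall>W. \<forall>g \<in> Hom C (Cod C f) W. \<forall>h \<in> Hom C (Cod C f) W.
        g \<cdot>\<^bsub>C\<^esub> f = h \<cdot>\<^bsub>C\<^esub> f \<longrightarrow> g = h)"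

definition iso_arr :: "('o, 'm, 'z) cat_scheme \<Rightarrow> 'm \<Rightarrow> bool" where
  "iso_arr C f \<longleftrightarrow> f \<in> Arr C \<and>
     (\<exists>g \<in> Hom C (Cod C f) (Dom C f).
        g \<cdot>\<^bsub>C\<^esub> f = Id C (Dom C f) \<and> f \<cdot>\<^bsub>C\<^esub> g = Id C (Cod C f))"

definition isomorphic :: "('o, 'm, 'z) cat_scheme \<Rightarrow> 'o \<Rightarrow> 'o \<Rightarrow> bool" where
  "isomorphic C X Y \<longleftrightarrow> (\<exists>f \<in> Hom C X Y. iso_arr C f)"

definition retract_of :: "('o, 'm, 'z) cat_scheme \<Rightarrow> 'o \<Rightarrow> 'o \<Rightarrow> bool" where
  "retract_of C X Y \<longleftrightarrow> (\<exists>i \<in> Hom C X Y. \<exists>r \<in> Hom C Y X. r \<cdot>\<^bsub>C\<^esub> i = Id C X)"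

definition zero_object :: "('o, 'm, 'z) cat_scheme \<Rightarrow> 'o \<Rightarrow> bool" where
  "zero_object C Z \<longleftrightarrow> Z \<in> Obj C \<and>
     (\<forall>X \<in> Obj C. (\<exists>!f. f \<in> Hom C X Z) \<and> (\<exists>!f. f \<in> Hom C Z X))"

definition injective_object :: "('o, 'm, 'z) cat_scheme \<Rightarrow> 'o \<Rightarrow> bool" where
  "injective_object C I \<longleftrightarrow> I \<in> Obj C \<and>
     (\<forall>m. mono_arr C m \<longrightarrow> (\<forall>f \<in> Hom C (Dom C m) I. \<exists>g \<in> Hom C (Cod C m) I. g \<cdot>\<^bsub>C\<^esub> m = f))"

definition enough_injectives :: "('o, 'm, 'z) cat_scheme \<Rightarrow> bool" where
  "enough_injectives C \<longleftrightarrow>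
     (\<forall>X \<in> Obj C. \<exists>I m. injective_object C I \<and> m \<in> Hom C X I \<and> mono_arr C m)"

definition full_subcat :: "('o, 'm, 'z) cat_scheme \<Rightarrow> 'o set \<Rightarrow> ('o, 'm, 'z) cat_scheme" where
  "full_subcat C T = C\<lparr>Obj := T, Arr := {f \<in> Arr C. Dom C f \<in> T \<and> Cod C f \<in> T}\<rparr>"


section \<open>Functors and adjunctions\<close>

definition is_functor ::
  "('o, 'm, 'z) cat_scheme \<Rightarrow> ('p, 'n, 'y) cat_scheme \<Rightarrow> ('o \<Rightarrow> 'p) \<Rightarrow> ('m \<Rightarrow> 'n) \<Rightarrow> bool" where
  "is_functor C D Fo Fa \<longleftrightarrow>
     (\<forall>X \<in> Obj C. Fo X \<in> Obj D \<and> Fa (Id C X) = Id D (Fo X)) \<and>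
     (\<forall>f \<in> Arr C. Fa f \<in> Hom D (Fo (Dom C f)) (Fo (Cod C f))) \<and>
     (\<forall>f \<in> Arr C. \<forall>g \<in> Arr C. Cod C f = Dom C g \<longrightarrow> Fa (g \<cdot>\<^bsub>C\<^esub> f) = Fa g \<cdot>\<^bsub>D\<^esub> Fa f)"

text \<open>\<open>F : C \<rightarrow> D\<close> is left adjoint to \<open>G : D \<rightarrow> C\<close>, by a natural bijection of hom-sets.\<close>

definition adjoint_pair ::
  "('o, 'm, 'z) cat_scheme \<Rightarrow> ('p, 'n, 'y) cat_scheme \<Rightarrow>
   ('o \<Rightarrow> 'p) \<Rightarrow> ('m \<Rightarrow> 'n) \<Rightarrow> ('p \<Rightarrow> 'o) \<Rightarrow> ('n \<Rightarrow> 'm) \<Rightarrow> bool" where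
  "adjoint_pair C D Fo Fa Go Ga \<longleftrightarrow>
     is_functor C D Fo Fa \<and> is_functor D C Go Ga \<and>
     (\<exists>\<phi>. (\<forall>X \<in> Obj C. \<forall>Y \<in> Obj D. bij_betw (\<phi> X Y) (Hom D (Fo X) Y) (Hom C X (Go Y))) \<and>
          (\<forall>f \<in> Arr C. \<forall>g \<in> Arr D. \<forall>h \<in> Hom D (Fo (Cod C f)) (Dom D g).
             \<phi> (Dom C f) (Cod D g) (g \<cdot>\<^bsub>D\<^esub> (h \<cdot>\<^bsub>D\<^esub> Fa f)) =
             Ga g \<cdot>\<^bsub>C\<^esub> (\<phi> (Cod C f) (Dom D g) h \<cdot>\<^bsub>C\<^esub> f)))"

definition has_left_adjoint ::
  "('o, 'm, 'z) cat_scheme \<Rightarrow> ('p, 'n, 'y) cat_scheme \<Rightarrow> ('o \<Rightarrow> 'p) \<Rightarrow> ('m \<Rightarrow> 'n) \<Rightarrow> bool" where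
  "has_left_adjoint C D Go Ga \<longleftrightarrow> (\<exists>Fo Fa. adjoint_pair D C Fo Fa Go Ga)"

definition has_right_adjoint ::
  "('o, 'm, 'z) cat_scheme \<Rightarrow> ('p, 'n, 'y) cat_scheme \<Rightarrow> ('o \<Rightarrow> 'p) \<Rightarrow> ('m \<Rightarrow> 'n) \<Rightarrow> bool" where
  "has_right_adjoint C D Fo Fa \<longleftrightarrow> (\<exists>Go Ga. adjoint_pair C D Fo Fa Go Ga)"


section \<open>Abelian categories\<close>

record ('o, 'm) add_cat = "('o, 'm) cat" +
  Add  :: "'m \<Rightarrow> 'm \<Rightarrow> 'm"
  Zero :: "'o \<Rightarrow> 'o \<Rightarrow> 'm"

definition hom_group :: "('o, 'm, 'z) add_cat_scheme \<Rightarrow> 'o \<Rightarrow> 'o \<Rightarrow> 'm monoid" where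
  "hom_group C X Y = \<lparr>carrier = Hom C X Y, mult = Add C, one = Zero C X Y\<rparr>"

definition Diff :: "('o, 'm, 'z) add_cat_scheme \<Rightarrow> 'm \<Rightarrow> 'm \<Rightarrow> 'm" where
  "Diff C f g = Add C f (inv\<^bsub>hom_group C (Dom C g) (Cod C g)\<^esub> g)"

definition is_kernel :: "('o, 'm, 'z) add_cat_scheme \<Rightarrow> 'm \<Rightarrow> 'm \<Rightarrow> bool" where
  "is_kernel C k f \<longleftrightarrow> k \<in> Arr C \<and> f \<in> Arr C \<and> Cod C k = Dom C f \<and>
     f \<cdot>\<^bsub>C\<^esub> k = Zero C (Dom C k) (Cod C f) \<and>
     (\<forall>W. \<forall>h \<in> Hom C W (Dom C f). f \<cdot>\<^bsub>C\<^esub> h = Zero C W (Cod C f) \<longrightarrow>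
        (\<exists>!u. u \<in> Hom C W (Dom C k) \<and> k \<cdot>\<^bsub>C\<^esub> u = h))"

definition is_cokernel :: "('o, 'm, 'z) add_cat_scheme \<Rightarrow> 'm \<Rightarrow> 'm \<Rightarrow> bool" where
  "is_cokernel C c f \<longleftrightarrow> c \<in> Arr C \<and> f \<in> Arr C \<and> Dom C c = Cod C f \<and>
     c \<cdot>\<^bsub>C\<^esub> f = Zero C (Dom C f) (Cod C c) \<and>
     (\<forall>W. \<forall>h \<in> Hom C (Cod C f) W. h \<cdot>\<^bsub>C\<^esub> f = Zero C (Dom C f) W \<longrightarrow>
        (\<exists>!u. u \<in> Hom C (Cod C c) W \<and> u \<cdot>\<^bsub>C\<^esub> c = h))"

definition is_biproduct :: "('o, 'm, 'z) add_cat_scheme \<Rightarrow> 'o \<Rightarrow> 'o \<Rightarrow> 'o \<Rightarrow> bool" where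
  "is_biproduct C X Y B \<longleftrightarrow>
     (\<exists>i \<in> Hom C X B. \<exists>j \<in> Hom C Y B. \<exists>p \<in> Hom C B X. \<exists>q \<in> Hom C B Y.
        p \<cdot>\<^bsub>C\<^esub> i = Id C X \<and> q \<cdot>\<^bsub>C\<^esub> j = Id C Y \<and>
        p \<cdot>\<^bsub>C\<^esub> j = Zero C Y X \<and> q \<cdot>\<^bsub>C\<^esub> i = Zero C X Y \<and>
        Add C (i \<cdot>\<^bsub>C\<^esub> p) (j \<cdot>\<^bsub>C\<^esub> q) = Id C B)"

locale preadditive_category = category C for C :: "('o, 'm, 'z) add_cat_scheme" (structure) +
  assumes hom_comm_group: "\<lbrakk>X \<in> Obj C; Y \<in> Obj C\<rbrakk> \<Longrightarrow> comm_group (hom_group C X Y)"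
    and Comp_Add_right: "\<lbrakk>f \<in> Hom C X Y; f' \<in> Hom C X Y; g \<in> Hom C Y Z\<rbrakk>
          \<Longrightarrow> g \<cdot> Add C f f' = Add C (g \<cdot> f) (g \<cdot> f')"
    and Comp_Add_left: "\<lbrakk>f \<in> Hom C X Y; g \<in> Hom C Y Z; g' \<in> Hom C Y Z\<rbrakk>
          \<Longrightarrow> Add C g g' \<cdot> f = Add C (g \<cdot> f) (g' \<cdot> f)"

locale additive_category = preadditive_category +
  assumes ex_zero_object: "\<exists>Z. zero_object C Z"
    and ex_biproduct: "\<lbrakk>X \<in> Obj C; Y \<in> Obj C\<rbrakk> \<Longrightarrow> \<exists>B. is_biproduct C X Y B"

locale abelian_category = additive_category +
  assumes ex_kernel: "f \<in> Arr C \<Longrightarrow> \<exists>k. is_kernel C k f"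
    and ex_cokernel: "f \<in> Arr C \<Longrightarrow> \<exists>c. is_cokernel C c f"
    and mono_is_kernel: "mono_arr C m \<Longrightarrow> \<exists>f. is_kernel C m f"
    and epi_is_cokernel: "epi_arr C e \<Longrightarrow> \<exists>f. is_cokernel C e f"

definition short_exact :: "('o, 'm, 'z) add_cat_scheme \<Rightarrow> 'm \<Rightarrow> 'm \<Rightarrow> bool" where
  "short_exact C i p \<longleftrightarrow> is_kernel C i p \<and> is_cokernel C p i"

definition direct_summand :: "('o, 'm, 'z) add_cat_scheme \<Rightarrow> 'o \<Rightarrow> 'o \<Rightarrow> bool" where
  "direct_summand C X Y \<longleftrightarrow> (\<exists>Z \<in> Obj C. is_biproduct C X Z Y)"


section \<open>Yoneda Ext and cotorsion pairs\<close>

text \<open>The pair \<^term>\<open>(i, p)\<close> stands for the extension \<open>0 \<rightarrow> Y \<rightarrow> E \<rightarrow> X \<rightarrow> 0\<close>.\<close>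

definition extensions :: "('o, 'm, 'z) add_cat_scheme \<Rightarrow> 'o \<Rightarrow> 'o \<Rightarrow> ('m \<times> 'm) set" where
  "extensions A X Y = {(i, p). short_exact A i p \<and> Dom A i = Y \<and> Cod A p = X}"

definition ext_equiv ::
  "('o, 'm, 'z) add_cat_scheme \<Rightarrow> 'o \<Rightarrow> 'o \<Rightarrow> (('m \<times> 'm) \<times> ('m \<times> 'm)) set" where
  "ext_equiv A X Y = {((i, p), (i', p')).
     (i, p) \<in> extensions A X Y \<and> (i', p') \<in> extensions A X Y \<and>
     (\<exists>h \<in> Hom A (Cod A i) (Cod A i'). h \<cdot>\<^bsub>A\<^esub> i = i' \<and> p' \<cdot>\<^bsub>A\<^esub> h = p)}"

definition Ext1 :: "('o, 'm, 'z) add_cat_scheme \<Rightarrow> 'o \<Rightarrow> 'o \<Rightarrow> ('m \<times> 'm) set set" where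
  "Ext1 A X Y = extensions A X Y // ext_equiv A X Y"

text \<open>The split extensions form a single class, the neutral element for the Baer sum.\<close>

definition Ext1_zero :: "('o, 'm, 'z) add_cat_scheme \<Rightarrow> 'o \<Rightarrow> 'o \<Rightarrow> ('m \<times> 'm) set" where
  "Ext1_zero A X Y =
     {(i, p) \<in> extensions A X Y. \<exists>s \<in> Hom A X (Dom A p). p \<cdot>\<^bsub>A\<^esub> s = Id A X}"

definition Ext1_vanishes :: "('o, 'm, 'z) add_cat_scheme \<Rightarrow> 'o \<Rightarrow> 'o \<Rightarrow> bool" where
  "Ext1_vanishes A X Y \<longleftrightarrow> Ext1 A X Y = {Ext1_zero A X Y}"

definition cotorsion_pair :: "('o, 'm, 'z) add_cat_scheme \<Rightarrow> 'o set \<Rightarrow> 'o set \<Rightarrow> bool" where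
  "cotorsion_pair A \<X> \<Y> \<longleftrightarrow>
     \<Y> = {Y \<in> Obj A. \<forall>X \<in> \<X>. Ext1_vanishes A X Y} \<and>
     \<X> = {X \<in> Obj A. \<forall>Y \<in> \<Y>. Ext1_vanishes A X Y}"

definition complete_cotorsion_pair ::
  "('o, 'm, 'z) add_cat_scheme \<Rightarrow> 'o set \<Rightarrow> 'o set \<Rightarrow> bool" where
  "complete_cotorsion_pair A \<X> \<Y> \<longleftrightarrow> cotorsion_pair A \<X> \<Y> \<and>
     (\<forall>M \<in> Obj A.
        (\<exists>i p. short_exact A i p \<and> Dom A i \<in> \<Y> \<and> Dom A p \<in> \<X> \<and> Cod A p = M) \<and>
        (\<exists>i p. short_exact A i p \<and> Dom A i = M \<and> Dom A p \<in> \<Y> \<and> Cod A p \<in> \<X>))"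

definition thick_class :: "('o, 'm, 'z) add_cat_scheme \<Rightarrow> 'o set \<Rightarrow> bool" where
  "thick_class A \<W> \<longleftrightarrow> \<W> \<subseteq> Obj A \<and>
     (\<forall>Y \<in> \<W>. \<forall>X. direct_summand A X Y \<longrightarrow> X \<in> \<W>) \<and>
     (\<forall>i p. short_exact A i p \<longrightarrow>
        (Dom A i \<in> \<W> \<and> Dom A p \<in> \<W> \<longrightarrow> Cod A p \<in> \<W>) \<and>
        (Dom A i \<in> \<W> \<and> Cod A p \<in> \<W> \<longrightarrow> Dom A p \<in> \<W>) \<and>
        (Dom A p \<in> \<W> \<and> Cod A p \<in> \<W> \<longrightarrow> Dom A i \<in> \<W>))"

definition injective_cotorsion_pair ::
  "('o, 'm, 'z) add_cat_scheme \<Rightarrow> 'o set \<Rightarrow> 'o set \<Rightarrow> bool" where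
  "injective_cotorsion_pair A \<W> \<F> \<longleftrightarrow>
     complete_cotorsion_pair A \<W> \<F> \<and> thick_class A \<W> \<and> \<W> \<inter> \<F> = {I. injective_object A I}"


section \<open>The stable category of a class of objects\<close>

definition factors_through_injective :: "('o, 'm, 'z) add_cat_scheme \<Rightarrow> 'm \<Rightarrow> bool" where
  "factors_through_injective A f \<longleftrightarrow>
     (\<exists>I g h. injective_object A I \<and> g \<in> Hom A (Dom A f) I \<and> h \<in> Hom A I (Cod A f) \<and>
        f = h \<cdot>\<^bsub>A\<^esub> g)"

definition stable_class :: "('o, 'm, 'z) add_cat_scheme \<Rightarrow> 'm \<Rightarrow> 'm set" where
  "stable_class A f =
     {g \<in> Hom A (Dom A f) (Cod A f). factors_through_injective A (Diff A g f)}"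

text \<open>
  The operations are those of representatives; congruent arrows are parallel, so domain and
  codomain do not depend on the choice.
\<close>

definition rep :: "'m set \<Rightarrow> 'm" where
  "rep \<alpha> = (SOME f. f \<in> \<alpha>)"

definition stable_category ::
  "('o, 'm, 'z) add_cat_scheme \<Rightarrow> 'o set \<Rightarrow> ('o, 'm set) add_cat" where
  "stable_category A \<F> =
     \<lparr>Obj = \<F>,
      Arr = {stable_class A f | f. f \<in> Arr A \<and> Dom A f \<in> \<F> \<and> Cod A f \<in> \<F>},
      Dom = (\<lambda>\<alpha>. Dom A (rep \<alpha>)),
      Cod = (\<lambda>\<alpha>. Cod A (rep \<alpha>)),
      Id = (\<lambda>X. stable_class A (Id A X)),
      Comp = (\<lambda>\<beta> \<alpha>. stable_class A (rep \<beta> \<cdot>\<^bsub>A\<^esub> rep \<alpha>)),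
      Add = (\<lambda>\<alpha> \<beta>. stable_class A (Add A (rep \<alpha>) (rep \<beta>))),
      Zero = (\<lambda>X Y. stable_class A (Zero A X Y))\<rparr>"


section \<open>The triangulated structure of the stable category\<close>

text \<open>
  Happel's triangulated structure of a Frobenius category, here for the class \<^term>\<open>\<F>\<close> with the
  short exact sequences of \<^term>\<open>A\<close> that have all terms in \<^term>\<open>\<F>\<close>. For every \<^term>\<open>X\<close> a
  sequence \<open>0 \<rightarrow> X \<rightarrow> I \<rightarrow> \<Sigma>X \<rightarrow> 0\<close> is chosen once and for all. (An injective cotorsion
  pair has every injective object of \<^term>\<open>A\<close> in its right-hand class, so \<^term>\<open>I\<close> is in
  \<^term>\<open>\<F>\<close>.)
\<close>

definition susp_seq :: "('o, 'm, 'z) add_cat_scheme \<Rightarrow> 'o set \<Rightarrow> 'o \<Rightarrow> 'm \<times> 'm" where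
  "susp_seq A \<F> X = (SOME (i, p).
     short_exact A i p \<and> Dom A i = X \<and> injective_object A (Dom A p) \<and> Cod A p \<in> \<F>)"

definition susp_in :: "('o, 'm, 'z) add_cat_scheme \<Rightarrow> 'o set \<Rightarrow> 'o \<Rightarrow> 'm" where
  "susp_in A \<F> X = fst (susp_seq A \<F> X)"

definition susp_pr :: "('o, 'm, 'z) add_cat_scheme \<Rightarrow> 'o set \<Rightarrow> 'o \<Rightarrow> 'm" where
  "susp_pr A \<F> X = snd (susp_seq A \<F> X)"

definition susp :: "('o, 'm, 'z) add_cat_scheme \<Rightarrow> 'o set \<Rightarrow> 'o \<Rightarrow> 'o" where
  "susp A \<F> X = Cod A (susp_pr A \<F> X)"

text \<open>
  \<open>\<Sigma>\<close> on arrows: extend a representative \<open>f : X \<rightarrow> Y\<close> to \<open>g : I(X) \<rightarrow> I(Y)\<close> and pass to the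
  induced \<open>h : \<Sigma>X \<rightarrow> \<Sigma>Y\<close>, whose stable class does not depend on the choices.
\<close>

definition susp_arr :: "('o, 'm, 'z) add_cat_scheme \<Rightarrow> 'o set \<Rightarrow> 'm set \<Rightarrow> 'm set" where
  "susp_arr A \<F> \<alpha> = (SOME \<beta>. \<exists>X Y f g h.
     f \<in> \<alpha> \<and> f \<in> Hom A X Y \<and>
     g \<in> Hom A (Cod A (susp_in A \<F> X)) (Cod A (susp_in A \<F> Y)) \<and>
     h \<in> Hom A (susp A \<F> X) (susp A \<F> Y) \<and>
     g \<cdot>\<^bsub>A\<^esub> susp_in A \<F> X = susp_in A \<F> Y \<cdot>\<^bsub>A\<^esub> f \<and>
     h \<cdot>\<^bsub>A\<^esub> susp_pr A \<F> X = susp_pr A \<F> Y \<cdot>\<^bsub>A\<^esub> g \<and>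
     \<beta> = stable_class A h)"

text \<open>
  The standard triangle \<open>X \<rightarrow> Y \<rightarrow> C(u) \<rightarrow> \<Sigma>X\<close> on \<open>u : X \<rightarrow> Y\<close> is given by a morphism
  \<open>(u, t, id)\<close> of short exact sequences from \<open>X \<rightarrow> I(X) \<rightarrow> \<Sigma>X\<close> to \<open>Y \<rightarrow> C(u) \<rightarrow> \<Sigma>X\<close>;
  its left-hand square is then the pushout that is usually taken as the definition of \<open>C(u)\<close>.
\<close>

definition standard_triangle ::
  "('o, 'm, 'z) add_cat_scheme \<Rightarrow> 'o set \<Rightarrow> 'm \<Rightarrow> 'm \<Rightarrow> 'm \<Rightarrow> bool" where
  "standard_triangle A \<F> u v w \<longleftrightarrow>
     u \<in> Arr A \<and> Dom A u \<in> \<F> \<and> Cod A u \<in> \<F> \<and>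
     short_exact A v w \<and> Dom A v = Cod A u \<and> Cod A v \<in> \<F> \<and> Cod A w = susp A \<F> (Dom A u) \<and>
     (\<exists>t \<in> Hom A (Cod A (susp_in A \<F> (Dom A u))) (Cod A v).
        t \<cdot>\<^bsub>A\<^esub> susp_in A \<F> (Dom A u) = v \<cdot>\<^bsub>A\<^esub> u \<and> w \<cdot>\<^bsub>A\<^esub> t = susp_pr A \<F> (Dom A u))"

definition distinguished_triangles ::
  "('o, 'm, 'z) add_cat_scheme \<Rightarrow> 'o set \<Rightarrow> ('m set \<times> 'm set \<times> 'm set) set" where
  "distinguished_triangles A \<F> = (let S = stable_category A \<F> in
     {(\<alpha>, \<beta>, \<gamma>). \<alpha> \<in> Arr S \<and> \<beta> \<in> Arr S \<and> \<gamma> \<in> Arr S \<and>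
        Cod S \<alpha> = Dom S \<beta> \<and> Cod S \<beta> = Dom S \<gamma> \<and> Cod S \<gamma> = susp A \<F> (Dom S \<alpha>) \<and>
        (\<exists>u v w. standard_triangle A \<F> u v w \<and>
          (\<exists>a \<in> Hom S (Dom S \<alpha>) (Dom A u). \<exists>b \<in> Hom S (Dom S \<beta>) (Dom A v).
           \<exists>c \<in> Hom S (Dom S \<gamma>) (Dom A w).
             iso_arr S a \<and> iso_arr S b \<and> iso_arr S c \<and>
             b \<cdot>\<^bsub>S\<^esub> \<alpha> = stable_class A u \<cdot>\<^bsub>S\<^esub> a \<and>
             c \<cdot>\<^bsub>S\<^esub> \<beta> = stable_class A v \<cdot>\<^bsub>S\<^esub> b \<and>
             susp_arr A \<F> a \<cdot>\<^bsub>S\<^esub> \<gamma> = stable_class A w \<cdot>\<^bsub>S\<^esub> c))})"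


section \<open>Thick and admissible subcategories\<close>

text \<open>
  \<^term>\<open>S\<close> is a category with suspension \<^term>\<open>\<Sigma>\<close> on objects and distinguished triangles
  \<^term>\<open>\<Delta>\<close>. The equivalence \<open>X \<in> T \<longleftrightarrow> \<Sigma>X \<in> T\<close> expresses closure of a replete \<^term>\<open>T\<close> under
  \<open>\<Sigma>\<close> and its inverse.
\<close>

definition full_triangulated_subcategory ::
  "('o, 'm, 'z) cat_scheme \<Rightarrow> ('o \<Rightarrow> 'o) \<Rightarrow> ('m \<times> 'm \<times> 'm) set \<Rightarrow>
   ('o, 'm, 'z) cat_scheme \<Rightarrow> bool" where
  "full_triangulated_subcategory S \<Sigma> \<Delta> D \<longleftrightarrow>
     (\<exists>T \<subseteq> Obj S. D = full_subcat S T \<and>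
        (\<exists>Z \<in> T. zero_object S Z) \<and>
        (\<forall>X \<in> T. \<forall>Y \<in> Obj S. isomorphic S X Y \<longrightarrow> Y \<in> T) \<and>
        (\<forall>X \<in> Obj S. X \<in> T \<longleftrightarrow> \<Sigma> X \<in> T) \<and>
        (\<forall>(\<alpha>, \<beta>, \<gamma>) \<in> \<Delta>. Dom S \<alpha> \<in> T \<and> Dom S \<beta> \<in> T \<longrightarrow> Dom S \<gamma> \<in> T))"

definition thick_subcategory ::
  "('o, 'm, 'z) cat_scheme \<Rightarrow> ('o \<Rightarrow> 'o) \<Rightarrow> ('m \<times> 'm \<times> 'm) set \<Rightarrow>
   ('o, 'm, 'z) cat_scheme \<Rightarrow> bool" where
  "thick_subcategory S \<Sigma> \<Delta> D \<longleftrightarrow> full_triangulated_subcategory S \<Sigma> \<Delta> D \<and>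
     (\<forall>Y \<in> Obj D. \<forall>X \<in> Obj S. retract_of S X Y \<longrightarrow> X \<in> Obj D)"

definition stable_thick_subcategory ::
  "('o, 'm, 'z) add_cat_scheme \<Rightarrow> 'o set \<Rightarrow> ('o, 'm set) add_cat \<Rightarrow> bool" where
  "stable_thick_subcategory A \<F> D \<longleftrightarrow>
     thick_subcategory (stable_category A \<F>) (susp A \<F>) (distinguished_triangles A \<F>) D"

definition left_admissible ::
  "('o, 'm, 'z) add_cat_scheme \<Rightarrow> 'o set \<Rightarrow> ('o, 'm set) add_cat \<Rightarrow> bool" where
  "left_admissible A \<F> D \<longleftrightarrow> stable_thick_subcategory A \<F> D \<and>
     has_left_adjoint D (stable_category A \<F>) (\<lambda>X. X) (\<lambda>\<alpha>. \<alpha>)"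

definition admissible ::
  "('o, 'm, 'z) add_cat_scheme \<Rightarrow> 'o set \<Rightarrow> ('o, 'm set) add_cat \<Rightarrow> bool" where
  "admissible A \<F> D \<longleftrightarrow> stable_thick_subcategory A \<F> D \<and>
     has_left_adjoint D (stable_category A \<F>) (\<lambda>X. X) (\<lambda>\<alpha>. \<alpha>) \<and>
     has_right_adjoint D (stable_category A \<F>) (\<lambda>X. X) (\<lambda>\<alpha>. \<alpha>)"

end

(*
  Everything is read off in A itself. A reflection X -> L of X in F to T can be replaced by a
  monomorphism X -> Q with Q stably isomorphic to L; its cokernel V satisfies Ext(V, T) = 0, because
  Ext(V, Y) is the stable Hom(V, SY) and SY lies in T again. This gives one of the approximation
  sequences for the pair (perp T, T), and a pushout (Salce's trick) gives the other. Thickness of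
  perp T comes from desuspension: every Y in T is a cokernel K -> J -> Y with J injective and K in T,
  so all arrows from perp T to T factor through injectives. Conversely, the approximation sequences
  of an injective cotorsion pair are reflections. The right adjoint is handled by passing to
  F'' = {Y in F. Ext(T, Y) = 0}: the cone of a coreflection to T is a reflection to F'', so the first
  part applies to F''.
*)

theory Submission
  imports Defs
begin

section \<open>Arrows and their sums\<close>

text \<open>Orthogonality is taken in all of \<open>A\<close>, while the adjoints live in the stable
  category of \<open>\<F>\<close>. Passing between them shifts Ext in the first variable as well as
  in the second, and both shifts need injectives to have no Ext into the object on the right. For
  objects of \<open>\<F>\<close> this holds because injectives lie in \<open>\<W>\<close>; it stands
  in for projectives, which \<open>A\<close> need not have. No long exact sequence and no Baer sum
  appear: vanishing of Ext serves to extend or to lift an arrow, and stable equality is equality up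
  to a null arrow, which extends along every monomorphism and so can be corrected away.

  Bijectivity also asks for uniqueness. The first pair is fixed by its right-hand class F'. Of the
  second pair, F' gives only the part of W'' inside \<open>\<F>\<close>; but W'' contains
  \<open>\<W>\<close>, and every object embeds in one of \<open>\<F>\<close> with cokernel in
  \<open>\<W>\<close>, so that two-out-of-three decides membership in W''.\<close>

lemma HomI: "f \<in> Arr C \<Longrightarrow> Dom C f = X \<Longrightarrow> Cod C f = Y \<Longrightarrow> f \<in> Hom C X Y"
  by (simp add: Hom_def)

lemma Hom_iff: "f \<in> Hom C X Y \<longleftrightarrow> f \<in> Arr C \<and> Dom C f = X \<and> Cod C f = Y"
  by (simp add: Hom_def)

context category
begin

declare Dom_in_Obj [simp] Cod_in_Obj [simp]

lemma Hom_Obj: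
  assumes "f \<in> Hom C X Y"
  shows "X \<in> Obj C" "Y \<in> Obj C"
  using assms by (auto simp: Hom_iff)

lemma Arr_in_Hom: "f \<in> Arr C \<Longrightarrow> f \<in> Hom C (Dom C f) (Cod C f)"
  by (simp add: Hom_iff)

lemma Comp_Arr [simp]:
  assumes "f \<in> Arr C" "g \<in> Arr C" "Dom C g = Cod C f"
  shows "g \<cdot> f \<in> Arr C" "Dom C (g \<cdot> f) = Dom C f" "Cod C (g \<cdot> f) = Cod C g"
  using Comp_in_Hom[of f "Dom C f" "Cod C f" g "Cod C g"] assms by (auto simp: Hom_iff)

lemma Comp_assoc_Arr [simp]:
  assumes "f \<in> Arr C" "g \<in> Arr C" "h \<in> Arr C" "Dom C g = Cod C f" "Dom C h = Cod C g"
  shows "(h \<cdot> g) \<cdot> f = h \<cdot> (g \<cdot> f)"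
  using Comp_assoc[of f "Dom C f" "Cod C f" g "Cod C g" h "Cod C h"] assms
  by (auto simp: Hom_iff)

lemma Id_Arr [simp]:
  assumes "X \<in> Obj C"
  shows "Id C X \<in> Arr C" "Dom C (Id C X) = X" "Cod C (Id C X) = X"
  using Id_in_Hom[OF assms] by (auto simp: Hom_iff)

lemma Id_left_Arr [simp]: "f \<in> Arr C \<Longrightarrow> Cod C f = Y \<Longrightarrow> Id C Y \<cdot> f = f"
  using Id_left[of f "Dom C f" Y] by (simp add: Hom_iff)

lemma Id_right_Arr [simp]: "f \<in> Arr C \<Longrightarrow> Dom C f = X \<Longrightarrow> f \<cdot> Id C X = f"
  using Id_right[of f X "Cod C f"] by (simp add: Hom_iff)

end

context preadditive_category
begin

abbreviation add_arr (infixl "\<oplus>" 65) where "f \<oplus> g \<equiv> Add C f g"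

definition Neg where "Neg f = inv\<^bsub>hom_group C (Dom C f) (Cod C f)\<^esub> f"

lemma hom_group_simps [simp]:
  "carrier (hom_group C X Y) = Hom C X Y" "mult (hom_group C X Y) = Add C"
  "one (hom_group C X Y) = Zero C X Y"
  by (simp_all add: hom_group_def)

lemma Zero_Arr [simp]:
  assumes "X \<in> Obj C" "Y \<in> Obj C"
  shows "Zero C X Y \<in> Arr C" "Dom C (Zero C X Y) = X" "Cod C (Zero C X Y) = Y"
proof -
  interpret comm_group "hom_group C X Y" by (rule hom_comm_group[OF assms])
  show "Zero C X Y \<in> Arr C" "Dom C (Zero C X Y) = X" "Cod C (Zero C X Y) = Y"
    using one_closed by (auto simp: Hom_iff)
qed

lemma
  assumes "f \<in> Arr C" "g \<in> Arr C" "Dom C g = Dom C f" "Cod C g = Cod C f"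
  shows Add_Arr [simp]:
      "f \<oplus> g \<in> Arr C" "Dom C (f \<oplus> g) = Dom C f" "Cod C (f \<oplus> g) = Cod C f"
    and Add_commute: "f \<oplus> g = g \<oplus> f"
proof -
  interpret comm_group "hom_group C (Dom C f) (Cod C f)" using assms by (intro hom_comm_group) auto
  show "f \<oplus> g \<in> Arr C" "Dom C (f \<oplus> g) = Dom C f" "Cod C (f \<oplus> g) = Cod C f"
    using m_closed[of f g] assms by (auto simp: Hom_iff)
  show "f \<oplus> g = g \<oplus> f" using m_comm[of f g] assms by (auto simp: Hom_iff)
qed

lemma Add_assoc:
  assumes "f \<in> Arr C" "g \<in> Arr C" "h \<in> Arr C" "Dom C g = Dom C f" "Cod C g = Cod C f"
    "Dom C h = Dom C f" "Cod C h = Cod C f"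
  shows "(f \<oplus> g) \<oplus> h = f \<oplus> (g \<oplus> h)"
proof -
  interpret comm_group "hom_group C (Dom C f) (Cod C f)" using assms by (intro hom_comm_group) auto
  show ?thesis using m_assoc[of f g h] assms by (auto simp: Hom_iff)
qed

lemma
  assumes "f \<in> Arr C"
  shows Neg_Arr [simp]: "Neg f \<in> Arr C" "Dom C (Neg f) = Dom C f" "Cod C (Neg f) = Cod C f"
    and Add_Neg [simp]: "f \<oplus> Neg f = Zero C (Dom C f) (Cod C f)"
      "Neg f \<oplus> f = Zero C (Dom C f) (Cod C f)"
proof -
  interpret comm_group "hom_group C (Dom C f) (Cod C f)" using assms by (intro hom_comm_group) auto
  show "Neg f \<in> Arr C" "Dom C (Neg f) = Dom C f" "Cod C (Neg f) = Cod C f"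
    using inv_closed[of f] assms by (auto simp: Hom_iff Neg_def)
  show "f \<oplus> Neg f = Zero C (Dom C f) (Cod C f)" "Neg f \<oplus> f = Zero C (Dom C f) (Cod C f)"
    using r_inv[of f] l_inv[of f] assms by (auto simp: Hom_iff Neg_def)
qed

lemma Zero_Add [simp]:
  assumes "f \<in> Arr C" "Dom C f = X" "Cod C f = Y"
  shows "Zero C X Y \<oplus> f = f" "f \<oplus> Zero C X Y = f"
proof -
  interpret comm_group "hom_group C X Y" using assms by (intro hom_comm_group) auto
  show "Zero C X Y \<oplus> f = f" "f \<oplus> Zero C X Y = f"
    using l_one[of f] r_one[of f] assms by (auto simp: Hom_iff)
qed

lemma Comp_Add [simp]:
  assumes "f \<in> Arr C" "g \<in> Arr C" "Dom C g = Dom C f" "Cod C g = Cod C f" "h \<in> Arr C"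
  shows "Dom C h = Cod C f \<Longrightarrow> h \<cdot> (f \<oplus> g) = h \<cdot> f \<oplus> h \<cdot> g"
    and "Cod C h = Dom C f \<Longrightarrow> (f \<oplus> g) \<cdot> h = f \<cdot> h \<oplus> g \<cdot> h"
  using Comp_Add_right[of f "Dom C f" "Cod C f" g h "Cod C h"]
    Comp_Add_left[of h "Dom C h" "Dom C f" f "Cod C f" g] assms
  by (auto simp: Hom_iff)

lemma Add_self_eq:
  assumes "f \<oplus> f = f" "f \<in> Arr C"
  shows "f = Zero C (Dom C f) (Cod C f)"
proof -
  have "f = (f \<oplus> f) \<oplus> Neg f" using assms(2) by (simp add: Add_assoc)
  also have "\<dots> = f \<oplus> Neg f" unfolding assms(1) ..
  finally show ?thesis using assms(2) by simp
qed

text \<open>By bilinearity a composite with a zero arrow equals its own double, so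
  \<open>Add_self_eq\<close> applies.\<close>

lemma Comp_Zero [simp]:
  assumes "f \<in> Arr C" "X \<in> Obj C"
  shows "Dom C f = Y \<Longrightarrow> f \<cdot> Zero C X Y = Zero C X (Cod C f)"
    and "Cod C f = Y \<Longrightarrow> Zero C Y X \<cdot> f = Zero C (Dom C f) X"
proof -
  assume Y: "Dom C f = Y"
  then have "Y \<in> Obj C" using assms by auto
  then have "f \<cdot> Zero C X Y \<oplus> f \<cdot> Zero C X Y = f \<cdot> Zero C X Y"
    using assms Y by (subst Comp_Add(1)[symmetric]) auto
  then show "f \<cdot> Zero C X Y = Zero C X (Cod C f)"
    using Add_self_eq[of "f \<cdot> Zero C X Y"] assms Y \<open>Y \<in> Obj C\<close> by (simp)
next
  assume Y: "Cod C f = Y"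
  then have "Y \<in> Obj C" using assms by auto
  then have "Zero C Y X \<cdot> f \<oplus> Zero C Y X \<cdot> f = Zero C Y X \<cdot> f"
    using assms Y by (subst Comp_Add(2)[symmetric]) auto
  then show "Zero C Y X \<cdot> f = Zero C (Dom C f) X"
    using Add_self_eq[of "Zero C Y X \<cdot> f"] assms Y \<open>Y \<in> Obj C\<close> by (simp)
qed

lemma Neg_unique:
  assumes "f \<oplus> g = Zero C (Dom C f) (Cod C f)" "f \<in> Arr C" "g \<in> Arr C" "Dom C g = Dom C f"
    "Cod C g = Cod C f"
  shows "g = Neg f"
proof -
  have "g = (Neg f \<oplus> f) \<oplus> g" using assms(2-) by simp
  also have "\<dots> = Neg f \<oplus> (f \<oplus> g)" using assms(2-) by (subst Add_assoc) auto
  also have "\<dots> = Neg f" using assms by simp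
  finally show ?thesis .
qed

lemma Comp_Neg [simp]:
  assumes "f \<in> Arr C" "h \<in> Arr C"
  shows "Dom C h = Cod C f \<Longrightarrow> h \<cdot> Neg f = Neg (h \<cdot> f)"
    and "Cod C h = Dom C f \<Longrightarrow> Neg f \<cdot> h = Neg (f \<cdot> h)"
proof -
  assume d: "Dom C h = Cod C f"
  have "h \<cdot> f \<oplus> h \<cdot> Neg f = h \<cdot> (f \<oplus> Neg f)" using assms d by (subst Comp_Add) auto
  also have "\<dots> = Zero C (Dom C f) (Cod C h)" using assms d by simp
  finally show "h \<cdot> Neg f = Neg (h \<cdot> f)" using assms d by (intro Neg_unique) auto
next
  assume d: "Cod C h = Dom C f"
  have "f \<cdot> h \<oplus> Neg f \<cdot> h = (f \<oplus> Neg f) \<cdot> h" using assms d by (subst Comp_Add) auto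
  also have "\<dots> = Zero C (Dom C h) (Cod C f)" using assms d by simp
  finally show "Neg f \<cdot> h = Neg (f \<cdot> h)" using assms d by (intro Neg_unique) auto
qed

lemma Neg_Neg [simp]: "f \<in> Arr C \<Longrightarrow> Neg (Neg f) = f"
  by (rule Neg_unique[symmetric]) auto

lemma Add_Neg_eq_Zero:
  assumes "f \<oplus> Neg g = Zero C X Y" "f \<in> Hom C X Y" "g \<in> Hom C X Y"
  shows "f = g"
proof -
  have "Neg g \<oplus> f = Zero C X Y" using assms by (simp add: Hom_iff Add_commute)
  then show ?thesis using Neg_unique[of "Neg g" f] assms(2,3) by (auto simp: Hom_iff)
qed

lemma Diff_Neg: "Diff C f g = f \<oplus> Neg g"
  by (simp add: Diff_def Neg_def)

lemma Add_Diff: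
  assumes "f \<in> Hom C X Y" "g \<in> Hom C X Y"
  shows "Diff C f g \<in> Hom C X Y" "f = g \<oplus> Diff C f g"
proof -
  show "Diff C f g \<in> Hom C X Y" using assms by (auto simp: Hom_iff Diff_Neg)
  have "g \<oplus> (f \<oplus> Neg g) = (f \<oplus> Neg g) \<oplus> g"
    using assms by (subst Add_commute) (auto simp: Hom_iff)
  also have "\<dots> = f" using assms by (subst Add_assoc) (auto simp: Hom_iff)
  finally show "f = g \<oplus> Diff C f g" by (simp add: Diff_Neg)
qed

lemma Comp_Diff:
  assumes "f \<in> Hom C X Y" "g \<in> Hom C X Y"
  shows "h \<in> Hom C Y Z \<Longrightarrow> h \<cdot> Diff C f g = Diff C (h \<cdot> f) (h \<cdot> g)"
    and "k \<in> Hom C Z X \<Longrightarrow> Diff C f g \<cdot> k = Diff C (f \<cdot> k) (g \<cdot> k)"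
  using assms by (auto simp: Hom_iff Diff_Neg)

lemma Diff_self [simp]: "f \<in> Hom C X Y \<Longrightarrow> Diff C f f = Zero C X Y"
  by (auto simp: Hom_iff Diff_Neg)

lemma Diff_Add:
  assumes "f \<in> Hom C X Y" "g \<in> Hom C X Y"
  shows "Diff C (f \<oplus> g) f = g"
proof -
  have "(f \<oplus> g) \<oplus> Neg f = (g \<oplus> f) \<oplus> Neg f"
    using assms Add_commute[of f g] by (auto simp: Hom_iff)
  also have "\<dots> = g" using assms by (subst Add_assoc) (auto simp: Hom_iff)
  finally show ?thesis by (simp add: Diff_Neg)
qed

lemma Diff_eq_Zero:
  assumes "Diff C f g = Zero C X Y" "f \<in> Hom C X Y" "g \<in> Hom C X Y"
  shows "f = g"
  using Add_Neg_eq_Zero assms by (simp add: Diff_Neg)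

text \<open>Cancellation for a pair g, h is the kernel condition for their difference.\<close>

lemma mono_arr_iff:
  assumes "f \<in> Hom C X Y"
  shows "mono_arr C f \<longleftrightarrow> (\<forall>W. \<forall>g \<in> Hom C W X. f \<cdot> g = Zero C W Y \<longrightarrow> g = Zero C W X)"
    (is "_ \<longleftrightarrow> ?r")
proof
  assume m: "mono_arr C f"
  show ?r
  proof safe
    fix W g assume g: "g \<in> Hom C W X" and 0: "f \<cdot> g = Zero C W Y"
    then have "f \<cdot> g = f \<cdot> Zero C W X" using assms by (auto simp: Hom_iff)
    moreover have "Zero C W X \<in> Hom C W X" using g by (auto simp: Hom_iff)
    moreover have X: "Dom C f = X" using assms by (simp add: Hom_iff)
    ultimately show "g = Zero C W X" using m g unfolding mono_arr_def X by blast
  qed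
next
  assume r: ?r
  show "mono_arr C f"
    unfolding mono_arr_def
  proof (intro conjI allI ballI impI)
    show "f \<in> Arr C" using assms by (simp add: Hom_iff)
    fix W g h assume gh: "g \<in> Hom C W (Dom C f)" "h \<in> Hom C W (Dom C f)" and e: "f \<cdot> g = f \<cdot> h"
    have X: "Dom C f = X" using assms by (simp add: Hom_iff)
    have "f \<cdot> Diff C g h = Diff C (f \<cdot> g) (f \<cdot> h)"
      using gh unfolding X by (rule Comp_Diff(1)) (rule assms)
    also have "\<dots> = Zero C W Y"
      unfolding e using gh(2) assms by (intro Diff_self) (auto simp: Hom_iff)
    finally have "f \<cdot> Diff C g h = Zero C W Y" .
    moreover have "Diff C g h \<in> Hom C W X" using gh X Add_Diff(1) by auto
    ultimately have "Diff C g h = Zero C W X" using r by blast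
    then show "g = h" by (rule Diff_eq_Zero[OF _ gh[unfolded X]])
  qed
qed

end

section \<open>The opposite category\<close>

text \<open>\<open>Zero\<close> swaps its two objects because the hom-group from X to Y in the
  opposite category is the one from Y to X; \<open>Add\<close> stays as it is. Statements on exact
  sequences can then be proved on one side only.\<close>

definition opp :: "('o, 'm, 'z) add_cat_scheme \<Rightarrow> ('o, 'm, 'z) add_cat_scheme" where
  "opp C = C\<lparr>Dom := Cod C, Cod := Dom C, Comp := \<lambda>g f. f \<cdot>\<^bsub>C\<^esub> g, Zero := \<lambda>X Y. Zero C Y X\<rparr>"

lemma opp_simps [simp]:
  "Obj (opp C) = Obj C" "Arr (opp C) = Arr C" "Dom (opp C) = Cod C" "Cod (opp C) = Dom C"
  "Id (opp C) = Id C" "g \<cdot>\<^bsub>opp C\<^esub> f = f \<cdot>\<^bsub>C\<^esub> g" "Add (opp C) = Add C"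
  "Zero (opp C) X Y = Zero C Y X"
  by (simp_all add: opp_def)

lemma Hom_opp [simp]: "Hom (opp C) X Y = Hom C Y X"
  by (auto simp: Hom_def)

lemma mono_arr_opp [simp]: "mono_arr (opp C) f = epi_arr C f"
  by (simp add: mono_arr_def epi_arr_def)

lemma epi_arr_opp [simp]: "epi_arr (opp C) f = mono_arr C f"
  by (simp add: mono_arr_def epi_arr_def)

lemma is_kernel_opp [simp]: "is_kernel (opp C) k f = is_cokernel C k f"
  by (simp add: is_kernel_def is_cokernel_def)

lemma is_cokernel_opp [simp]: "is_cokernel (opp C) k f = is_kernel C k f"
  by (simp add: is_kernel_def is_cokernel_def)

lemma is_biproduct_opp: "is_biproduct C X Y B \<Longrightarrow> is_biproduct (opp C) X Y B"
  unfolding is_biproduct_def opp_simps Hom_opp by blast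

lemma zero_object_opp [simp]: "zero_object (opp C) Z = zero_object C Z"
  unfolding zero_object_def opp_simps Hom_opp by blast

lemma (in abelian_category) abelian_category_opp: "abelian_category (opp C)"
proof (intro abelian_category.intro additive_category.intro preadditive_category.intro
    category.intro preadditive_category_axioms.intro additive_category_axioms.intro
    abelian_category_axioms.intro)
  fix f assume "f \<in> Arr (opp C)"
  then show "Dom (opp C) f \<in> Obj (opp C)" "Cod (opp C) f \<in> Obj (opp C)"
    "\<exists>k. is_kernel (opp C) k f" "\<exists>k. is_cokernel (opp C) k f"
    using ex_kernel ex_cokernel by auto
next
  fix X assume "X \<in> Obj (opp C)"
  then show "Id (opp C) X \<in> Hom (opp C) X X" by (simp add: Id_in_Hom)
next
  fix f X Y g Z assume "f \<in> Hom (opp C) X Y" "g \<in> Hom (opp C) Y Z"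
  then show "g \<cdot>\<^bsub>opp C\<^esub> f \<in> Hom (opp C) X Z" by (auto intro: Comp_in_Hom)
next
  fix f X Y g Z h W assume "f \<in> Hom (opp C) X Y" "g \<in> Hom (opp C) Y Z" "h \<in> Hom (opp C) Z W"
  then show "h \<cdot>\<^bsub>opp C\<^esub> (g \<cdot>\<^bsub>opp C\<^esub> f) = (h \<cdot>\<^bsub>opp C\<^esub> g) \<cdot>\<^bsub>opp C\<^esub> f"
    by (simp add: Hom_iff)
next
  fix f X Y assume "f \<in> Hom (opp C) X Y"
  then show "Id (opp C) Y \<cdot>\<^bsub>opp C\<^esub> f = f" "f \<cdot>\<^bsub>opp C\<^esub> Id (opp C) X = f"
    by (auto simp add: Hom_iff)
next
  fix X Y assume "X \<in> Obj (opp C)" "Y \<in> Obj (opp C)"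
  moreover have "hom_group (opp C) X Y = hom_group C Y X" by (simp add: hom_group_def)
  ultimately show "comm_group (hom_group (opp C) X Y)" using hom_comm_group by simp
next
  fix f X Y f' g Z
  assume "f \<in> Hom (opp C) X Y" "f' \<in> Hom (opp C) X Y" "g \<in> Hom (opp C) Y Z"
  then show "g \<cdot>\<^bsub>opp C\<^esub> Add (opp C) f f' = Add (opp C) (g \<cdot>\<^bsub>opp C\<^esub> f) (g \<cdot>\<^bsub>opp C\<^esub> f')"
    by (auto simp: Hom_iff)
next
  fix f X Y g Z g'
  assume "f \<in> Hom (opp C) X Y" "g \<in> Hom (opp C) Y Z" "g' \<in> Hom (opp C) Y Z"
  then show "Add (opp C) g g' \<cdot>\<^bsub>opp C\<^esub> f = Add (opp C) (g \<cdot>\<^bsub>opp C\<^esub> f) (g' \<cdot>\<^bsub>opp C\<^esub> f)"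
    by (auto simp: Hom_iff)
next
  show "\<exists>Z. zero_object (opp C) Z" using ex_zero_object by simp
next
  fix X Y assume "X \<in> Obj (opp C)" "Y \<in> Obj (opp C)"
  then show "\<exists>B. is_biproduct (opp C) X Y B" using ex_biproduct is_biproduct_opp by fastforce
next
  fix m assume "mono_arr (opp C) m"
  then show "\<exists>f. is_kernel (opp C) m f" using epi_is_cokernel by simp
next
  fix m assume "epi_arr (opp C) m"
  then show "\<exists>f. is_cokernel (opp C) m f" using mono_is_kernel by simp
qed


section \<open>Short exact sequences, pushouts and pullbacks\<close>

text \<open>The three objects are named so that later arguments need not compute domains and
  codomains. Under \<open>opp\<close> the two arrows and the two outer objects change
  places.\<close>

definition ses ::
  "('o, 'm, 'z) add_cat_scheme \<Rightarrow> 'm \<Rightarrow> 'm \<Rightarrow> 'o \<Rightarrow> 'o \<Rightarrow> 'o \<Rightarrow> bool" where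
  "ses C i p X Y Z \<longleftrightarrow> short_exact C i p \<and> i \<in> Hom C X Y \<and> p \<in> Hom C Y Z"

lemma ses_opp [simp]: "ses (opp C) p i Z Y X = ses C i p X Y Z"
  by (auto simp: ses_def short_exact_def)

lemma short_exact_ses: "short_exact C i p \<longleftrightarrow> ses C i p (Dom C i) (Cod C i) (Cod C p) \<and> Dom C p = Cod C i"
  by (auto simp: ses_def short_exact_def is_kernel_def Hom_def)

context abelian_category
begin

lemma ses_Hom:
  assumes "ses C i p X Y Z"
  shows "i \<in> Hom C X Y" "p \<in> Hom C Y Z" "X \<in> Obj C" "Y \<in> Obj C" "Z \<in> Obj C"
  using assms Hom_Obj unfolding ses_def by auto

lemma ses_zero:
  assumes "ses C i p X Y Z"
  shows "p \<cdot> i = Zero C X Z"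
proof -
  have "p \<cdot> i = Zero C (Dom C i) (Cod C p)"
    using assms unfolding ses_def short_exact_def is_kernel_def by blast
  then show ?thesis using assms unfolding ses_def Hom_iff by simp
qed

lemma ses_lift_unique:
  assumes "ses C i p X Y Z" "f \<in> Hom C W Y" "p \<cdot> f = Zero C W Z"
  shows "\<exists>!u. u \<in> Hom C W X \<and> i \<cdot> u = f"
proof -
  have e: "Dom C i = X" "Dom C p = Y" "Cod C p = Z"
    using assms(1) unfolding ses_def Hom_iff by simp_all
  have "\<forall>W. \<forall>h \<in> Hom C W (Dom C p). p \<cdot> h = Zero C W (Cod C p) \<longrightarrow>
        (\<exists>!u. u \<in> Hom C W (Dom C i) \<and> i \<cdot> u = h)"
    using assms(1) unfolding ses_def short_exact_def is_kernel_def by blast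
  then show ?thesis using assms(2,3) unfolding e by blast
qed

lemma ses_lift:
  assumes "ses C i p X Y Z" "f \<in> Hom C W Y" "p \<cdot> f = Zero C W Z"
  obtains u where "u \<in> Hom C W X" "i \<cdot> u = f"
  using ses_lift_unique[OF assms] by blast

lemma ses_colift:
  assumes "ses C i p X Y Z" "f \<in> Hom C Y W" "f \<cdot> i = Zero C X W"
  obtains u where "u \<in> Hom C Z W" "u \<cdot> p = f"
  using abelian_category.ses_lift[OF abelian_category_opp, of p i Z Y X f W] assms by auto

lemma ses_mono:
  assumes "ses C i p X Y Z"
  shows "mono_arr C i"
proof -
  note h = ses_Hom[OF assms]
  have "g = Zero C W X" if g: "g \<in> Hom C W X" "i \<cdot> g = Zero C W Y" for W g
  proof -
    have W: "W \<in> Obj C" using g Hom_Obj by auto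
    have "\<exists>!u. u \<in> Hom C W X \<and> i \<cdot> u = Zero C W Y"
      using W h by (intro ses_lift_unique[OF assms]) (auto simp: Hom_iff)
    moreover have "Zero C W X \<in> Hom C W X \<and> i \<cdot> Zero C W X = Zero C W Y"
      using W h by (auto simp: Hom_iff)
    ultimately show ?thesis using g by blast
  qed
  then show ?thesis using mono_arr_iff h(1) by blast
qed

lemma ses_epi: "ses C i p X Y Z \<Longrightarrow> epi_arr C p"
  using abelian_category.ses_mono[OF abelian_category_opp, of p i Z Y X] by simp

lemma mono_cancel:
  assumes "mono_arr C i" "i \<in> Hom C X Y" "f \<in> Hom C W X" "g \<in> Hom C W X" "i \<cdot> f = i \<cdot> g"
  shows "f = g"
  using assms unfolding mono_arr_def by (auto simp: Hom_iff)

lemma epi_cancel: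
  assumes "epi_arr C p" "p \<in> Hom C X Y" "f \<in> Hom C Y W" "g \<in> Hom C Y W" "f \<cdot> p = g \<cdot> p"
  shows "f = g"
  using assms unfolding epi_arr_def by (auto simp: Hom_iff)

text \<open>The difference of f and g is killed by p and so factors through the kernel i. This is
  exactness of Hom(W, -) at the middle term, in the form in which two lifts are compared
  later.\<close>

lemma ses_lift_diff:
  assumes "ses C i p X Y Z" "f \<in> Hom C W Y" "g \<in> Hom C W Y" "p \<cdot> f = p \<cdot> g"
  obtains u where "u \<in> Hom C W X" "f = g \<oplus> i \<cdot> u"
proof -
  note h = ses_Hom[OF assms(1)]
  have "p \<cdot> Diff C f g = Zero C W Z"
    using Comp_Diff(1)[OF assms(2,3) h(2)] assms h Diff_self[of "p \<cdot> g" W Z]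
    by (auto simp: Hom_iff)
  then obtain u where u: "u \<in> Hom C W X" "i \<cdot> u = Diff C f g"
    using ses_lift[OF assms(1)] Add_Diff(1)[OF assms(2,3)] by blast
  then have "f = g \<oplus> i \<cdot> u" using Add_Diff(2)[OF assms(2,3)] by simp
  then show ?thesis using that u by blast
qed

lemma ses_colift_diff:
  assumes "ses C i p X Y Z" "f \<in> Hom C Y W" "g \<in> Hom C Y W" "f \<cdot> i = g \<cdot> i"
  obtains u where "u \<in> Hom C Z W" "f = g \<oplus> u \<cdot> p"
  using abelian_category.ses_lift_diff[OF abelian_category_opp, of p i Z Y X f W g] assms by auto

text \<open>A monomorphism is the kernel of some f, and f factors through the cokernel c. Hence
  whatever c kills is killed by f and factors through m.\<close>

lemma mono_kernel_cokernel:
  assumes "mono_arr C m" "is_cokernel C c m"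
  shows "is_kernel C m c"
proof -
  obtain f where f: "is_kernel C m f" using mono_is_kernel assms(1) by blast
  have arr: "m \<in> Arr C" "f \<in> Arr C" "c \<in> Arr C" "Cod C m = Dom C f" "Dom C c = Dom C f"
    and fm: "f \<cdot> m = Zero C (Dom C m) (Cod C f)"
    and cm: "c \<cdot> m = Zero C (Dom C m) (Cod C c)"
    using f assms(2) by (auto simp: is_kernel_def is_cokernel_def)
  then obtain u where u: "u \<in> Hom C (Cod C c) (Cod C f)" "u \<cdot> c = f"
    using assms(2) unfolding is_cokernel_def by (metis HomI)
  have "\<exists>!v. v \<in> Hom C W (Dom C m) \<and> m \<cdot> v = h"
    if h: "h \<in> Hom C W (Dom C c)" "c \<cdot> h = Zero C W (Cod C c)" for W h
  proof -
    have W: "W \<in> Obj C" using h Hom_Obj by auto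
    have c: "c \<in> Hom C (Dom C c) (Cod C c)" using arr by (simp add: Hom_iff)
    have "f \<cdot> h = u \<cdot> (c \<cdot> h)"
      using Comp_assoc[OF h(1) c u(1)] u(2) by simp
    also have "\<dots> = Zero C W (Cod C f)" using u(1) W unfolding h(2) Hom_iff by simp
    finally have fh: "f \<cdot> h = Zero C W (Cod C f)" .
    have "h \<in> Hom C W (Dom C f)" using h(1) arr by simp
    then show ?thesis using f fh unfolding is_kernel_def by blast
  qed
  then show ?thesis using arr cm unfolding is_kernel_def by simp
qed

lemma sesI:
  assumes "mono_arr C i" "is_cokernel C p i"
  shows "ses C i p (Dom C i) (Cod C i) (Cod C p)"
  using assms mono_kernel_cokernel[OF assms]
  by (auto simp: ses_def short_exact_def is_cokernel_def Hom_iff)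

lemma mono_ses:
  assumes "mono_arr C i" "i \<in> Hom C X Y"
  obtains p Z where "ses C i p X Y Z"
proof -
  obtain p where "is_cokernel C p i" using ex_cokernel assms by (auto simp: Hom_iff)
  then show ?thesis using sesI[OF assms(1)] that assms(2) by (auto simp: Hom_iff)
qed

text \<open>Uniqueness of the factorization comes from p being epi, so existence is all that is left
  to check.\<close>

lemma ses_cokernelI:
  assumes "mono_arr C i" "i \<in> Hom C X Y" "p \<in> Hom C Y Z" "p \<cdot> i = Zero C X Z" "epi_arr C p"
    and "\<And>W f. f \<in> Hom C Y W \<Longrightarrow> f \<cdot> i = Zero C X W \<Longrightarrow> \<exists>u \<in> Hom C Z W. u \<cdot> p = f"
  shows "ses C i p X Y Z"
proof -
  have d: "Dom C i = X" "Cod C i = Y" "Dom C p = Y" "Cod C p = Z" "i \<in> Arr C" "p \<in> Arr C"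
    using assms(2,3) unfolding Hom_iff by simp_all
  have "\<exists>!u. u \<in> Hom C Z W \<and> u \<cdot> p = h" if h: "h \<in> Hom C Y W" "h \<cdot> i = Zero C X W" for W h
    using assms(6)[OF h] epi_cancel[OF assms(5,3), of _ W] by metis
  then have "is_cokernel C p i"
    unfolding is_cokernel_def d using assms(4) d by blast
  then show ?thesis using sesI[OF assms(1), of p] d by simp
qed

lemma biproduct:
  assumes "X \<in> Obj C" "Y \<in> Obj C"
  obtains B i j p q where "is_biproduct C X Y B" "i \<in> Hom C X B" "j \<in> Hom C Y B"
    "p \<in> Hom C B X" "q \<in> Hom C B Y" "p \<cdot> i = Id C X" "q \<cdot> j = Id C Y"
    "p \<cdot> j = Zero C Y X" "q \<cdot> i = Zero C X Y" "i \<cdot> p \<oplus> j \<cdot> q = Id C B"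
  using ex_biproduct[OF assms] unfolding is_biproduct_def by blast

end

text \<open>Existence and uniqueness of the induced arrow are separate clauses because they are used
  apart: the first produces arrows out of P, the second cancels.\<close>

definition is_pushout ::
  "('o, 'm, 'z) add_cat_scheme \<Rightarrow> 'o \<Rightarrow> 'o \<Rightarrow> 'o \<Rightarrow> 'o \<Rightarrow> 'm \<Rightarrow> 'm \<Rightarrow> 'm \<Rightarrow> 'm \<Rightarrow> bool" where
  "is_pushout C X Y Z P i f i' f' \<longleftrightarrow>
     i \<in> Hom C X Y \<and> f \<in> Hom C X Z \<and> i' \<in> Hom C Z P \<and> f' \<in> Hom C Y P \<and> f' \<cdot>\<^bsub>C\<^esub> i = i' \<cdot>\<^bsub>C\<^esub> f \<and>
     (\<forall>V. \<forall>a \<in> Hom C Y V. \<forall>b \<in> Hom C Z V. a \<cdot>\<^bsub>C\<^esub> i = b \<cdot>\<^bsub>C\<^esub> f \<longrightarrow>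
        (\<exists>u \<in> Hom C P V. u \<cdot>\<^bsub>C\<^esub> f' = a \<and> u \<cdot>\<^bsub>C\<^esub> i' = b)) \<and>
     (\<forall>V. \<forall>u \<in> Hom C P V. \<forall>v \<in> Hom C P V. u \<cdot>\<^bsub>C\<^esub> f' = v \<cdot>\<^bsub>C\<^esub> f' \<longrightarrow> u \<cdot>\<^bsub>C\<^esub> i' = v \<cdot>\<^bsub>C\<^esub> i' \<longrightarrow> u = v)"

lemma is_pushout_sym: "is_pushout C X Y Z P i f i' f' \<Longrightarrow> is_pushout C X Z Y P f i f' i'"
  unfolding is_pushout_def by metis

context abelian_category
begin

lemma mono_arrI:
  assumes "f \<in> Hom C X Y" "\<And>W g. g \<in> Hom C W X \<Longrightarrow> f \<cdot> g = Zero C W Y \<Longrightarrow> g = Zero C W X"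
  shows "mono_arr C f"
  using assms mono_arr_iff by blast

lemma mono_zero:
  assumes "mono_arr C f" "f \<in> Hom C X Y" "g \<in> Hom C W X" "f \<cdot> g = Zero C W Y"
  shows "g = Zero C W X"
  using assms mono_arr_iff by blast

text \<open>P is the cokernel of (i, -f) from X to the biproduct of Y and Z, which is mono because
  its component i is. If i' kills g, then (0, g) comes from some v with i v = 0, so v = 0 and g = 0;
  for f' the argument is the same with f in place of i.\<close>

lemma pushout:
  assumes i: "i \<in> Hom C X Y" "mono_arr C i" and f: "f \<in> Hom C X Z"
  obtains P i' f' where "is_pushout C X Y Z P i f i' f'" "mono_arr C i'"
    "mono_arr C f \<Longrightarrow> mono_arr C f'"
proof -
  have O: "X \<in> Obj C" "Y \<in> Obj C" "Z \<in> Obj C" using Hom_Obj i f by auto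
  obtain B a b p q where ab: "a \<in> Hom C Y B" "b \<in> Hom C Z B" "p \<in> Hom C B Y" "q \<in> Hom C B Z"
    and e: "p \<cdot> a = Id C Y" "q \<cdot> b = Id C Z" "p \<cdot> b = Zero C Z Y" "q \<cdot> a = Zero C Y Z"
      "a \<cdot> p \<oplus> b \<cdot> q = Id C B"
    using biproduct[OF O(2,3)] by metis
  note h = i(1)[unfolded Hom_iff] f[unfolded Hom_iff] ab[unfolded Hom_iff]
  have BO: "B \<in> Obj C" using ab Hom_Obj by auto
  have pa: "p \<cdot> (a \<cdot> g) = g" if "g \<in> Hom C W Y" for g W
    using Comp_assoc[OF that ab(1,3)] Id_left[OF that] e(1) by simp
  have qb: "q \<cdot> (b \<cdot> g) = g" if "g \<in> Hom C W Z" for g W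
    using Comp_assoc[OF that ab(2,4)] Id_left[OF that] e(2) by simp
  have pb: "p \<cdot> (b \<cdot> g) = Zero C W Y" if "g \<in> Hom C W Z" for g W
    using Comp_assoc[OF that ab(2,3)] that O by (simp add: e(3) Hom_iff)
  have qa: "q \<cdot> (a \<cdot> g) = Zero C W Z" if "g \<in> Hom C W Y" for g W
    using Comp_assoc[OF that ab(1,4)] that O by (simp add: e(4) Hom_iff)
  define d where "d = a \<cdot> i \<oplus> b \<cdot> Neg f"
  have nf: "Neg f \<in> Hom C X Z" using h by (simp add: Hom_iff)
  have d: "d \<in> Hom C X B" unfolding d_def using h by (simp add: Hom_iff)
  have pd: "p \<cdot> d = i"
  proof -
    have "p \<cdot> d = p \<cdot> (a \<cdot> i) \<oplus> p \<cdot> (b \<cdot> Neg f)" unfolding d_def using h by (subst Comp_Add(1)) auto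
    also have "\<dots> = i" unfolding pa[OF i(1)] pb[OF nf] using h by simp
    finally show ?thesis .
  qed
  have qd: "q \<cdot> d = Neg f"
  proof -
    have "q \<cdot> d = q \<cdot> (a \<cdot> i) \<oplus> q \<cdot> (b \<cdot> Neg f)" unfolding d_def using h by (subst Comp_Add(1)) auto
    also have "\<dots> = Neg f" unfolding qa[OF i(1)] qb[OF nf] using h by simp
    finally show ?thesis .
  qed
  have dm: "mono_arr C d"
  proof (rule mono_arrI[OF d])
    fix W g assume g: "g \<in> Hom C W X" "d \<cdot> g = Zero C W B"
    have "i \<cdot> g = p \<cdot> (d \<cdot> g)" using Comp_assoc[OF g(1) d ab(3)] pd by simp
    also have "\<dots> = Zero C W Y" unfolding g(2) using h g(1) Hom_Obj[OF g(1)] by simp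
    finally show "g = Zero C W X" using mono_zero[OF i(2,1) g(1)] by simp
  qed
  obtain c P where s: "ses C d c X B P" using mono_ses[OF dm d] .
  have c: "c \<in> Hom C B P" "P \<in> Obj C" using ses_Hom[OF s] by auto
  define i' f' where "i' = c \<cdot> b" and "f' = c \<cdot> a"
  have i'f': "i' \<in> Hom C Z P" "f' \<in> Hom C Y P"
    using Comp_in_Hom ab c by (auto simp: i'_def f'_def)
  have cg: "c \<cdot> (b \<cdot> g) = i' \<cdot> g" if "g \<in> Hom C W Z" for g W
    using Comp_assoc[OF that ab(2) c(1)] i'_def by simp
  have cg': "c \<cdot> (a \<cdot> g) = f' \<cdot> g" if "g \<in> Hom C W Y" for g W
    using Comp_assoc[OF that ab(1) c(1)] f'_def by simp
  have comm: "f' \<cdot> i = i' \<cdot> f"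
  proof -
    have "Zero C X P = c \<cdot> d" using ses_zero[OF s] by simp
    also have "\<dots> = f' \<cdot> i \<oplus> i' \<cdot> Neg f"
      unfolding d_def cg[OF nf, symmetric] cg'[OF i(1), symmetric] using h c(1)[unfolded Hom_iff]
      by (subst Comp_Add(1)) auto
    also have "i' \<cdot> Neg f = Neg (i' \<cdot> f)" using h i'f'[unfolded Hom_iff] by simp
    finally show ?thesis
      using Add_Neg_eq_Zero[OF _ Comp_in_Hom[OF i(1) i'f'(2)] Comp_in_Hom[OF f i'f'(1)]] by metis
  qed
  have i'm: "mono_arr C i'"
  proof (rule mono_arrI[OF i'f'(1)])
    fix W g assume g: "g \<in> Hom C W Z" "i' \<cdot> g = Zero C W P"
    have bg: "b \<cdot> g \<in> Hom C W B" using Comp_in_Hom g(1) ab(2) by blast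
    obtain v where v: "v \<in> Hom C W X" "d \<cdot> v = b \<cdot> g"
      using ses_lift[OF s bg] cg[OF g(1)] g(2) by auto
    have "i \<cdot> v = p \<cdot> (d \<cdot> v)" using Comp_assoc[OF v(1) d ab(3)] pd by simp
    also have "\<dots> = Zero C W Y" unfolding v(2) by (rule pb[OF g(1)])
    finally have "v = Zero C W X" using mono_zero[OF i(2,1) v(1)] by simp
    then have "b \<cdot> g = Zero C W B" using v d Hom_Obj[OF v(1)] by (simp add: Hom_iff)
    then show "g = Zero C W Z" using qb[OF g(1)] h Hom_Obj[OF v(1)] by simp
  qed
  have f'm: "mono_arr C f'" if fm: "mono_arr C f"
  proof (rule mono_arrI[OF i'f'(2)])
    fix W g assume g: "g \<in> Hom C W Y" "f' \<cdot> g = Zero C W P"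
    have ag: "a \<cdot> g \<in> Hom C W B" using Comp_in_Hom g(1) ab(1) by blast
    obtain v where v: "v \<in> Hom C W X" "d \<cdot> v = a \<cdot> g"
      using ses_lift[OF s ag] cg'[OF g(1)] g(2) by auto
    have W: "W \<in> Obj C" "v \<in> Arr C" "Dom C v = W" "Cod C v = X"
      using v Hom_Obj by (auto simp: Hom_iff)
    have "Neg f \<cdot> v = q \<cdot> (d \<cdot> v)" using Comp_assoc[OF v(1) d ab(4)] qd by simp
    also have "\<dots> = Zero C W Z" unfolding v(2) by (rule qa[OF g(1)])
    finally have "Zero C W Z \<oplus> Neg (f \<cdot> v) = Zero C W Z" using W h O by simp
    then have "f \<cdot> v = Zero C W Z"
      using Add_Neg_eq_Zero[of "Zero C W Z" "f \<cdot> v" W Z] W h O by (simp add: Hom_iff)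
    then have "v = Zero C W X" using mono_zero[OF fm f v(1)] by simp
    then have "a \<cdot> g = Zero C W B" using v d W by (simp add: Hom_iff)
    then show "g = Zero C W Y" using pa[OF g(1)] h W by simp
  qed
  have ex: "\<exists>u \<in> Hom C P V. u \<cdot> f' = k \<and> u \<cdot> i' = l"
    if k: "k \<in> Hom C Y V" "l \<in> Hom C Z V" "k \<cdot> i = l \<cdot> f" for V k l
  proof -
    note hk = k(1,2)[unfolded Hom_iff]
    have V: "V \<in> Obj C" using k Hom_Obj by auto
    define w where "w = k \<cdot> p \<oplus> l \<cdot> q"
    have w: "w \<in> Hom C B V" unfolding w_def using h hk by (simp add: Hom_iff)
    have wa: "w \<cdot> a = k"
    proof -
      have "w \<cdot> a = k \<cdot> (p \<cdot> a) \<oplus> l \<cdot> (q \<cdot> a)" unfolding w_def using h hk by simp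
      then show ?thesis unfolding e using h hk O V by simp
    qed
    have wb: "w \<cdot> b = l"
    proof -
      have "w \<cdot> b = k \<cdot> (p \<cdot> b) \<oplus> l \<cdot> (q \<cdot> b)" unfolding w_def using h hk by simp
      then show ?thesis unfolding e using h hk O V by simp
    qed
    have "w \<cdot> d = w \<cdot> (a \<cdot> i) \<oplus> w \<cdot> (b \<cdot> Neg f)"
      unfolding d_def using h w[unfolded Hom_iff] by (subst Comp_Add(1)) auto
    also have "w \<cdot> (a \<cdot> i) = k \<cdot> i" using Comp_assoc[OF i(1) ab(1) w] wa by simp
    also have "w \<cdot> (b \<cdot> Neg f) = l \<cdot> Neg f" using Comp_assoc[OF nf ab(2) w] wb by simp
    also have "k \<cdot> i \<oplus> l \<cdot> Neg f = Zero C X V" unfolding k(3) using h hk by simp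
    finally obtain u where u: "u \<in> Hom C P V" "u \<cdot> c = w" using ses_colift[OF s w] by blast
    then show ?thesis
      using wa wb Comp_assoc[OF ab(1) c(1) u(1)] Comp_assoc[OF ab(2) c(1) u(1)]
      unfolding i'_def f'_def by auto
  qed
  have un: "u = v" if uv: "u \<in> Hom C P V" "v \<in> Hom C P V" "u \<cdot> f' = v \<cdot> f'" "u \<cdot> i' = v \<cdot> i'"
    for V u v
  proof -
    \<comment> \<open>An arrow out of P is recovered from its restrictions to Y and Z by the
      decomposition of the identity of the biproduct.\<close>
    have *: "w \<cdot> c = (w \<cdot> f') \<cdot> p \<oplus> (w \<cdot> i') \<cdot> q" if w: "w \<in> Hom C P V" for w
    proof -
      have "w \<cdot> c = (w \<cdot> c) \<cdot> (a \<cdot> p \<oplus> b \<cdot> q)"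
        unfolding e(5) using w c by (simp add: Hom_iff)
      also have "\<dots> = (w \<cdot> c) \<cdot> (a \<cdot> p) \<oplus> (w \<cdot> c) \<cdot> (b \<cdot> q)"
        using w c h by (subst Comp_Add(1)) (auto simp: Hom_iff)
      finally show ?thesis unfolding i'_def f'_def using w c h by (simp add: Hom_iff)
    qed
    have "u \<cdot> c = v \<cdot> c" unfolding *[OF uv(1)] *[OF uv(2)] uv(3,4) ..
    then show ?thesis using epi_cancel[OF ses_epi[OF s] c(1) uv(1,2)] by simp
  qed
  have "is_pushout C X Y Z P i f i' f'"
    unfolding is_pushout_def using i f i'f' comm ex un by blast
  then show ?thesis using that i'm f'm by blast
qed

text \<open>The arrow p' is induced by p on Y and by zero on Z. An arrow on P that vanishes on Z
  restricts on Y to one that kills X, hence factors through p; so the cokernel does not change under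
  the pushout.\<close>

lemma pushout_ses:
  assumes po: "is_pushout C X Y Z P i f i' f'" and s: "ses C i p X Y W" and m: "mono_arr C i'"
  obtains p' where "ses C i' p' Z P W" "p' \<cdot> f' = p"
proof -
  note h = ses_Hom[OF s]
  have f: "f \<in> Hom C X Z" "i' \<in> Hom C Z P" "f' \<in> Hom C Y P" "f' \<cdot> i = i' \<cdot> f"
    using po unfolding is_pushout_def by auto
  have O: "Z \<in> Obj C" "P \<in> Obj C" using Hom_Obj f by auto
  have ex: "\<exists>u \<in> Hom C P V. u \<cdot> f' = k \<and> u \<cdot> i' = l"
    if "k \<in> Hom C Y V" "l \<in> Hom C Z V" "k \<cdot> i = l \<cdot> f" for V k l
    using po that unfolding is_pushout_def by blast
  have un: "u = v" if "u \<in> Hom C P V" "v \<in> Hom C P V" "u \<cdot> f' = v \<cdot> f'" "u \<cdot> i' = v \<cdot> i'"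
    for V u v
    using po that unfolding is_pushout_def by blast
  have "p \<cdot> i = Zero C Z W \<cdot> f" using ses_zero[OF s] f(1) h O by (simp add: Hom_iff)
  moreover have z: "Zero C Z W \<in> Hom C Z W" using O h by (simp add: Hom_iff)
  ultimately obtain p' where p': "p' \<in> Hom C P W" "p' \<cdot> f' = p" "p' \<cdot> i' = Zero C Z W"
    using ex[OF h(2)] by blast
  have epi: "epi_arr C p'"
    unfolding epi_arr_def
  proof (intro conjI allI ballI impI)
    show "p' \<in> Arr C" using p' by (simp add: Hom_iff)
    fix V g k assume gk: "g \<in> Hom C (Cod C p') V" "k \<in> Hom C (Cod C p') V" "g \<cdot> p' = k \<cdot> p'"
    have cod: "Cod C p' = W" using p'(1) by (simp add: Hom_iff)
    note gk' = gk(1,2)[unfolded cod]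
    have "g \<cdot> p = k \<cdot> p"
      using Comp_assoc[OF f(3) p'(1) gk'(1)] Comp_assoc[OF f(3) p'(1) gk'(2)] p'(2) gk(3) by simp
    then show "g = k" using epi_cancel[OF ses_epi[OF s] h(2) gk'] by simp
  qed
  have "ses C i' p' Z P W"
  proof (rule ses_cokernelI[OF m f(2) p'(1,3) epi])
    fix V g assume g: "g \<in> Hom C P V" "g \<cdot> i' = Zero C Z V"
    have V: "V \<in> Obj C" using g Hom_Obj by auto
    have "(g \<cdot> f') \<cdot> i = (g \<cdot> i') \<cdot> f"
      using Comp_assoc[OF h(1) f(3) g(1)] Comp_assoc[OF f(1,2) g(1)] f(4) by simp
    also have "\<dots> = Zero C X V" unfolding g(2) using f(1) V by (simp add: Hom_iff)
    finally obtain u where u: "u \<in> Hom C W V" "u \<cdot> p = g \<cdot> f'"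
      using ses_colift[OF s Comp_in_Hom[OF f(3) g(1)]] by blast
    have up: "u \<cdot> p' \<in> Hom C P V" using Comp_in_Hom p' u by blast
    have "(u \<cdot> p') \<cdot> f' = g \<cdot> f'" using Comp_assoc[OF f(3) p'(1) u(1)] p'(2) u(2) by simp
    moreover have "(u \<cdot> p') \<cdot> i' = g \<cdot> i'"
      using Comp_assoc[OF f(2) p'(1) u(1)] p'(3) u(1) g(2) O by (simp add: Hom_iff)
    ultimately have "u \<cdot> p' = g" using un[OF up g(1)] by simp
    then show "\<exists>u \<in> Hom C W V. u \<cdot> p' = g" using u by blast
  qed
  then show ?thesis using that p' by blast
qed

text \<open>This is the action of f on extensions of W by X, on the level of
  representatives.\<close>

lemma ses_pushout:
  assumes s: "ses C i p X Y W" and f: "f \<in> Hom C X Z"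
  obtains P i' p' t where "ses C i' p' Z P W" "t \<in> Hom C Y P" "t \<cdot> i = i' \<cdot> f" "p' \<cdot> t = p"
proof -
  obtain P i' f' where po: "is_pushout C X Y Z P i f i' f'" "mono_arr C i'"
    using pushout[OF ses_Hom(1)[OF s] ses_mono[OF s] f] by blast
  obtain p' where "ses C i' p' Z P W" "p' \<cdot> f' = p" using pushout_ses[OF po(1) s po(2)] .
  then show ?thesis using that po(1) unfolding is_pushout_def by blast
qed

text \<open>The pushout of two monomorphisms carries both cokernels, which is the shape needed for
  Salce's trick in \<open>reflective_icp\<close>.\<close>

lemma ses_pushout2:
  assumes s: "ses C i p X Y W" and s': "ses C f q X Z V"
  obtains P i' p' t q' where "ses C i' p' Z P W" "ses C t q' Y P V"
proof -
  obtain P i' f' where po: "is_pushout C X Y Z P i f i' f'" "mono_arr C i'" "mono_arr C f'"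
    using pushout[OF ses_Hom(1)[OF s] ses_mono[OF s] ses_Hom(1)[OF s']] ses_mono[OF s'] by blast
  show ?thesis
    using pushout_ses[OF po(1) s po(2)] pushout_ses[OF is_pushout_sym[OF po(1)] s' po(3)] that by metis
qed

text \<open>The third isomorphism theorem: \<open>(E / X) / (Y / X) = E / Y\<close>.\<close>

lemma ses_quotient:
  assumes s: "ses C i p X Y Z" and s': "ses C y w Y E W"
  obtains D t i' p' where "ses C (y \<cdot> i) t X E D" "ses C i' p' Z D W" "t \<cdot> y = i' \<cdot> p" "p' \<cdot> t = w"
proof -
  note h = ses_Hom[OF s] ses_Hom[OF s']
  \<comment> \<open>The quotient E / X is built as the pushout of y along p, which yields the
    sequence Z -> D -> W at once; what remains is exactness of X -> E -> D.\<close>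
  obtain D i' t where po: "is_pushout C Y E Z D y p i' t" "mono_arr C i'"
    using pushout[OF ses_Hom(1)[OF s'] ses_mono[OF s'] h(2)] by blast
  obtain p' where p': "ses C i' p' Z D W" "p' \<cdot> t = w" using pushout_ses[OF po(1) s' po(2)] .
  have t: "t \<in> Hom C E D" "i' \<in> Hom C Z D" "t \<cdot> y = i' \<cdot> p"
    using po(1) unfolding is_pushout_def by auto
  have D: "D \<in> Obj C" using t Hom_Obj by auto
  have yi: "y \<cdot> i \<in> Hom C X E" using Comp_in_Hom h by blast
  have ex: "\<exists>u \<in> Hom C D V. u \<cdot> t = k \<and> u \<cdot> i' = l"
    if "k \<in> Hom C E V" "l \<in> Hom C Z V" "k \<cdot> y = l \<cdot> p" for V k l
    using po that unfolding is_pushout_def by blast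
  have un: "u = v" if "u \<in> Hom C D V" "v \<in> Hom C D V" "u \<cdot> t = v \<cdot> t" "u \<cdot> i' = v \<cdot> i'"
    for V u v
    using po that unfolding is_pushout_def by blast
  have m: "mono_arr C (y \<cdot> i)"
  proof (rule mono_arrI[OF yi])
    fix V g assume g: "g \<in> Hom C V X" "(y \<cdot> i) \<cdot> g = Zero C V E"
    have "y \<cdot> (i \<cdot> g) = Zero C V E" using Comp_assoc[OF g(1) h(1) h(6)] g(2) by simp
    then have "i \<cdot> g = Zero C V Y"
      using mono_zero[OF ses_mono[OF s'] h(6)] Comp_in_Hom[OF g(1) h(1)] by blast
    then show "g = Zero C V X" using mono_zero[OF ses_mono[OF s] h(1) g(1)] by simp
  qed
  have "t \<cdot> (y \<cdot> i) = (i' \<cdot> p) \<cdot> i" using Comp_assoc[OF h(1,6) t(1)] t(3) by simp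
  also have "\<dots> = i' \<cdot> (p \<cdot> i)" using Comp_assoc[OF h(1,2) t(2)] by simp
  also have "\<dots> = Zero C X D" unfolding ses_zero[OF s] using t h by (simp add: Hom_iff)
  finally have z: "t \<cdot> (y \<cdot> i) = Zero C X D" .
  have epi: "epi_arr C t"
    unfolding epi_arr_def
  proof (intro conjI allI ballI impI)
    show "t \<in> Arr C" using t by (simp add: Hom_iff)
    fix V g k assume gk: "g \<in> Hom C (Cod C t) V" "k \<in> Hom C (Cod C t) V" "g \<cdot> t = k \<cdot> t"
    have cod: "Cod C t = D" using t by (simp add: Hom_iff)
    note gk' = gk(1,2)[unfolded cod]
    have *: "(x \<cdot> i') \<cdot> p = (x \<cdot> t) \<cdot> y" if x: "x \<in> Hom C D V" for x
      using Comp_assoc[OF h(2) t(2) x] Comp_assoc[OF h(6) t(1) x] t(3) by simp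
    have "(g \<cdot> i') \<cdot> p = (k \<cdot> i') \<cdot> p" unfolding *[OF gk'(1)] *[OF gk'(2)] gk(3) ..
    then have "g \<cdot> i' = k \<cdot> i'"
      using epi_cancel[OF ses_epi[OF s] h(2)] Comp_in_Hom[OF t(2)] gk' by blast
    then show "g = k" using un[OF gk' gk(3)] by simp
  qed
  have "ses C (y \<cdot> i) t X E D"
  proof (rule ses_cokernelI[OF m yi t(1) z epi])
    fix V g assume g: "g \<in> Hom C E V" "g \<cdot> (y \<cdot> i) = Zero C X V"
    have "(g \<cdot> y) \<cdot> i = Zero C X V" using Comp_assoc[OF h(1,6) g(1)] g(2) by simp
    then obtain u where "u \<in> Hom C Z V" "u \<cdot> p = g \<cdot> y"
      using ses_colift[OF s Comp_in_Hom[OF h(6) g(1)]] by blast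
    then show "\<exists>u \<in> Hom C D V. u \<cdot> t = g" using ex[OF g(1)] by metis
  qed
  then show ?thesis using that p' t(3) by blast
qed

text \<open>Dual to \<open>ses_quotient\<close>: L is the preimage of Z under q, that is, the kernel
  of the composite V -> E -> W.\<close>

lemma ses_subobject:
  assumes "ses C k q K V E" "ses C z w Z E W"
  obtains L l k' g where "ses C l (w \<cdot> q) L V W" "ses C k' g K L Z" "l \<cdot> k' = k" "q \<cdot> l = z \<cdot> g"
proof (rule abelian_category.ses_quotient[OF abelian_category_opp, of w z W E Z q k V K])
  show "ses (opp C) w z W E Z" "ses (opp C) q k E V K" using assms by simp_all
qed (use that in auto)

end

section \<open>Vanishing of Ext\<close>

text \<open>A replacement for the quotient in \<open>Ext1\<close>: every extension splits.
  \<open>Ext1_vanishes_iff\<close> connects the two.\<close>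

definition ext_zero :: "('o, 'm, 'z) add_cat_scheme \<Rightarrow> 'o \<Rightarrow> 'o \<Rightarrow> bool" where
  "ext_zero C W Y \<longleftrightarrow> (\<forall>i p B. ses C i p Y B W \<longrightarrow> (\<exists>s \<in> Hom C W B. p \<cdot>\<^bsub>C\<^esub> s = Id C W))"

context abelian_category
begin

text \<open>The endomorphism id - s p is killed by p, so it is i r for some r. Then i r i = i, and i
  can be cancelled.\<close>

lemma retraction_of_section:
  assumes s: "ses C i p X Y Z" and "s \<in> Hom C Z Y" "p \<cdot> s = Id C Z"
  obtains r where "r \<in> Hom C Y X" "r \<cdot> i = Id C X" "i \<cdot> r \<oplus> s \<cdot> p = Id C Y"
proof -
  note h = ses_Hom[OF s]
  have sp: "s \<cdot> p \<in> Hom C Y Y" using Comp_in_Hom h assms by blast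
  have "p \<cdot> Id C Y = p \<cdot> (s \<cdot> p)"
    using Comp_assoc[OF h(2) assms(2) h(2)] assms(3) h by (simp add: Hom_iff)
  then obtain r where r: "r \<in> Hom C Y X" "Id C Y = s \<cdot> p \<oplus> i \<cdot> r"
    using ses_lift_diff[OF s Id_in_Hom[OF h(4)] sp] by blast
  have ir: "i \<cdot> r \<in> Hom C Y Y" using Comp_in_Hom h r by blast
  have "i = (s \<cdot> p \<oplus> i \<cdot> r) \<cdot> i" using h unfolding r(2)[symmetric] by (simp add: Hom_iff)
  also have "\<dots> = s \<cdot> (p \<cdot> i) \<oplus> i \<cdot> (r \<cdot> i)"
    using h r(1) assms(2) by (simp add: Hom_iff)
  also have "\<dots> = i \<cdot> (r \<cdot> i)"
    unfolding ses_zero[OF s] using h r(1) assms(2) by (simp add: Hom_iff)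
  finally have "i \<cdot> (r \<cdot> i) = i \<cdot> Id C X" using h by (simp add: Hom_iff)
  then have "r \<cdot> i = Id C X"
    using mono_cancel[OF ses_mono[OF s] h(1)] Comp_in_Hom[OF h(1) r(1)] Id_in_Hom[OF h(3)] by blast
  moreover have "i \<cdot> r \<oplus> s \<cdot> p = Id C Y"
    unfolding r(2) using ir sp by (subst Add_commute) (auto simp: Hom_iff)
  ultimately show ?thesis using that r(1) by blast
qed

lemma split_iff:
  assumes s: "ses C i p X Y Z"
  shows "(\<exists>s \<in> Hom C Z Y. p \<cdot> s = Id C Z) \<longleftrightarrow> (\<exists>r \<in> Hom C Y X. r \<cdot> i = Id C X)"
proof
  assume "\<exists>s \<in> Hom C Z Y. p \<cdot> s = Id C Z"
  then show "\<exists>r \<in> Hom C Y X. r \<cdot> i = Id C X" using retraction_of_section[OF s] by metis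
next
  assume "\<exists>r \<in> Hom C Y X. r \<cdot> i = Id C X"
  then obtain r where r: "r \<in> Hom (opp C) X Y" "i \<cdot>\<^bsub>opp C\<^esub> r = Id (opp C) X" by auto
  have s': "ses (opp C) p i Z Y X" using s by simp
  show "\<exists>s \<in> Hom C Z Y. p \<cdot> s = Id C Z"
    using abelian_category.retraction_of_section[OF abelian_category_opp s' r] by auto
qed

lemma ext_zero_opp: "ext_zero (opp C) Y W = ext_zero C W Y"
  unfolding ext_zero_def using split_iff by (auto; blast)

lemma ext_zeroI:
  assumes "\<And>i p B. ses C i p Y B W \<Longrightarrow> \<exists>r \<in> Hom C B Y. r \<cdot> i = Id C Y"
  shows "ext_zero C W Y"
  using assms split_iff unfolding ext_zero_def by blast

text \<open>Push the sequence out along f. The new extension of W by Y splits, and its retraction,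
  composed with B -> P, extends f.\<close>

lemma ext_extend:
  assumes e: "ext_zero C W Y" and s: "ses C i p X B W" and f: "f \<in> Hom C X Y"
  obtains g where "g \<in> Hom C B Y" "g \<cdot> i = f"
proof -
  obtain P i' p' t where s': "ses C i' p' Y P W" and t: "t \<in> Hom C B P" "t \<cdot> i = i' \<cdot> f"
    using ses_pushout[OF s f] by metis
  obtain r where r: "r \<in> Hom C P Y" "r \<cdot> i' = Id C Y"
    using e s' split_iff[OF s'] unfolding ext_zero_def by blast
  have "(r \<cdot> t) \<cdot> i = (r \<cdot> i') \<cdot> f"
    using Comp_assoc[OF ses_Hom(1)[OF s] t(1) r(1)] Comp_assoc[OF f ses_Hom(1)[OF s'] r(1)] t(2) by simp
  also have "\<dots> = f" unfolding r(2) using f by (simp add: Hom_iff)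
  finally show ?thesis using that Comp_in_Hom[OF t(1) r(1)] by blast
qed

lemma ext_lift:
  assumes e: "ext_zero C W Y" and s: "ses C i p Y B Z" and f: "f \<in> Hom C W Z"
  obtains g where "g \<in> Hom C W B" "p \<cdot> g = f"
proof (rule abelian_category.ext_extend[OF abelian_category_opp])
  show "ext_zero (opp C) Y W" using e ext_zero_opp by simp
  show "ses (opp C) p i Z B Y" "f \<in> Hom (opp C) Z W" using s f by simp_all
qed (use that in auto)

text \<open>The biproduct supplies one split extension, so that the quotient in \<open>Ext1\<close>
  is not empty.\<close>

lemma split_exact:
  assumes "X \<in> Obj C" "Y \<in> Obj C"
  obtains i p B s where "ses C i p Y B X" "s \<in> Hom C X B" "p \<cdot> s = Id C X"
proof -
  obtain B i j p q where b: "i \<in> Hom C X B" "j \<in> Hom C Y B"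
    "p \<in> Hom C B X" "q \<in> Hom C B Y" "p \<cdot> i = Id C X" "q \<cdot> j = Id C Y"
    "p \<cdot> j = Zero C Y X" "q \<cdot> i = Zero C X Y" "i \<cdot> p \<oplus> j \<cdot> q = Id C B"
    using biproduct[OF assms] by metis
  have m: "mono_arr C j"
  proof (rule mono_arrI[OF b(2)])
    fix W g assume g: "g \<in> Hom C W Y" "j \<cdot> g = Zero C W B"
    have "g = q \<cdot> (j \<cdot> g)" using Comp_assoc[OF g(1) b(2,4)] b(6) g(1) by (simp add: Hom_iff)
    then show "g = Zero C W Y" using g b(4) Hom_Obj[OF g(1)] by (simp add: Hom_iff)
  qed
  have e: "epi_arr C p"
    unfolding epi_arr_def
  proof (intro conjI allI ballI impI)
    show "p \<in> Arr C" using b by (simp add: Hom_iff)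
    fix V g k assume gk: "g \<in> Hom C (Cod C p) V" "k \<in> Hom C (Cod C p) V" "g \<cdot> p = k \<cdot> p"
    have cod: "Cod C p = X" using b(3) by (simp add: Hom_iff)
    note gk' = gk(1,2)[unfolded cod]
    show "g = k"
      using Comp_assoc[OF b(1,3) gk'(1)] Comp_assoc[OF b(1,3) gk'(2)] gk(3) b(5) gk' by (simp add: Hom_iff)
  qed
  have "ses C j p Y B X"
  proof (rule ses_cokernelI[OF m b(2,3,7) e])
    fix W f assume f: "f \<in> Hom C B W" "f \<cdot> j = Zero C Y W"
    have W: "W \<in> Obj C" using f Hom_Obj by auto
    have "f = f \<cdot> (i \<cdot> p \<oplus> j \<cdot> q)" unfolding b(9) using f(1) by (simp add: Hom_iff)
    also have "\<dots> = (f \<cdot> i) \<cdot> p \<oplus> (f \<cdot> j) \<cdot> q" using f(1) b(1-4) by (simp add: Hom_iff)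
    also have "\<dots> = (f \<cdot> i) \<cdot> p" unfolding f(2) using f(1) b(1-4) W by (simp add: Hom_iff)
    finally show "\<exists>u \<in> Hom C X W. u \<cdot> p = f" using Comp_in_Hom[OF b(1) f(1)] by metis
  qed
  then show ?thesis using that b by blast
qed

text \<open>With r the retraction that belongs to s, the arrow i' r + s' p identifies the two
  decompositions of the middle terms.\<close>

lemma split_equiv:
  assumes s: "ses C i p Y B X" "s \<in> Hom C X B" "p \<cdot> s = Id C X"
    and s': "ses C i' p' Y B' X" "s' \<in> Hom C X B'" "p' \<cdot> s' = Id C X"
  shows "\<exists>h \<in> Hom C B B'. h \<cdot> i = i' \<and> p' \<cdot> h = p"
proof -
  obtain r where r: "r \<in> Hom C B Y" "r \<cdot> i = Id C Y" using retraction_of_section[OF s] .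
  note h = ses_Hom[OF s(1)] ses_Hom[OF s'(1)] r(1) s(2) s'(2)
  have hh: "i' \<cdot> r \<oplus> s' \<cdot> p \<in> Hom C B B'" using h by (simp add: Hom_iff)
  have "(i' \<cdot> r \<oplus> s' \<cdot> p) \<cdot> i = i' \<cdot> (r \<cdot> i) \<oplus> s' \<cdot> (p \<cdot> i)"
    using h by (simp add: Hom_iff)
  also have "\<dots> = i'" unfolding r(2) ses_zero[OF s(1)] using h by (simp add: Hom_iff)
  finally have 1: "(i' \<cdot> r \<oplus> s' \<cdot> p) \<cdot> i = i'" .
  have "p' \<cdot> (i' \<cdot> r \<oplus> s' \<cdot> p) = p' \<cdot> (i' \<cdot> r) \<oplus> p' \<cdot> (s' \<cdot> p)"
    using h by (subst Comp_Add(1)) (auto simp: Hom_iff)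
  also have "\<dots> = (p' \<cdot> i') \<cdot> r \<oplus> (p' \<cdot> s') \<cdot> p" using h by (simp add: Hom_iff)
  also have "\<dots> = p" unfolding s'(3) ses_zero[OF s'(1)] using h by (simp add: Hom_iff)
  finally show ?thesis using 1 hh by blast
qed

text \<open>If all extensions split, the class of each is the set of split ones, by
  \<open>split_equiv\<close>. In the other direction an extension lies in its own class, and that
  class can only be the split one.\<close>

lemma Ext1_vanishes_iff:
  assumes "X \<in> Obj C" "Y \<in> Obj C"
  shows "Ext1_vanishes C X Y \<longleftrightarrow> ext_zero C X Y"
proof -
  have ext: "(i, p) \<in> extensions C X Y \<longleftrightarrow> (\<exists>B. ses C i p Y B X)" for i p
    unfolding extensions_def short_exact_ses by (auto simp: ses_def Hom_iff)
  have in_zero: "(i, p) \<in> Ext1_zero C X Y \<longleftrightarrow>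
      (\<exists>B s. ses C i p Y B X \<and> s \<in> Hom C X B \<and> p \<cdot> s = Id C X)" for i p
    unfolding Ext1_zero_def using ext by (auto simp: ses_def Hom_iff)
  have eq: "((i, p), (i', p')) \<in> ext_equiv C X Y \<longleftrightarrow>
      (\<exists>B B'. ses C i p Y B X \<and> ses C i' p' Y B' X \<and> (\<exists>h \<in> Hom C B B'. h \<cdot> i = i' \<and> p' \<cdot> h = p))"
    for i p i' p'
    unfolding ext_equiv_def using ext by (auto simp: ses_def Hom_iff)
  have refl: "(x, x) \<in> ext_equiv C X Y" if x: "x \<in> extensions C X Y" for x
  proof -
    obtain i p B where "x = (i, p)" and s: "ses C i p Y B X" using x ext by (cases x) auto
    moreover have "Id C B \<in> Hom C B B \<and> Id C B \<cdot> i = i \<and> p \<cdot> Id C B = p"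
      using ses_Hom[OF s] by (simp add: Hom_iff)
    ultimately show ?thesis using eq by blast
  qed
  show ?thesis
  proof
    assume v: "Ext1_vanishes C X Y"
    show "ext_zero C X Y"
      unfolding ext_zero_def
    proof (intro allI impI)
      fix i p B assume s: "ses C i p Y B X"
      then have x: "(i, p) \<in> extensions C X Y" using ext by blast
      then have "ext_equiv C X Y `` {(i, p)} \<in> Ext1 C X Y"
        unfolding Ext1_def by (rule quotientI)
      then have "ext_equiv C X Y `` {(i, p)} = Ext1_zero C X Y"
        using v unfolding Ext1_vanishes_def by simp
      then have "(i, p) \<in> Ext1_zero C X Y" using refl[OF x] by blast
      then show "\<exists>s \<in> Hom C X B. p \<cdot> s = Id C X" using s in_zero by (auto simp: ses_def Hom_iff)
    qed
  next
    assume z: "ext_zero C X Y"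
    have cls: "ext_equiv C X Y `` {x} = Ext1_zero C X Y" if x: "x \<in> extensions C X Y" for x
    proof -
      obtain i p B where xi: "x = (i, p)" and s: "ses C i p Y B X" using x ext by (cases x) auto
      obtain s where sc: "s \<in> Hom C X B" "p \<cdot> s = Id C X" using z s unfolding ext_zero_def by blast
      have "((i, p), (i', p')) \<in> ext_equiv C X Y \<longleftrightarrow> (i', p') \<in> Ext1_zero C X Y" for i' p'
      proof
        assume "((i, p), (i', p')) \<in> ext_equiv C X Y"
        then obtain B' where "ses C i' p' Y B' X" using eq by blast
        then show "(i', p') \<in> Ext1_zero C X Y" using z in_zero unfolding ext_zero_def by blast
      next
        assume "(i', p') \<in> Ext1_zero C X Y"
        then obtain B' s' where "ses C i' p' Y B' X" "s' \<in> Hom C X B'" "p' \<cdot> s' = Id C X"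
          using in_zero by blast
        then show "((i, p), (i', p')) \<in> ext_equiv C X Y" using split_equiv[OF s sc] s eq by blast
      qed
      then show ?thesis unfolding xi by auto
    qed
    obtain i p B where "ses C i p Y B X" using split_exact[OF assms] by metis
    then have "extensions C X Y \<noteq> {}" using ext by blast
    then show "Ext1_vanishes C X Y"
      unfolding Ext1_vanishes_def Ext1_def quotient_def using cls by auto
  qed
qed

lemma injective_extend:
  assumes "injective_object C I" "mono_arr C m" "m \<in> Hom C X Y" "f \<in> Hom C X I"
  obtains g where "g \<in> Hom C Y I" "g \<cdot> m = f"
proof -
  have d: "Dom C m = X" "Cod C m = Y" using assms(3) by (simp_all add: Hom_iff)
  have "\<forall>f \<in> Hom C (Dom C m) I. \<exists>g \<in> Hom C (Cod C m) I. g \<cdot> m = f"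
    using assms(1,2) unfolding injective_object_def by blast
  then show ?thesis using that assms(4) unfolding d by blast
qed

lemma ext_zero_injective:
  assumes "injective_object C I"
  shows "ext_zero C W I"
proof (rule ext_zeroI)
  fix i p B assume s: "ses C i p I B W"
  show "\<exists>r \<in> Hom C B I. r \<cdot> i = Id C I"
    using injective_extend[OF assms ses_mono[OF s] ses_Hom(1)[OF s]] Id_in_Hom[OF ses_Hom(3)[OF s]]
    by metis
qed

text \<open>Ext(W, Y) is the cokernel of Hom(W, I) -> Hom(W, S). Concretely, an extension B of W by
  Y maps to the given sequence by some e : B -> I and f : W -> S; for a lift g of f, the difference
  e - g p lands in Y and is a retraction.\<close>

lemma ext_zero_if_lift:
  assumes s: "ses C \<iota> \<pi> Y I S" and I: "injective_object C I"
    and l: "\<And>f. f \<in> Hom C W S \<Longrightarrow> \<exists>g \<in> Hom C W I. \<pi> \<cdot> g = f"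
  shows "ext_zero C W Y"
proof (rule ext_zeroI)
  fix i p B assume s': "ses C i p Y B W"
  note h = ses_Hom[OF s] ses_Hom[OF s']
  obtain e where e: "e \<in> Hom C B I" "e \<cdot> i = \<iota>"
    using injective_extend[OF I ses_mono[OF s'] h(6) h(1)] .
  have pe: "\<pi> \<cdot> e \<in> Hom C B S" using Comp_in_Hom e h by blast
  have "(\<pi> \<cdot> e) \<cdot> i = Zero C Y S" using Comp_assoc[OF h(6) e(1) h(2)] e(2) ses_zero[OF s] by simp
  then obtain f where f: "f \<in> Hom C W S" "f \<cdot> p = \<pi> \<cdot> e" using ses_colift[OF s' pe] by blast
  obtain g where g: "g \<in> Hom C W I" "\<pi> \<cdot> g = f" using l[OF f(1)] by blast
  have gp: "g \<cdot> p \<in> Hom C B I" using Comp_in_Hom g h by blast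
  have "\<pi> \<cdot> e = \<pi> \<cdot> (g \<cdot> p)" using Comp_assoc[OF h(7) g(1) h(2)] g(2) f(2) by simp
  then obtain u where u: "u \<in> Hom C B Y" "e = g \<cdot> p \<oplus> \<iota> \<cdot> u"
    using ses_lift_diff[OF s e(1) gp] by blast
  have "\<iota> = (g \<cdot> p \<oplus> \<iota> \<cdot> u) \<cdot> i" using e(2) unfolding u(2) by simp
  also have "\<dots> = g \<cdot> (p \<cdot> i) \<oplus> \<iota> \<cdot> (u \<cdot> i)" using h g(1) u(1) by (simp add: Hom_iff)
  also have "\<dots> = \<iota> \<cdot> (u \<cdot> i)" unfolding ses_zero[OF s'] using h g(1) u(1) by (simp add: Hom_iff)
  finally have "\<iota> \<cdot> (u \<cdot> i) = \<iota> \<cdot> Id C Y" using h by (simp add: Hom_iff)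
  then have "u \<cdot> i = Id C Y"
    using mono_cancel[OF ses_mono[OF s] h(1) Comp_in_Hom[OF h(6) u(1)] Id_in_Hom[OF h(3)]] by simp
  then show "\<exists>r \<in> Hom C B Y. r \<cdot> i = Id C Y" using u(1) by blast
qed

end

section \<open>Arrows factoring through injective objects\<close>

locale abelian_inj = abelian_category +
  assumes enough_inj: "enough_injectives C"
begin

abbreviation null where "null \<equiv> factors_through_injective C"

lemma injective_Obj: "injective_object C I \<Longrightarrow> I \<in> Obj C"
  by (simp add: injective_object_def)

lemma injective_ses:
  assumes "X \<in> Obj C"
  obtains \<iota> \<pi> I S where "ses C \<iota> \<pi> X I S" "injective_object C I"
proof -
  obtain I m where "injective_object C I" "m \<in> Hom C X I" "mono_arr C m"
    using enough_inj assms unfolding enough_injectives_def by blast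
  then show ?thesis using that mono_ses by metis
qed

lemma nullI: "injective_object C I \<Longrightarrow> g \<in> Hom C X I \<Longrightarrow> h \<in> Hom C I Y \<Longrightarrow> null (h \<cdot> g)"
  unfolding factors_through_injective_def by (auto simp: Hom_iff)

lemma nullE:
  assumes "null f" "f \<in> Hom C X Y"
  obtains I g h where "injective_object C I" "g \<in> Hom C X I" "h \<in> Hom C I Y" "f = h \<cdot> g"
proof -
  have "Dom C f = X" "Cod C f = Y" using assms(2) by (simp_all add: Hom_iff)
  then show ?thesis using that assms(1) unfolding factors_through_injective_def by metis
qed

lemma null_comp:
  assumes "null f" "f \<in> Hom C X Y" "g \<in> Hom C Y Z"
  shows "null (g \<cdot> f)"
  using assms(1,2)
proof (rule nullE)
  fix I a b assume h: "injective_object C I" "a \<in> Hom C X I" "b \<in> Hom C I Y" "f = b \<cdot> a"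
  show ?thesis
    unfolding h(4) using nullI[OF h(1,2) Comp_in_Hom[OF h(3) assms(3)]] Comp_assoc[OF h(2,3) assms(3)]
    by simp
qed

lemma null_comp':
  assumes "null f" "f \<in> Hom C X Y" "g \<in> Hom C Z X"
  shows "null (f \<cdot> g)"
  using assms(1,2)
proof (rule nullE)
  fix I a b assume h: "injective_object C I" "a \<in> Hom C X I" "b \<in> Hom C I Y" "f = b \<cdot> a"
  show ?thesis
    unfolding h(4) using nullI[OF h(1) Comp_in_Hom[OF assms(3) h(2)] h(3)] Comp_assoc[OF assms(3) h(2,3)]
    by simp
qed

text \<open>The first leg extends to Y because I is injective. As the extension is null again, it
  can be subtracted later without changing a stable class.\<close>

lemma null_extend:
  assumes "null f" "f \<in> Hom C X Z" "m \<in> Hom C X Y" "mono_arr C m"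
  obtains g where "g \<in> Hom C Y Z" "null g" "g \<cdot> m = f"
  using assms(1,2)
proof (rule nullE)
  fix I a b assume h: "injective_object C I" "a \<in> Hom C X I" "b \<in> Hom C I Z" "f = b \<cdot> a"
  obtain a' where a': "a' \<in> Hom C Y I" "a' \<cdot> m = a"
    using injective_extend[OF h(1) assms(4,3) h(2)] .
  have "(b \<cdot> a') \<cdot> m = f" using Comp_assoc[OF assms(3) a'(1) h(3)] a'(2) h(4) by simp
  then show ?thesis using that nullI[OF h(1) a'(1) h(3)] Comp_in_Hom[OF a'(1) h(3)] by blast
qed

text \<open>The leg from the injective object to Z lifts because Ext(J, Y) vanishes for injective J.
  For Y in \<open>\<F>\<close> this makes injectives act as projectives, as in a Frobenius
  category.\<close>

lemma null_lift:
  assumes "null f" "f \<in> Hom C W Z" "ses C i p Y B Z" "\<And>J. injective_object C J \<Longrightarrow> ext_zero C J Y"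
  obtains g where "g \<in> Hom C W B" "null g" "p \<cdot> g = f"
  using assms(1,2)
proof (rule nullE)
  fix I a b assume h: "injective_object C I" "a \<in> Hom C W I" "b \<in> Hom C I Z" "f = b \<cdot> a"
  obtain b' where b': "b' \<in> Hom C I B" "p \<cdot> b' = b"
    using ext_lift[OF assms(4)[OF h(1)] assms(3) h(3)] .
  have "p \<cdot> (b' \<cdot> a) = f" using Comp_assoc[OF h(2) b'(1) ses_Hom(2)[OF assms(3)]] b'(2) h(4) by simp
  then show ?thesis using that nullI[OF h(1,2) b'(1)] Comp_in_Hom[OF h(2) b'(1)] by blast
qed

text \<open>Both arrows extend along one fixed embedding of X in an injective object, and the two
  extensions can be added.\<close>

lemma null_Add:
  assumes "null f" "null g" "f \<in> Hom C X Y" "g \<in> Hom C X Y"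
  shows "null (f \<oplus> g)"
proof -
  obtain \<iota> \<pi> I S where s: "ses C \<iota> \<pi> X I S" and I: "injective_object C I"
    using injective_ses Hom_Obj assms(3) by metis
  note m = ses_mono[OF s] ses_Hom[OF s]
  obtain a b where ab: "a \<in> Hom C I Y" "a \<cdot> \<iota> = f" "b \<in> Hom C I Y" "b \<cdot> \<iota> = g"
    using null_extend[OF assms(1,3) m(2,1)] null_extend[OF assms(2,4) m(2,1)] by metis
  have "(a \<oplus> b) \<cdot> \<iota> = f \<oplus> g"
    unfolding ab(2,4)[symmetric] using ab(1,3) m(2) by (intro Comp_Add(2)) (simp_all add: Hom_iff)
  moreover have "a \<oplus> b \<in> Hom C I Y" using ab(1,3) by (simp add: Hom_iff)
  ultimately show ?thesis using nullI[OF I m(2)] by metis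
qed

lemma null_Neg:
  assumes "null f" "f \<in> Hom C X Y"
  shows "null (Neg f)"
  using assms
proof (rule nullE)
  fix I a b assume h: "injective_object C I" "a \<in> Hom C X I" "b \<in> Hom C I Y" "f = b \<cdot> a"
  have "Neg f = Neg b \<cdot> a" using h by (simp add: Hom_iff)
  moreover have "Neg b \<in> Hom C I Y" using h by (simp add: Hom_iff)
  ultimately show ?thesis using nullI[OF h(1,2)] by simp
qed

lemma null_injective_Dom: "injective_object C X \<Longrightarrow> f \<in> Hom C X Y \<Longrightarrow> null f"
  using nullI[of X "Id C X" X f Y] Id_in_Hom injective_Obj by (metis Id_right)

lemma null_Zero:
  assumes "X \<in> Obj C" "Y \<in> Obj C"
  shows "null (Zero C X Y)"
proof -
  obtain \<iota> \<pi> I S where s: "ses C \<iota> \<pi> X I S" and I: "injective_object C I"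
    using injective_ses assms by metis
  have "Zero C I Y \<cdot> \<iota> = Zero C X Y" "Zero C I Y \<in> Hom C I Y"
    using ses_Hom[OF s] assms by (simp_all add: Hom_iff)
  then show ?thesis using nullI[OF I ses_Hom(1)[OF s]] by metis
qed

section \<open>The congruence modulo null arrows, and retracts in the stable category\<close>

definition steq :: "'a \<Rightarrow> 'a \<Rightarrow> 'b \<Rightarrow> 'b \<Rightarrow> bool" where
  "steq X Y f g \<longleftrightarrow> f \<in> Hom C X Y \<and> g \<in> Hom C X Y \<and> null (Diff C f g)"

lemma steqD: "steq X Y f g \<Longrightarrow> f \<in> Hom C X Y" "steq X Y f g \<Longrightarrow> g \<in> Hom C X Y"
  by (simp_all add: steq_def)

lemma steqI:
  assumes "f = g \<oplus> n" "g \<in> Hom C X Y" "n \<in> Hom C X Y" "null n"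
  shows "steq X Y f g"
proof -
  have "f \<in> Hom C X Y" unfolding assms(1) using assms(2,3) by (simp add: Hom_iff)
  then show ?thesis unfolding steq_def using assms(2,4) Diff_Add[OF assms(2,3)] assms(1) by simp
qed

lemma steqE:
  assumes "steq X Y f g"
  obtains n where "n \<in> Hom C X Y" "null n" "f = g \<oplus> n"
  using assms Add_Diff[of f X Y g] unfolding steq_def by blast

lemma steq_refl: "f \<in> Hom C X Y \<Longrightarrow> steq X Y f f"
  unfolding steq_def using null_Zero[of X Y] Hom_Obj by simp

lemma steq_sym:
  assumes "steq X Y f g"
  shows "steq X Y g f"
  using assms
proof (rule steqE)
  fix n assume n: "n \<in> Hom C X Y" "null n" "f = g \<oplus> n"
  note f = steqD[OF assms]
  have "f \<oplus> Neg n = g" unfolding n(3) using f(2) n(1) by (subst Add_assoc) (simp_all add: Hom_iff)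
  moreover have "Neg n \<in> Hom C X Y" using n(1) by (simp add: Hom_iff)
  ultimately show ?thesis using steqI f(1) null_Neg[OF n(2,1)] by metis
qed

lemma steq_trans:
  assumes "steq X Y f g" "steq X Y g h"
  shows "steq X Y f h"
proof -
  obtain n n' where n: "n \<in> Hom C X Y" "null n" "f = g \<oplus> n" "n' \<in> Hom C X Y" "null n'" "g = h \<oplus> n'"
    using steqE[OF assms(1)] steqE[OF assms(2)] by metis
  have h: "h \<in> Hom C X Y" using steqD assms(2) by blast
  have "f = h \<oplus> (n' \<oplus> n)"
    unfolding n(3) n(6) using n(1,4) h by (subst Add_assoc) (simp_all add: Hom_iff)
  moreover have "n' \<oplus> n \<in> Hom C X Y" using n(1,4) by (simp add: Hom_iff)
  ultimately show ?thesis using steqI h null_Add[OF n(5,2,4,1)] by metis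
qed

lemma steq_left:
  assumes "steq X Y f g" "k \<in> Hom C Y Z"
  shows "steq X Z (k \<cdot> f) (k \<cdot> g)"
  using assms(1)
proof (rule steqE)
  fix n assume n: "n \<in> Hom C X Y" "null n" "f = g \<oplus> n"
  note f = steqD[OF assms(1)]
  have "k \<cdot> f = k \<cdot> g \<oplus> k \<cdot> n"
    unfolding n(3) using f(2) n(1) assms(2) by (intro Comp_Add(1)) (simp_all add: Hom_iff)
  then show ?thesis
    using steqI Comp_in_Hom[OF f(2) assms(2)] Comp_in_Hom[OF n(1) assms(2)]
      null_comp[OF n(2,1) assms(2)] by blast
qed

lemma steq_right:
  assumes "steq X Y f g" "k \<in> Hom C Z X"
  shows "steq Z Y (f \<cdot> k) (g \<cdot> k)"
  using assms(1)
proof (rule steqE)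
  fix n assume n: "n \<in> Hom C X Y" "null n" "f = g \<oplus> n"
  note f = steqD[OF assms(1)]
  have "f \<cdot> k = g \<cdot> k \<oplus> n \<cdot> k"
    unfolding n(3) using f(2) n(1) assms(2) by (intro Comp_Add(2)) (simp_all add: Hom_iff)
  then show ?thesis
    using steqI Comp_in_Hom[OF assms(2) f(2)] Comp_in_Hom[OF assms(2) n(1)]
      null_comp'[OF n(2,1) assms(2)] by blast
qed

lemma steq_comp: "steq X Y f f' \<Longrightarrow> steq Y Z g g' \<Longrightarrow> steq X Z (g \<cdot> f) (g' \<cdot> f')"
  using steq_left steq_right steq_trans steqD by metis

lemma steq_Zero_iff: "f \<in> Hom C X Y \<Longrightarrow> steq X Y f (Zero C X Y) \<longleftrightarrow> null f"
proof
  assume f: "f \<in> Hom C X Y"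
  have z: "Zero C X Y \<in> Hom C X Y" using Hom_Obj[OF f] by (simp add: Hom_iff)
  { assume "steq X Y f (Zero C X Y)"
    then obtain n where "n \<in> Hom C X Y" "null n" "f = Zero C X Y \<oplus> n" by (rule steqE)
    then show "null f" by (simp add: Hom_iff) }
  { assume "null f"
    moreover have "f = Zero C X Y \<oplus> f" using f by (simp add: Hom_iff)
    ultimately show "steq X Y f (Zero C X Y)" using steqI z f by blast }
qed

lemma steq_null: "steq X Y f g \<Longrightarrow> null g \<Longrightarrow> null f"
  using steq_Zero_iff steq_trans steqD by metis

lemma null_steq: "null f \<Longrightarrow> null g \<Longrightarrow> f \<in> Hom C X Y \<Longrightarrow> g \<in> Hom C X Y \<Longrightarrow> steq X Y f g"
  using steq_Zero_iff steq_trans steq_sym by metis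

text \<open>A retract in the stable category, expressed by arrows of \<open>C\<close> so that no
  class \<open>\<F>\<close> has to be fixed; \<open>retract_of_stable_iff\<close> connects the
  two.\<close>

definition sretract :: "'a \<Rightarrow> 'a \<Rightarrow> bool" where
  "sretract X Y \<longleftrightarrow> (\<exists>i \<in> Hom C X Y. \<exists>r \<in> Hom C Y X. steq X X (Id C X) (r \<cdot> i))"

text \<open>The identity of X is r i plus a null arrow. Along X -> B the arrow i extends because
  Ext(W, Y) vanishes, and the null arrow extends along any monomorphism; together they give a
  retraction.\<close>

lemma ext_zero_sretract:
  assumes "ext_zero C W Y" "sretract X Y"
  shows "ext_zero C W X"
proof (rule ext_zeroI)
  fix a b B assume s: "ses C a b X B W"
  note h = ses_Hom[OF s]
  obtain i r where ir: "i \<in> Hom C X Y" "r \<in> Hom C Y X" "steq X X (Id C X) (r \<cdot> i)"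
    using assms(2) unfolding sretract_def by blast
  obtain n where n: "n \<in> Hom C X X" "null n" "Id C X = r \<cdot> i \<oplus> n" using steqE[OF ir(3)] .
  obtain u where u: "u \<in> Hom C B Y" "u \<cdot> a = i" using ext_extend[OF assms(1) s ir(1)] .
  obtain m where m: "m \<in> Hom C B X" "m \<cdot> a = n"
    using null_extend[OF n(2,1) h(1) ses_mono[OF s]] by metis
  have "(r \<cdot> u \<oplus> m) \<cdot> a = r \<cdot> (u \<cdot> a) \<oplus> m \<cdot> a" using h ir(2) u(1) m(1) by (simp add: Hom_iff)
  then have "(r \<cdot> u \<oplus> m) \<cdot> a = Id C X" unfolding u(2) m(2) n(3) .
  moreover have "r \<cdot> u \<oplus> m \<in> Hom C B X" using ir(2) u(1) m(1) by (simp add: Hom_iff)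
  ultimately show "\<exists>r \<in> Hom C B X. r \<cdot> a = Id C X" by blast
qed

lemma ext_zero_retract:
  assumes "ext_zero C W Y" "s \<in> Hom C V W" "q \<in> Hom C W V" "q \<cdot> s = Id C V"
  shows "ext_zero C V Y"
  unfolding ext_zero_def
proof (intro allI impI)
  fix i p B assume e: "ses C i p Y B V"
  obtain g where g: "g \<in> Hom C W B" "p \<cdot> g = q" using ext_lift[OF assms(1) e assms(3)] .
  have "p \<cdot> (g \<cdot> s) = Id C V" using Comp_assoc[OF assms(2) g(1) ses_Hom(2)[OF e]] g(2) assms(4) by simp
  then show "\<exists>s \<in> Hom C V B. p \<cdot> s = Id C V" using Comp_in_Hom[OF assms(2) g(1)] by blast
qed

lemma sretract_trans:
  assumes "sretract X Y" "sretract Y Z"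
  shows "sretract X Z"
proof -
  obtain i r where ir: "i \<in> Hom C X Y" "r \<in> Hom C Y X" "steq X X (Id C X) (r \<cdot> i)"
    using assms(1) unfolding sretract_def by blast
  obtain j q where jq: "j \<in> Hom C Y Z" "q \<in> Hom C Z Y" "steq Y Y (Id C Y) (q \<cdot> j)"
    using assms(2) unfolding sretract_def by blast
  have "steq X X (r \<cdot> (Id C Y \<cdot> i)) (r \<cdot> ((q \<cdot> j) \<cdot> i))"
    using steq_left[OF steq_right[OF jq(3) ir(1)] ir(2)] .
  moreover have "r \<cdot> ((q \<cdot> j) \<cdot> i) = (r \<cdot> q) \<cdot> (j \<cdot> i)" "Id C Y \<cdot> i = i"
    using ir(1,2) jq(1,2) by (auto simp: Hom_iff)
  ultimately have "steq X X (Id C X) ((r \<cdot> q) \<cdot> (j \<cdot> i))" using steq_trans[OF ir(3)] by simp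
  then show ?thesis
    unfolding sretract_def using Comp_in_Hom[OF ir(1) jq(1)] Comp_in_Hom[OF jq(2) ir(2)] by blast
qed

text \<open>A mapping cylinder: Q is the biproduct of L with an injective object I that contains X,
  and m consists of e and that embedding. The summand I is invisible stably.\<close>

lemma mono_replacement:
  assumes e: "e \<in> Hom C X L"
  obtains Q m r j where "m \<in> Hom C X Q" "mono_arr C m" "r \<in> Hom C Q L" "j \<in> Hom C L Q"
    "r \<cdot> m = e" "r \<cdot> j = Id C L" "steq Q Q (Id C Q) (j \<cdot> r)"
proof -
  have O: "X \<in> Obj C" "L \<in> Obj C" using e Hom_Obj by auto
  obtain \<iota> \<pi> I S where s: "ses C \<iota> \<pi> X I S" and I: "injective_object C I"
    using injective_ses O by metis
  note h = ses_Hom[OF s]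
  obtain Q a b p q where ab: "a \<in> Hom C L Q" "b \<in> Hom C I Q"
    "p \<in> Hom C Q L" "q \<in> Hom C Q I" and eq: "p \<cdot> a = Id C L" "q \<cdot> b = Id C I"
    "p \<cdot> b = Zero C I L" "q \<cdot> a = Zero C L I" "a \<cdot> p \<oplus> b \<cdot> q = Id C Q"
    using biproduct[OF O(2) h(4)] by metis
  define m where "m = a \<cdot> e \<oplus> b \<cdot> \<iota>"
  have m: "m \<in> Hom C X Q" unfolding m_def using e h ab by (simp add: Hom_iff)
  have "p \<cdot> m = p \<cdot> (a \<cdot> e) \<oplus> p \<cdot> (b \<cdot> \<iota>)"
    unfolding m_def using e h ab by (subst Comp_Add(1)) (simp_all add: Hom_iff)
  also have "\<dots> = (p \<cdot> a) \<cdot> e \<oplus> (p \<cdot> b) \<cdot> \<iota>" using e h ab by (simp add: Hom_iff)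
  also have "\<dots> = e" unfolding eq using e h O by (simp add: Hom_iff)
  finally have pm: "p \<cdot> m = e" .
  have "q \<cdot> m = q \<cdot> (a \<cdot> e) \<oplus> q \<cdot> (b \<cdot> \<iota>)"
    unfolding m_def using e h ab by (subst Comp_Add(1)) (simp_all add: Hom_iff)
  also have "\<dots> = (q \<cdot> a) \<cdot> e \<oplus> (q \<cdot> b) \<cdot> \<iota>" using e h ab by (simp add: Hom_iff)
  also have "\<dots> = \<iota>" unfolding eq using e h O by (simp add: Hom_iff)
  finally have qm: "q \<cdot> m = \<iota>" .
  have "mono_arr C m"
  proof (rule mono_arrI[OF m])
    fix W g assume g: "g \<in> Hom C W X" "m \<cdot> g = Zero C W Q"
    have "\<iota> \<cdot> g = q \<cdot> (m \<cdot> g)" using Comp_assoc[OF g(1) m ab(4)] qm by simp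
    also have "\<dots> = Zero C W I" unfolding g(2) using ab(4) Hom_Obj[OF g(1)] by (simp add: Hom_iff)
    finally show "g = Zero C W X" using mono_zero[OF ses_mono[OF s] h(1) g(1)] by simp
  qed
  moreover have "steq Q Q (Id C Q) (a \<cdot> p)"
    using steqI[OF eq(5)[symmetric] Comp_in_Hom[OF ab(3,1)] Comp_in_Hom[OF ab(4,2)] nullI[OF I ab(4,2)]] .
  ultimately show ?thesis using that[OF m _ ab(3,1) pm eq(1)] by blast
qed

text \<open>The dual of Schanuel's lemma: in the stable category \<open>Y\<close> is the suspension of \<open>K\<close>.\<close>

lemma schanuel:
  assumes s: "ses C \<kappa> \<tau> K J Y" "injective_object C J" and s': "ses C \<iota> \<pi> K I S" "injective_object C I"
  shows "sretract Y S"
proof -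
  note h = ses_Hom[OF s(1)] ses_Hom[OF s'(1)]
  obtain u where u: "u \<in> Hom C J I" "u \<cdot> \<kappa> = \<iota>"
    using injective_extend[OF s'(2) ses_mono[OF s(1)] h(1,6)] .
  obtain v where v: "v \<in> Hom C I J" "v \<cdot> \<iota> = \<kappa>"
    using injective_extend[OF s(2) ses_mono[OF s'(1)] h(6,1)] .
  have "(\<pi> \<cdot> u) \<cdot> \<kappa> = Zero C K S" using Comp_assoc[OF h(1) u(1) h(7)] u(2) ses_zero[OF s'(1)] by simp
  then obtain f where f: "f \<in> Hom C Y S" "f \<cdot> \<tau> = \<pi> \<cdot> u"
    using ses_colift[OF s(1) Comp_in_Hom[OF u(1) h(7)]] by blast
  have "(\<tau> \<cdot> v) \<cdot> \<iota> = Zero C K Y" using Comp_assoc[OF h(6) v(1) h(2)] v(2) ses_zero[OF s(1)] by simp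
  then obtain g where g: "g \<in> Hom C S Y" "g \<cdot> \<pi> = \<tau> \<cdot> v"
    using ses_colift[OF s'(1) Comp_in_Hom[OF v(1) h(2)]] by blast
  have vu: "v \<cdot> u \<in> Hom C J J" using Comp_in_Hom u v by blast
  \<comment> \<open>The identity of J and v u agree on K, so they differ by m \<tau>. On Y this
    difference becomes \<tau> m, which factors through J and is null.\<close>
  have "Id C J \<cdot> \<kappa> = (v \<cdot> u) \<cdot> \<kappa>"
    using Comp_assoc[OF h(1) u(1) v(1)] u(2) v(2) h(1) by (simp add: Hom_iff)
  then obtain m where m: "m \<in> Hom C Y J" "Id C J = v \<cdot> u \<oplus> m \<cdot> \<tau>"
    using ses_colift_diff[OF s(1) Id_in_Hom[OF h(4)] vu] by blast
  have "(g \<cdot> f \<oplus> \<tau> \<cdot> m) \<cdot> \<tau> = g \<cdot> (f \<cdot> \<tau>) \<oplus> \<tau> \<cdot> (m \<cdot> \<tau>)"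
    using h f(1) g(1) m(1) by (simp add: Hom_iff)
  also have "g \<cdot> (f \<cdot> \<tau>) = \<tau> \<cdot> (v \<cdot> u)"
    unfolding f(2) using Comp_assoc[OF u(1) h(7) g(1)] Comp_assoc[OF u(1) v(1) h(2)] g(2) by simp
  also have "\<tau> \<cdot> (v \<cdot> u) \<oplus> \<tau> \<cdot> (m \<cdot> \<tau>) = \<tau> \<cdot> Id C J"
    unfolding m(2) using h vu m(1) by (subst Comp_Add(1)) (simp_all add: Hom_iff)
  also have "\<dots> = Id C Y \<cdot> \<tau>" using h by (simp add: Hom_iff)
  finally have e: "(g \<cdot> f \<oplus> \<tau> \<cdot> m) \<cdot> \<tau> = Id C Y \<cdot> \<tau>" .
  have gf: "g \<cdot> f \<in> Hom C Y Y" "\<tau> \<cdot> m \<in> Hom C Y Y" using Comp_in_Hom f g m h by blast+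
  then have "g \<cdot> f \<oplus> \<tau> \<cdot> m \<in> Hom C Y Y" by (simp add: Hom_iff)
  then have "Id C Y = g \<cdot> f \<oplus> \<tau> \<cdot> m"
    using epi_cancel[OF ses_epi[OF s(1)] h(2) _ Id_in_Hom[OF h(5)] e] by simp
  then have "steq Y Y (Id C Y) (g \<cdot> f)" using steqI gf nullI[OF s(2) m(1) h(2)] by blast
  then show ?thesis unfolding sretract_def using f(1) g(1) by blast
qed

section \<open>Vanishing of Ext compared with vanishing in the stable category\<close>

lemma null_if_ext_zero:
  assumes s: "ses C \<iota> \<pi> X I S" "injective_object C I" and "ext_zero C S Y" "f \<in> Hom C X Y"
  shows "null f"
proof -
  obtain g where "g \<in> Hom C I Y" "g \<cdot> \<iota> = f" using ext_extend[OF assms(3) s(1) assms(4)] .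
  then show ?thesis using nullI[OF s(2) ses_Hom(1)[OF s(1)]] by blast
qed

text \<open>The shift in the first variable. Lift b to g : J -> B; on X it takes values in Y, and
  the resulting null arrow X -> Y extends to z : J -> Y. Then g - i z kills X and descends to a
  section S -> B.\<close>

lemma ext_zero_if_null:
  assumes s: "ses C a b X J S" and "ext_zero C J Y" and n: "\<And>f. f \<in> Hom C X Y \<Longrightarrow> null f"
  shows "ext_zero C S Y"
  unfolding ext_zero_def
proof (intro allI impI)
  fix i p B assume e: "ses C i p Y B S"
  note h = ses_Hom[OF s] ses_Hom[OF e]
  obtain g where g: "g \<in> Hom C J B" "p \<cdot> g = b" using ext_lift[OF assms(2) e h(2)] .
  have "p \<cdot> (g \<cdot> a) = Zero C X S" using Comp_assoc[OF h(1) g(1) h(7)] g(2) ses_zero[OF s] by simp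
  then obtain y where y: "y \<in> Hom C X Y" "i \<cdot> y = g \<cdot> a"
    using ses_lift[OF e Comp_in_Hom[OF h(1) g(1)]] by blast
  obtain z where z: "z \<in> Hom C J Y" "z \<cdot> a = y"
    using null_extend[OF n[OF y(1)] y(1) h(1) ses_mono[OF s]] by metis
  have "g \<cdot> a = (i \<cdot> z) \<cdot> a" using Comp_assoc[OF h(1) z(1) h(6)] z(2) y(2) by simp
  then obtain t where t: "t \<in> Hom C S B" "g = i \<cdot> z \<oplus> t \<cdot> b"
    using ses_colift_diff[OF s g(1) Comp_in_Hom[OF z(1) h(6)]] by blast
  have "p \<cdot> g = p \<cdot> (i \<cdot> z) \<oplus> p \<cdot> (t \<cdot> b)"
    unfolding t(2) using h z(1) t(1) by (intro Comp_Add(1)) (simp_all add: Hom_iff)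
  also have "\<dots> = (p \<cdot> i) \<cdot> z \<oplus> (p \<cdot> t) \<cdot> b" using h z(1) t(1) by (simp add: Hom_iff)
  also have "\<dots> = (p \<cdot> t) \<cdot> b" unfolding ses_zero[OF e] using h z(1) t(1) by (simp add: Hom_iff)
  finally have "(p \<cdot> t) \<cdot> b = Id C S \<cdot> b" using g(2) h by (simp add: Hom_iff)
  then have "p \<cdot> t = Id C S"
    using epi_cancel[OF ses_epi[OF s] h(2) Comp_in_Hom[OF t(1) h(7)] Id_in_Hom[OF h(5)]] by simp
  then show "\<exists>s \<in> Hom C S B. p \<cdot> s = Id C S" using t(1) by blast
qed

lemma null_if_ext_zero':
  assumes s: "ses C \<iota> \<pi> Y I S" "injective_object C I" and "ext_zero C X Y" "f \<in> Hom C X S"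
  shows "null f"
proof -
  obtain g where "g \<in> Hom C X I" "\<pi> \<cdot> g = f" using ext_lift[OF assms(3) s(1) assms(4)] .
  then show ?thesis using nullI[OF s(2) _ ses_Hom(2)[OF s(1)]] by blast
qed

text \<open>The shift in the second variable: a null arrow to S lifts to I by
  \<open>null_lift\<close>, which is what \<open>ext_zero_if_lift\<close> asks for.\<close>

lemma ext_zero_if_null':
  assumes s: "ses C \<iota> \<pi> Y I S" "injective_object C I"
    and "\<And>J. injective_object C J \<Longrightarrow> ext_zero C J Y" and n: "\<And>f. f \<in> Hom C X S \<Longrightarrow> null f"
  shows "ext_zero C X Y"
  using ext_zero_if_lift[OF s] null_lift[OF n _ s(1) assms(3)] by metis

end

section \<open>Injective cotorsion pairs\<close>

context abelian_inj
begin

abbreviation icp where "icp \<equiv> injective_cotorsion_pair C"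

lemma icp_Obj:
  assumes "icp \<W> \<F>"
  shows "\<W> \<subseteq> Obj C" "\<F> \<subseteq> Obj C"
  using assms
  unfolding injective_cotorsion_pair_def complete_cotorsion_pair_def cotorsion_pair_def by blast+

lemma icp_ext:
  assumes "icp \<W> \<F>" "X \<in> \<W>" "Y \<in> \<F>"
  shows "ext_zero C X Y"
proof -
  have O: "X \<in> Obj C" "Y \<in> Obj C" using icp_Obj[OF assms(1)] assms(2,3) by auto
  have "\<F> = {Y \<in> Obj C. \<forall>X \<in> \<W>. Ext1_vanishes C X Y}"
    using assms(1)
    unfolding injective_cotorsion_pair_def complete_cotorsion_pair_def cotorsion_pair_def by blast
  then have "Ext1_vanishes C X Y" using assms(2,3) by blast
  then show ?thesis using Ext1_vanishes_iff[OF O] by simp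
qed

lemma icp_right_eq:
  assumes "icp \<W> \<F>"
  shows "\<F> = {Y \<in> Obj C. \<forall>X \<in> \<W>. ext_zero C X Y}"
proof -
  have "\<F> = {Y \<in> Obj C. \<forall>X \<in> \<W>. Ext1_vanishes C X Y}"
    using assms
    unfolding injective_cotorsion_pair_def complete_cotorsion_pair_def cotorsion_pair_def by blast
  also have "\<dots> = {Y \<in> Obj C. \<forall>X \<in> \<W>. ext_zero C X Y}"
    using Ext1_vanishes_iff icp_Obj[OF assms] by blast
  finally show ?thesis .
qed

lemma icp_left_eq:
  assumes "icp \<W> \<F>"
  shows "\<W> = {X \<in> Obj C. \<forall>Y \<in> \<F>. ext_zero C X Y}"
proof -
  have "\<W> = {X \<in> Obj C. \<forall>Y \<in> \<F>. Ext1_vanishes C X Y}"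
    using assms
    unfolding injective_cotorsion_pair_def complete_cotorsion_pair_def cotorsion_pair_def by blast
  also have "\<dots> = {X \<in> Obj C. \<forall>Y \<in> \<F>. ext_zero C X Y}"
    using Ext1_vanishes_iff icp_Obj[OF assms] by blast
  finally show ?thesis .
qed

lemma icp_mem_right: "icp \<W> \<F> \<Longrightarrow> Y \<in> Obj C \<Longrightarrow> (\<And>X. X \<in> \<W> \<Longrightarrow> ext_zero C X Y) \<Longrightarrow> Y \<in> \<F>"
  using icp_right_eq by blast

lemma icp_approx_left:
  assumes "icp \<W> \<F>" "M \<in> Obj C"
  obtains i p K V where "ses C i p K V M" "K \<in> \<F>" "V \<in> \<W>"
proof -
  obtain i p where "short_exact C i p" "Dom C i \<in> \<F>" "Dom C p \<in> \<W>" "Cod C p = M"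
    using assms unfolding injective_cotorsion_pair_def complete_cotorsion_pair_def by blast
  then show ?thesis using that unfolding short_exact_ses by metis
qed

lemma icp_approx_right:
  assumes "icp \<W> \<F>" "M \<in> Obj C"
  obtains i p Q V where "ses C i p M Q V" "Q \<in> \<F>" "V \<in> \<W>"
proof -
  obtain i p where "short_exact C i p" "Dom C i = M" "Dom C p \<in> \<F>" "Cod C p \<in> \<W>"
    using assms unfolding injective_cotorsion_pair_def complete_cotorsion_pair_def by blast
  then show ?thesis using that unfolding short_exact_ses by metis
qed

lemma icp_injective:
  assumes "icp \<W> \<F>"
  shows "injective_object C I \<Longrightarrow> I \<in> \<W>" "injective_object C I \<Longrightarrow> I \<in> \<F>"
    and "X \<in> \<W> \<Longrightarrow> X \<in> \<F> \<Longrightarrow> injective_object C X"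
  using assms unfolding injective_cotorsion_pair_def by blast+

lemma icp_injective_ext: "icp \<W> \<F> \<Longrightarrow> Y \<in> \<F> \<Longrightarrow> injective_object C J \<Longrightarrow> ext_zero C J Y"
  using icp_ext icp_injective by blast

lemma icp_thick:
  assumes "icp \<W> \<F>" "ses C i p X Y Z"
  shows "X \<in> \<W> \<Longrightarrow> Y \<in> \<W> \<Longrightarrow> Z \<in> \<W>" "X \<in> \<W> \<Longrightarrow> Z \<in> \<W> \<Longrightarrow> Y \<in> \<W>"
    "Y \<in> \<W> \<Longrightarrow> Z \<in> \<W> \<Longrightarrow> X \<in> \<W>"
proof -
  have d: "short_exact C i p" "Dom C i = X" "Dom C p = Y" "Cod C p = Z"
    using assms(2) by (simp_all add: ses_def Hom_iff)
  have "thick_class C \<W>" using assms(1) unfolding injective_cotorsion_pair_def by simp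
  then have *: "(Dom C i \<in> \<W> \<and> Dom C p \<in> \<W> \<longrightarrow> Cod C p \<in> \<W>) \<and>
        (Dom C i \<in> \<W> \<and> Cod C p \<in> \<W> \<longrightarrow> Dom C p \<in> \<W>) \<and>
        (Dom C p \<in> \<W> \<and> Cod C p \<in> \<W> \<longrightarrow> Dom C i \<in> \<W>)"
    using d(1) unfolding thick_class_def by blast
  show "X \<in> \<W> \<Longrightarrow> Y \<in> \<W> \<Longrightarrow> Z \<in> \<W>" "X \<in> \<W> \<Longrightarrow> Z \<in> \<W> \<Longrightarrow> Y \<in> \<W>"
    "Y \<in> \<W> \<Longrightarrow> Z \<in> \<W> \<Longrightarrow> X \<in> \<W>"
    using *[unfolded d] by blast+
qed

section \<open>Closure properties of the two classes of an injective cotorsion pair\<close>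

lemma icp_sretract: "icp \<W> \<F> \<Longrightarrow> sretract X Y \<Longrightarrow> Y \<in> \<F> \<Longrightarrow> X \<in> Obj C \<Longrightarrow> X \<in> \<F>"
  using icp_mem_right ext_zero_sretract icp_ext by metis

text \<open>The pair is hereditary: by thickness, kernels of epimorphisms within \<open>\<W>\<close>
  stay in \<open>\<W>\<close>. Given an extension E of U by Z, cover E by V in \<open>\<W>\<close>
  with kernel K, and let L be the preimage of Z in V, the kernel of V -> U. The arrow L -> Z lifts
  to Y and then extends to V; composed with y it kills K and descends to a retraction E ->
  Z.\<close>

lemma icp_right_cokernel:
  assumes c: "icp \<W> \<F>" and s: "ses C x y X Y Z" and "X \<in> \<F>" "Y \<in> \<F>"
  shows "Z \<in> \<F>"
proof (rule icp_mem_right[OF c ses_Hom(5)[OF s]], rule ext_zeroI)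
  fix U i p E assume U: "U \<in> \<W>" and e: "ses C i p Z E U"
  obtain k q K V where v: "ses C k q K V E" "K \<in> \<F>" "V \<in> \<W>"
    using icp_approx_left[OF c ses_Hom(4)[OF e]] .
  obtain L l k' g where l: "ses C l (p \<cdot> q) L V U" "ses C k' g K L Z" "l \<cdot> k' = k" "q \<cdot> l = i \<cdot> g"
    using ses_subobject[OF v(1) e] .
  note h = ses_Hom[OF s] ses_Hom[OF e] and hv = ses_Hom[OF v(1)] and hl = ses_Hom[OF l(1)] ses_Hom[OF l(2)]
  have "L \<in> \<W>" using icp_thick(3)[OF c l(1) v(3) U] .
  then obtain g' where g': "g' \<in> Hom C L Y" "y \<cdot> g' = g"
    using ext_lift[OF icp_ext[OF c _ assms(3)] s hl(7)] by blast
  obtain v' where v': "v' \<in> Hom C V Y" "v' \<cdot> l = g'"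
    using ext_extend[OF icp_ext[OF c U assms(4)] l(1) g'(1)] .
  have yl: "(y \<cdot> v') \<cdot> l = g" using Comp_assoc[OF hl(1) v'(1) h(2)] v'(2) g'(2) by simp
  have yv: "y \<cdot> v' \<in> Hom C V Z" using Comp_in_Hom v' h by blast
  have "(y \<cdot> v') \<cdot> k = Zero C K Z"
    using Comp_assoc[OF hl(6,1) yv] yl l(3) ses_zero[OF l(2)] by simp
  then obtain r where r: "r \<in> Hom C E Z" "r \<cdot> q = y \<cdot> v'" using ses_colift[OF v(1) yv] by blast
  have "(r \<cdot> i) \<cdot> g = r \<cdot> (q \<cdot> l)" using Comp_assoc[OF hl(7) h(6) r(1)] l(4) by simp
  also have "\<dots> = Id C Z \<cdot> g" using Comp_assoc[OF hl(1) hv(2) r(1)] r(2) yl hl(7) by (simp add: Hom_iff)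
  finally have "r \<cdot> i = Id C Z"
    using epi_cancel[OF ses_epi[OF l(2)] hl(7) Comp_in_Hom[OF h(6) r(1)] Id_in_Hom[OF h(5)]] by simp
  then show "\<exists>r \<in> Hom C E Z. r \<cdot> i = Id C Z" using r(1) by blast
qed

text \<open>For an extension E of U by Y, divide by X. Over E / X a section exists because Z is in
  \<open>\<F>\<close>, and it lifts to E because X is.\<close>

lemma icp_right_extension:
  assumes c: "icp \<W> \<F>" and s: "ses C x y X Y Z" and "X \<in> \<F>" "Z \<in> \<F>"
  shows "Y \<in> \<F>"
proof (rule icp_mem_right[OF c ses_Hom(4)[OF s]])
  fix U assume U: "U \<in> \<W>"
  show "ext_zero C U Y"
    unfolding ext_zero_def
  proof (intro allI impI)
    fix i p E assume e: "ses C i p Y E U"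
    obtain D t i' p' where d: "ses C (i \<cdot> x) t X E D" "ses C i' p' Z D U" "t \<cdot> i = i' \<cdot> y" "p' \<cdot> t = p"
      using ses_quotient[OF s e] .
    note h = ses_Hom[OF d(1)] ses_Hom[OF d(2)]
    obtain a where a: "a \<in> Hom C U D" "p' \<cdot> a = Id C U"
      using icp_ext[OF c U assms(4)] d(2) unfolding ext_zero_def by blast
    obtain b where b: "b \<in> Hom C U E" "t \<cdot> b = a"
      using ext_lift[OF icp_ext[OF c U assms(3)] d(1) a(1)] .
    have "p \<cdot> b = Id C U" using Comp_assoc[OF b(1) h(2,7)] b(2) a(2) d(4) by simp
    then show "\<exists>s \<in> Hom C U E. p \<cdot> s = Id C U" using b(1) by blast
  qed
qed

text \<open>Thickness keeps the cosyzygy S of X in \<open>\<W>\<close>, so the arrow extends to the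
  injective object I.\<close>

lemma icp_null:
  assumes c: "icp \<W> \<F>" and "X \<in> \<W>" "Y \<in> \<F>" "f \<in> Hom C X Y"
  shows "null f"
proof -
  obtain \<iota> \<pi> I S where s: "ses C \<iota> \<pi> X I S" "injective_object C I"
    using injective_ses Hom_Obj(1)[OF assms(4)] .
  have "S \<in> \<W>" using icp_thick(1)[OF c s(1) assms(2)] icp_injective(1)[OF c s(2)] by simp
  then show ?thesis using null_if_ext_zero[OF s icp_ext[OF c _ assms(3)] assms(4)] by blast
qed

lemma icp_susp:
  assumes c: "icp \<W> \<F>" and "X \<in> \<F>"
  obtains \<iota> \<pi> I S where "ses C \<iota> \<pi> X I S" "injective_object C I" "S \<in> \<F>"
proof -
  have "X \<in> Obj C" using icp_Obj[OF c] assms(2) by blast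
  then obtain \<iota> \<pi> I S where s: "ses C \<iota> \<pi> X I S" "injective_object C I" using injective_ses by blast
  then show ?thesis using that icp_right_cokernel[OF c s(1) assms(2)] icp_injective(2)[OF c s(2)] by blast
qed

text \<open>A left approximation J of Y is an extension of Y by an object of \<open>\<F>\<close>, so
  it lies in both classes and is injective. This gives \<open>\<F>\<close> enough projectives as a
  Frobenius category.\<close>

lemma icp_desusp:
  assumes c: "icp \<W> \<F>" and "Y \<in> \<F>"
  obtains \<kappa> \<tau> K J where "ses C \<kappa> \<tau> K J Y" "injective_object C J" "K \<in> \<F>"
proof -
  have "Y \<in> Obj C" using icp_Obj[OF c] assms(2) by blast
  then obtain \<kappa> \<tau> K J where s: "ses C \<kappa> \<tau> K J Y" "K \<in> \<F>" "J \<in> \<W>"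
    using icp_approx_left[OF c] by blast
  then show ?thesis
    using that icp_right_extension[OF c s(1,2) assms(2)] icp_injective(3)[OF c s(3)] by blast
qed


section \<open>Stably thick classes and approximations\<close>

text \<open>Conditions of a thick subcategory, read in \<open>C\<close>: the injectives are the
  stable zero objects, and the suspension may be formed with any sequence X -> I -> S, not only with
  a chosen one. Cones are dealt with in \<open>stable_thick_subcategoryI\<close>, through
  extensions.\<close>

definition stable_thick :: "'a set \<Rightarrow> 'a set \<Rightarrow> bool" where
  "stable_thick \<F> T \<longleftrightarrow> T \<subseteq> \<F> \<and> (\<forall>I. injective_object C I \<longrightarrow> I \<in> T) \<and>
     (\<forall>X \<in> \<F>. \<forall>Y \<in> T. sretract X Y \<longrightarrow> X \<in> T) \<and>
     (\<forall>\<iota> \<pi> X I S. ses C \<iota> \<pi> X I S \<longrightarrow> injective_object C I \<longrightarrow> X \<in> \<F> \<longrightarrow> S \<in> \<F> \<longrightarrow> (X \<in> T \<longleftrightarrow> S \<in> T))"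

text \<open>A universal arrow of the stable category in terms of representatives. By additivity,
  uniqueness of the factorization becomes the statement that composition with e detects null
  arrows.\<close>

definition reflection :: "'a set \<Rightarrow> 'a \<Rightarrow> 'a \<Rightarrow> 'b \<Rightarrow> bool" where
  "reflection T X L e \<longleftrightarrow> L \<in> T \<and> e \<in> Hom C X L \<and>
     (\<forall>Y \<in> T. (\<forall>f \<in> Hom C X Y. \<exists>g \<in> Hom C L Y. steq X Y (g \<cdot> e) f) \<and>
              (\<forall>g \<in> Hom C L Y. null (g \<cdot> e) \<longrightarrow> null g))"

definition coreflection :: "'a set \<Rightarrow> 'a \<Rightarrow> 'a \<Rightarrow> 'b \<Rightarrow> bool" where
  "coreflection T X G e \<longleftrightarrow> G \<in> T \<and> e \<in> Hom C G X \<and>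
     (\<forall>Y \<in> T. (\<forall>f \<in> Hom C Y X. \<exists>g \<in> Hom C Y G. steq Y X (e \<cdot> g) f) \<and>
              (\<forall>g \<in> Hom C Y G. null (e \<cdot> g) \<longrightarrow> null g))"

lemma icp_stable_thick:
  assumes c: "icp \<W> \<F>" and c': "icp \<W>' \<F>'" and sub: "\<F>' \<subseteq> \<F>"
  shows "stable_thick \<F> \<F>'"
  unfolding stable_thick_def
proof (intro conjI allI ballI impI sub)
  fix I assume "injective_object C I" then show "I \<in> \<F>'" using icp_injective(2)[OF c'] by blast
next
  fix X Y assume "X \<in> \<F>" "Y \<in> \<F>'" "sretract X Y"
  then show "X \<in> \<F>'" using icp_sretract[OF c'] icp_Obj[OF c] by blast
next
  fix \<iota> \<pi> X I S assume s: "ses C \<iota> \<pi> X I S" "injective_object C I" and XS: "X \<in> \<F>" "S \<in> \<F>"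
  show "X \<in> \<F>' \<longleftrightarrow> S \<in> \<F>'"
  proof
    assume "X \<in> \<F>'"
    then show "S \<in> \<F>'" using icp_right_cokernel[OF c' s(1)] icp_injective(2)[OF c' s(2)] by blast
  next
    assume S: "S \<in> \<F>'"
    show "X \<in> \<F>'"
    proof (rule icp_mem_right[OF c' ses_Hom(3)[OF s(1)]])
      fix U assume U: "U \<in> \<W>'"
      \<comment> \<open>Ext(U, X) is governed by the arrows from U to S, and these go from
        \<open>\<W>'\<close> to \<open>\<F>'\<close>, so they are null.\<close>
      show "ext_zero C U X"
        using ext_zero_if_null'[OF s icp_injective_ext[OF c XS(1)] icp_null[OF c' U S]] .
    qed
  qed
qed

text \<open>A right approximation X -> L with cokernel V in \<open>\<W>\<close> is universal: arrows
  to \<open>\<F>\<close> extend over L because Ext(V, -) vanishes there. If g e is null, subtract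
  from g a null extension of g e; the rest factors through V and is null by
  \<open>icp_null\<close>.\<close>

lemma icp_reflection:
  assumes c: "icp \<W> \<F>" and "X \<in> Obj C"
  obtains L e where "reflection \<F> X L e"
proof -
  obtain e q L V where s: "ses C e q X L V" and L: "L \<in> \<F>" "V \<in> \<W>"
    using icp_approx_right[OF c assms(2)] .
  note h = ses_Hom[OF s]
  have "\<exists>g \<in> Hom C L Y. steq X Y (g \<cdot> e) f" if "Y \<in> \<F>" "f \<in> Hom C X Y" for Y f
    using ext_extend[OF icp_ext[OF c L(2) that(1)] s that(2)] steq_refl[OF that(2)] by metis
  moreover have "null g" if Y: "Y \<in> \<F>" "g \<in> Hom C L Y" "null (g \<cdot> e)" for Y g
  proof -
    obtain n where n: "n \<in> Hom C L Y" "null n" "n \<cdot> e = g \<cdot> e"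
      using null_extend[OF Y(3) Comp_in_Hom[OF h(1) Y(2)] h(1) ses_mono[OF s]] .
    obtain u where u: "u \<in> Hom C V Y" "g = n \<oplus> u \<cdot> q"
      using ses_colift_diff[OF s Y(2) n(1) n(3)[symmetric]] .
    have "null (u \<cdot> q)" using null_comp'[OF icp_null[OF c L(2) Y(1) u(1)] u(1) h(2)] .
    then show ?thesis unfolding u(2) using null_Add[OF n(2) _ n(1) Comp_in_Hom[OF h(2) u(1)]] by blast
  qed
  ultimately show ?thesis using that L(1) h(1) unfolding reflection_def by blast
qed

text \<open>A left approximation G -> X for the second pair is universal by the dual argument. Its
  kernel lies in \<open>\<F>' \<subseteq> \<F>\<close>, so G is an extension within
  \<open>\<F>\<close> and stays in \<open>\<F>\<close>.\<close>

lemma icp_coreflection: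
  assumes c: "icp \<W> \<F>" and c2: "icp \<W>' \<F>'" and sub: "\<F>' \<subseteq> \<F>" and X: "X \<in> \<F>"
  obtains G e where "coreflection (\<W>' \<inter> \<F>) X G e"
proof -
  have "X \<in> Obj C" using X icp_Obj[OF c] by blast
  then obtain i e K G where s: "ses C i e K G X" and K: "K \<in> \<F>'" "G \<in> \<W>'"
    using icp_approx_left[OF c2] by blast
  note h = ses_Hom[OF s]
  have G: "G \<in> \<F>" using icp_right_extension[OF c s _ X] K sub by blast
  have "\<exists>g \<in> Hom C Y G. steq Y X (e \<cdot> g) f" if "Y \<in> \<W>'" "f \<in> Hom C Y X" for Y f
    using ext_lift[OF icp_ext[OF c2 that(1) K(1)] s that(2)] steq_refl[OF that(2)] by metis
  moreover have "null g" if Y: "Y \<in> \<W>'" "g \<in> Hom C Y G" "null (e \<cdot> g)" for Y g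
  proof -
    obtain n where n: "n \<in> Hom C Y G" "null n" "e \<cdot> n = e \<cdot> g"
      using null_lift[OF Y(3) Comp_in_Hom[OF Y(2) h(2)] s icp_injective_ext[OF c2 K(1)]] .
    obtain u where u: "u \<in> Hom C Y K" "g = n \<oplus> i \<cdot> u"
      using ses_lift_diff[OF s Y(2) n(1) n(3)[symmetric]] .
    have "null (i \<cdot> u)" using null_comp[OF icp_null[OF c2 Y(1) K(1) u(1)] u(1) h(1)] .
    then show ?thesis unfolding u(2) using null_Add[OF n(2) _ n(1) Comp_in_Hom[OF u(1) h(1)]] by blast
  qed
  ultimately show ?thesis using that K(2) G h(2) unfolding coreflection_def by blast
qed

text \<open>X is a retract of an injective object I: extend to I and return along h.\<close>

lemma injective_if_null_Id:
  assumes "null (Id C X)" "X \<in> Obj C"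
  shows "injective_object C X"
  using assms(1) Id_in_Hom[OF assms(2)]
proof (rule nullE)
  fix I g h assume n: "injective_object C I" "g \<in> Hom C X I" "h \<in> Hom C I X" "Id C X = h \<cdot> g"
  have "\<exists>k \<in> Hom C (Cod C m) X. k \<cdot> m = f" if m: "mono_arr C m" and f: "f \<in> Hom C (Dom C m) X" for m f
  proof -
    have mh: "m \<in> Hom C (Dom C m) (Cod C m)" using m unfolding mono_arr_def Hom_iff by blast
    obtain k where k: "k \<in> Hom C (Cod C m) I" "k \<cdot> m = g \<cdot> f"
      using injective_extend[OF n(1) m mh Comp_in_Hom[OF f n(2)]] .
    have "(h \<cdot> k) \<cdot> m = f"
      using Comp_assoc[OF mh k(1) n(3)] Comp_assoc[OF f n(2,3)] k(2) n(4) Id_left[OF f] by simp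
    then show ?thesis using Comp_in_Hom[OF k(1) n(3)] by blast
  qed
  then show ?thesis unfolding injective_object_def using assms(2) by blast
qed

text \<open>The lift n of f q need not vanish on M, but its restriction there takes values in Y, as
  y : M -> Y. If y extends to z : Q -> Y, then n - \<iota> z is still a lift and does vanish on M,
  so it descends to V.\<close>

lemma lift_descends:
  assumes s: "ses C x q M Q V" and s': "ses C \<iota> \<pi> Y I S" and f: "f \<in> Hom C V S"
    and n: "n \<in> Hom C Q I" "\<pi> \<cdot> n = f \<cdot> q"
    and ext: "\<And>y. y \<in> Hom C M Y \<Longrightarrow> \<iota> \<cdot> y = n \<cdot> x \<Longrightarrow> \<exists>z \<in> Hom C Q Y. z \<cdot> x = y"
  obtains k where "k \<in> Hom C V I" "\<pi> \<cdot> k = f"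
proof -
  note h = ses_Hom[OF s] ses_Hom[OF s']
  have "\<pi> \<cdot> (n \<cdot> x) = f \<cdot> (q \<cdot> x)"
    using Comp_assoc[OF h(1) n(1) h(7)] Comp_assoc[OF h(1,2) f] n(2) by simp
  also have "\<dots> = Zero C M S" unfolding ses_zero[OF s] using f h by (simp add: Hom_iff)
  finally obtain y where y: "y \<in> Hom C M Y" "\<iota> \<cdot> y = n \<cdot> x"
    using ses_lift[OF s' Comp_in_Hom[OF h(1) n(1)]] by blast
  obtain z where z: "z \<in> Hom C Q Y" "z \<cdot> x = y" using ext[OF y] by blast
  have "n \<cdot> x = (\<iota> \<cdot> z) \<cdot> x" using Comp_assoc[OF h(1) z(1) h(6)] z(2) y(2) by simp
  then obtain k where k: "k \<in> Hom C V I" "n = \<iota> \<cdot> z \<oplus> k \<cdot> q"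
    using ses_colift_diff[OF s n(1) Comp_in_Hom[OF z(1) h(6)]] by blast
  have "\<pi> \<cdot> n = \<pi> \<cdot> (\<iota> \<cdot> z) \<oplus> \<pi> \<cdot> (k \<cdot> q)"
    unfolding k(2) using h z(1) k(1) by (intro Comp_Add(1)) (simp_all add: Hom_iff)
  also have "\<dots> = (\<pi> \<cdot> \<iota>) \<cdot> z \<oplus> (\<pi> \<cdot> k) \<cdot> q" using h z(1) k(1) by (simp add: Hom_iff)
  also have "\<dots> = (\<pi> \<cdot> k) \<cdot> q" unfolding ses_zero[OF s'] using h z(1) k(1) by (simp add: Hom_iff)
  finally have "(\<pi> \<cdot> k) \<cdot> q = f \<cdot> q" using n(2) by simp
  then have "\<pi> \<cdot> k = f" using epi_cancel[OF ses_epi[OF s] h(2) Comp_in_Hom[OF k(1) h(7)] f] by simp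
  then show ?thesis using that k(1) by blast
qed

end

section \<open>A stably thick class T, its left orthogonal, and the cotorsion pair of a reflective
  T\<close>

locale stable_thick_class = abelian_inj +
  fixes \<W> \<F> T :: "'a set"
  assumes pair: "injective_cotorsion_pair C \<W> \<F>" and thick: "stable_thick \<F> T"
begin

lemma T_sub: "T \<subseteq> \<F>" "X \<in> T \<Longrightarrow> X \<in> \<F>" "X \<in> T \<Longrightarrow> X \<in> Obj C"
  using thick icp_Obj[OF pair] unfolding stable_thick_def by auto

lemma T_injective: "injective_object C I \<Longrightarrow> I \<in> T"
  using thick unfolding stable_thick_def by blast

lemma T_sretract: "sretract X Y \<Longrightarrow> Y \<in> T \<Longrightarrow> X \<in> Obj C \<Longrightarrow> X \<in> T"
  using thick icp_sretract[OF pair] T_sub unfolding stable_thick_def by blast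

lemma T_susp_iff: "ses C \<iota> \<pi> X I S \<Longrightarrow> injective_object C I \<Longrightarrow> X \<in> \<F> \<Longrightarrow> S \<in> \<F> \<Longrightarrow> X \<in> T \<longleftrightarrow> S \<in> T"
  using thick unfolding stable_thick_def by blast

lemma injective_ext: "X \<in> \<F> \<Longrightarrow> injective_object C J \<Longrightarrow> ext_zero C J X"
  using icp_injective_ext[OF pair] .

lemma T_susp:
  assumes "X \<in> T"
  obtains \<iota> \<pi> I S where "ses C \<iota> \<pi> X I S" "injective_object C I" "S \<in> T"
proof -
  obtain \<iota> \<pi> I S where "ses C \<iota> \<pi> X I S" "injective_object C I" "S \<in> \<F>"
    using icp_susp[OF pair T_sub(2)[OF assms]] .
  then show ?thesis using that assms T_susp_iff T_sub by blast
qed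

lemma T_desusp:
  assumes "Y \<in> T"
  obtains \<kappa> \<tau> K J where "ses C \<kappa> \<tau> K J Y" "injective_object C J" "K \<in> T"
proof -
  obtain \<kappa> \<tau> K J where k: "ses C \<kappa> \<tau> K J Y" "injective_object C J" "K \<in> \<F>"
    using icp_desusp[OF pair T_sub(2)[OF assms]] .
  then show ?thesis using that assms T_susp_iff T_sub by blast
qed

text \<open>Formed in all of \<open>C\<close> and not inside \<open>\<F>\<close>, since it is to be
  the left-hand class of a cotorsion pair in \<open>C\<close>.\<close>

definition perp :: "'a set" where
  "perp = {X \<in> Obj C. \<forall>Y \<in> T. ext_zero C X Y}"

lemma perpD: "X \<in> perp \<Longrightarrow> Y \<in> T \<Longrightarrow> ext_zero C X Y" "X \<in> perp \<Longrightarrow> X \<in> Obj C"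
  by (simp_all add: perp_def)

lemma W_perp: "\<W> \<subseteq> perp"
  using icp_ext[OF pair] icp_Obj[OF pair] T_sub unfolding perp_def by blast

lemma perp_null:
  assumes "X \<in> perp" "Y \<in> T" "f \<in> Hom C X Y"
  shows "null f"
  using T_desusp[OF assms(2)] null_if_ext_zero'[OF _ _ perpD(1)[OF assms(1)] assms(3)] by metis

text \<open>For f : V -> S, with S a suspension of Y, the composite f q vanishes on M, so it is null
  by the detection hypothesis and lifts to I. The extension hypothesis then lets the lift descend to
  V.\<close>

lemma cokernel_perp:
  assumes s: "ses C x q M Q V"
    and ext: "\<And>Y f. Y \<in> T \<Longrightarrow> f \<in> Hom C M Y \<Longrightarrow> \<exists>g \<in> Hom C Q Y. g \<cdot> x = f"
    and nul: "\<And>Y g. Y \<in> T \<Longrightarrow> g \<in> Hom C Q Y \<Longrightarrow> null (g \<cdot> x) \<Longrightarrow> null g"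
  shows "V \<in> perp"
  unfolding perp_def
proof (intro CollectI conjI ballI)
  note h = ses_Hom[OF s]
  show "V \<in> Obj C" by (rule h)
  fix Y assume Y: "Y \<in> T"
  obtain \<iota> \<pi> I S where s': "ses C \<iota> \<pi> Y I S" and I: "injective_object C I" and S: "S \<in> T"
    using T_susp[OF Y] .
  show "ext_zero C V Y"
  proof (rule ext_zero_if_lift[OF s' I])
    fix f assume f: "f \<in> Hom C V S"
    have fq: "f \<cdot> q \<in> Hom C Q S" using Comp_in_Hom f h by blast
    have "(f \<cdot> q) \<cdot> x = Zero C M S" using Comp_assoc[OF h(1,2) f] f h ses_zero[OF s] by (simp add: Hom_iff)
    then have "null (f \<cdot> q)" using nul[OF S fq] null_Zero h(3) T_sub(3)[OF S] by simp
    then obtain n where n: "n \<in> Hom C Q I" "\<pi> \<cdot> n = f \<cdot> q"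
      using null_lift[OF _ fq s' injective_ext[OF T_sub(2)[OF Y]]] by metis
    show "\<exists>g \<in> Hom C V I. \<pi> \<cdot> g = f" using lift_descends[OF s s' f n ext[OF Y]] by metis
  qed
qed

text \<open>Lift f on A, extend this lift over B by injectivity of I, and repair the difference,
  which factors through D and lifts there.\<close>

lemma perp_extension:
  assumes s: "ses C i p A B D" and "A \<in> perp" "D \<in> perp"
  shows "B \<in> perp"
  unfolding perp_def
proof (intro CollectI conjI ballI)
  note h = ses_Hom[OF s]
  show "B \<in> Obj C" by (rule h)
  fix Y assume Y: "Y \<in> T"
  obtain \<iota> \<pi> I S where s': "ses C \<iota> \<pi> Y I S" and I: "injective_object C I" using T_susp[OF Y] .
  note h' = ses_Hom[OF s']
  show "ext_zero C B Y"
  proof (rule ext_zero_if_lift[OF s' I])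
    fix f assume f: "f \<in> Hom C B S"
    obtain n where n: "n \<in> Hom C A I" "\<pi> \<cdot> n = f \<cdot> i"
      using ext_lift[OF perpD(1)[OF assms(2) Y] s' Comp_in_Hom[OF h(1) f]] .
    obtain n' where n': "n' \<in> Hom C B I" "n' \<cdot> i = n"
      using injective_extend[OF I ses_mono[OF s] h(1) n(1)] .
    have "f \<cdot> i = (\<pi> \<cdot> n') \<cdot> i" using Comp_assoc[OF h(1) n'(1) h'(2)] n'(2) n(2) by simp
    then obtain u where u: "u \<in> Hom C D S" "f = \<pi> \<cdot> n' \<oplus> u \<cdot> p"
      using ses_colift_diff[OF s f Comp_in_Hom[OF n'(1) h'(2)]] by blast
    obtain m where m: "m \<in> Hom C D I" "\<pi> \<cdot> m = u"
      using ext_lift[OF perpD(1)[OF assms(3) Y] s' u(1)] .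
    have "\<pi> \<cdot> (n' \<oplus> m \<cdot> p) = \<pi> \<cdot> n' \<oplus> \<pi> \<cdot> (m \<cdot> p)"
      using n'(1) m(1) h h' by (intro Comp_Add(1)) (simp_all add: Hom_iff)
    also have "\<dots> = f" using Comp_assoc[OF h(2) m(1) h'(2)] u(2) m(2) by simp
    finally have "\<pi> \<cdot> (n' \<oplus> m \<cdot> p) = f" .
    moreover have "n' \<oplus> m \<cdot> p \<in> Hom C B I" using n'(1) m(1) h by (simp add: Hom_iff)
    ultimately show "\<exists>g \<in> Hom C B I. \<pi> \<cdot> g = f" by blast
  qed
qed

text \<open>All arrows from A and from B to T are null. Null arrows on A extend to B, so both
  hypotheses of \<open>cokernel_perp\<close> hold.\<close>

lemma perp_cokernel:
  assumes s: "ses C i p A B D" and "A \<in> perp" "B \<in> perp"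
  shows "D \<in> perp"
proof (rule cokernel_perp[OF s])
  fix Y f assume Y: "Y \<in> T" and f: "f \<in> Hom C A Y"
  show "\<exists>g \<in> Hom C B Y. g \<cdot> i = f"
    using null_extend[OF perp_null[OF assms(2) Y f] f ses_Hom(1)[OF s] ses_mono[OF s]] by metis
qed (use perp_null[OF assms(3)] in blast)

text \<open>Here T being closed under suspension enters: Ext(D, S) vanishes for the suspension S of
  Y, so an arrow A -> S extends to B, where it lifts to I.\<close>

lemma perp_kernel:
  assumes s: "ses C i p A B D" and "B \<in> perp" "D \<in> perp"
  shows "A \<in> perp"
  unfolding perp_def
proof (intro CollectI conjI ballI)
  note h = ses_Hom[OF s]
  show "A \<in> Obj C" by (rule h)
  fix Y assume Y: "Y \<in> T"
  obtain \<iota> \<pi> I S where s': "ses C \<iota> \<pi> Y I S" and I: "injective_object C I" and S: "S \<in> T"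
    using T_susp[OF Y] .
  show "ext_zero C A Y"
  proof (rule ext_zero_if_lift[OF s' I])
    fix f assume f: "f \<in> Hom C A S"
    obtain g where g: "g \<in> Hom C B S" "g \<cdot> i = f" using ext_extend[OF perpD(1)[OF assms(3) S] s f] .
    obtain k where k: "k \<in> Hom C B I" "\<pi> \<cdot> k = g" using ext_lift[OF perpD(1)[OF assms(2) Y] s' g(1)] .
    have "\<pi> \<cdot> (k \<cdot> i) = f" using Comp_assoc[OF h(1) k(1) ses_Hom(2)[OF s']] k(2) g(2) by simp
    then show "\<exists>g \<in> Hom C A I. \<pi> \<cdot> g = f" using Comp_in_Hom[OF h(1) k(1)] by blast
  qed
qed

lemma perp_thick: "thick_class C perp"
proof -
  have "X \<in> perp" if Y: "Y \<in> perp" and d: "direct_summand C X Y" for X Y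
  proof -
    obtain s q where sq: "s \<in> Hom C X Y" "q \<in> Hom C Y X" "q \<cdot> s = Id C X"
      using d unfolding direct_summand_def is_biproduct_def by blast
    then show ?thesis using ext_zero_retract[OF perpD(1)[OF Y] sq] Hom_Obj unfolding perp_def by blast
  qed
  moreover have "perp \<subseteq> Obj C" by (auto simp: perp_def)
  moreover have "(Dom C i \<in> perp \<and> Dom C p \<in> perp \<longrightarrow> Cod C p \<in> perp) \<and>
      (Dom C i \<in> perp \<and> Cod C p \<in> perp \<longrightarrow> Dom C p \<in> perp) \<and>
      (Dom C p \<in> perp \<and> Cod C p \<in> perp \<longrightarrow> Dom C i \<in> perp)" if "short_exact C i p" for i p
  proof -
    have s: "ses C i p (Dom C i) (Dom C p) (Cod C p)"
      using \<open>short_exact C i p\<close> unfolding short_exact_ses by simp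
    show ?thesis using perp_cokernel[OF s] perp_extension[OF s] perp_kernel[OF s] by blast
  qed
  ultimately show ?thesis unfolding thick_class_def by blast
qed

lemma perp_T: "perp \<inter> T = {I. injective_object C I}"
proof
  show "perp \<inter> T \<subseteq> {I. injective_object C I}"
    using perp_null Id_in_Hom injective_if_null_Id perpD(2) by blast
  show "{I. injective_object C I} \<subseteq> perp \<inter> T"
    using T_injective injective_ext T_sub(2) injective_Obj unfolding perp_def by blast
qed

text \<open>Reflections are given for objects of \<open>\<F>\<close>, so M is first embedded in an
  object X of \<open>\<F>\<close> with cokernel U in \<open>\<W>\<close>. From U to T there is no
  Ext and every arrow is null, so the composite M -> X -> Q inherits the extension and detection
  properties of the reflection.\<close>

lemma approx_right:
  assumes refl: "\<And>X. X \<in> \<F> \<Longrightarrow> \<exists>L e. reflection T X L e" and M: "M \<in> Obj C"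
  obtains x q Q V where "ses C x q M Q V" "Q \<in> T" "V \<in> perp"
proof -
  obtain a b X U where s: "ses C a b M X U" and X: "X \<in> \<F>" "U \<in> \<W>"
    using icp_approx_right[OF pair M] .
  obtain L e where L: "L \<in> T" "e \<in> Hom C X L"
    and ex: "\<And>Y f. Y \<in> T \<Longrightarrow> f \<in> Hom C X Y \<Longrightarrow> \<exists>g \<in> Hom C L Y. steq X Y (g \<cdot> e) f"
    and nu: "\<And>Y g. Y \<in> T \<Longrightarrow> g \<in> Hom C L Y \<Longrightarrow> null (g \<cdot> e) \<Longrightarrow> null g"
    using refl[OF X(1)] unfolding reflection_def by metis
  obtain Q m r j where m: "m \<in> Hom C X Q" "mono_arr C m" and rj: "r \<in> Hom C Q L" "j \<in> Hom C L Q"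
    "r \<cdot> m = e" "r \<cdot> j = Id C L" "steq Q Q (Id C Q) (j \<cdot> r)"
    using mono_replacement[OF L(2)] .
  have Q: "Q \<in> T" using T_sretract[OF _ L(1)] rj Hom_Obj unfolding sretract_def by blast
  note h = ses_Hom[OF s]
  have ma: "m \<cdot> a \<in> Hom C M Q" using Comp_in_Hom m h by blast
  have mono: "mono_arr C (m \<cdot> a)"
  proof (rule mono_arrI[OF ma])
    fix V g assume g: "g \<in> Hom C V M" "(m \<cdot> a) \<cdot> g = Zero C V Q"
    have "m \<cdot> (a \<cdot> g) = Zero C V Q" using Comp_assoc[OF g(1) h(1) m(1)] g(2) by simp
    then have "a \<cdot> g = Zero C V X" using mono_zero[OF m(2,1) Comp_in_Hom[OF g(1) h(1)]] by simp
    then show "g = Zero C V M" using mono_zero[OF ses_mono[OF s] h(1) g(1)] by simp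
  qed
  obtain q V where sq: "ses C (m \<cdot> a) q M Q V" using mono_ses[OF mono ma] .
  have "V \<in> perp"
  proof (rule cokernel_perp[OF sq])
    fix Y f assume Y: "Y \<in> T" and f: "f \<in> Hom C M Y"
    obtain f' where f': "f' \<in> Hom C X Y" "f' \<cdot> a = f"
      using ext_extend[OF icp_ext[OF pair X(2) T_sub(2)[OF Y]] s f] .
    obtain g where g: "g \<in> Hom C L Y" "steq X Y (g \<cdot> e) f'" using ex[OF Y f'(1)] by blast
    \<comment> \<open>The reflection yields f' only up to a null arrow n; extending n along the
      monomorphism m makes the factorization exact.\<close>
    obtain n where n: "n \<in> Hom C X Y" "null n" "f' = g \<cdot> e \<oplus> n" using steqE[OF steq_sym[OF g(2)]] .
    obtain n' where n': "n' \<in> Hom C Q Y" "n' \<cdot> m = n" using null_extend[OF n(2,1) m] by metis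
    have k: "g \<cdot> r \<oplus> n' \<in> Hom C Q Y" using g(1) rj(1) n'(1) by (simp add: Hom_iff)
    have "(g \<cdot> r \<oplus> n') \<cdot> m = g \<cdot> (r \<cdot> m) \<oplus> n' \<cdot> m" using g(1) rj(1) n'(1) m(1) by (simp add: Hom_iff)
    then have km: "(g \<cdot> r \<oplus> n') \<cdot> m = f'" unfolding rj(3) n'(2) n(3) .
    have "(g \<cdot> r \<oplus> n') \<cdot> (m \<cdot> a) = f" using Comp_assoc[OF h(1) m(1) k] km f'(2) by simp
    then show "\<exists>g \<in> Hom C Q Y. g \<cdot> (m \<cdot> a) = f" using k by blast
  next
    fix Y g assume Y: "Y \<in> T" and g: "g \<in> Hom C Q Y" and nl: "null (g \<cdot> (m \<cdot> a))"
    have gm: "g \<cdot> m \<in> Hom C X Y" using Comp_in_Hom g m by blast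
    have "null ((g \<cdot> m) \<cdot> a)" using nl Comp_assoc[OF h(1) m(1) g] by simp
    then obtain n where n: "n \<in> Hom C X Y" "null n" "n \<cdot> a = (g \<cdot> m) \<cdot> a"
      using null_extend[OF _ Comp_in_Hom[OF h(1) gm] h(1) ses_mono[OF s]] by metis
    obtain u where u: "u \<in> Hom C U Y" "g \<cdot> m = n \<oplus> u \<cdot> b"
      using ses_colift_diff[OF s gm n(1) n(3)[symmetric]] .
    have "null (u \<cdot> b)" using null_comp'[OF icp_null[OF pair X(2) T_sub(2)[OF Y] u(1)] u(1) h(2)] .
    then have gmn: "null (g \<cdot> m)"
      unfolding u(2) using null_Add[OF n(2) _ n(1) Comp_in_Hom[OF h(2) u(1)]] by blast
    \<comment> \<open>Stably g is (g j) r, so it is enough that g j is null. This arrow starts at L,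
      where the detection property of the reflection applies.\<close>
    have gj: "g \<cdot> j \<in> Hom C L Y" using Comp_in_Hom g rj by blast
    have gjr: "steq Q Y g ((g \<cdot> j) \<cdot> r)"
      using steq_left[OF rj(5) g] Id_right[OF g] Comp_assoc[OF rj(1,2) g] by simp
    have "(g \<cdot> j) \<cdot> e = ((g \<cdot> j) \<cdot> r) \<cdot> m" using Comp_assoc[OF m(1) rj(1) gj] rj(3) by simp
    then have "null ((g \<cdot> j) \<cdot> e)" using steq_null[OF steq_sym[OF steq_right[OF gjr m(1)]] gmn] by simp
    then have "null (g \<cdot> j)" using nu[OF Y gj] by blast
    then show "null g" using steq_null[OF gjr null_comp'[OF _ gj rj(1)]] by blast
  qed
  then show ?thesis using that sq Q by blast
qed

theorem reflective_icp:
  assumes refl: "\<And>X. X \<in> \<F> \<Longrightarrow> \<exists>L e. reflection T X L e"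
  shows "icp perp T"
proof -
  have R: "\<exists>i p. short_exact C i p \<and> Dom C i = M \<and> Dom C p \<in> T \<and> Cod C p \<in> perp" if "M \<in> Obj C" for M
  proof -
    obtain x q Q V where "ses C x q M Q V" "Q \<in> T" "V \<in> perp" using approx_right[OF refl \<open>M \<in> Obj C\<close>] .
    then show ?thesis unfolding ses_def Hom_iff by (intro exI[of _ x] exI[of _ q]) simp
  qed
  have L: "\<exists>i p. short_exact C i p \<and> Dom C i \<in> T \<and> Dom C p \<in> perp \<and> Cod C p = M" if M: "M \<in> Obj C" for M
  proof -
    \<comment> \<open>The left approximation U in \<open>\<W>\<close> plays the part that a
      projective cover has in Salce's trick: as \<open>\<W> \<subseteq> perp\<close>, the pushout P,
      an extension of V by U, lies in \<open>perp\<close>.\<close>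
    obtain k w K U where s: "ses C k w K U M" and U: "U \<in> \<W>" using icp_approx_left[OF pair M] .
    obtain x q Q V where s': "ses C x q K Q V" and Q: "Q \<in> T" "V \<in> perp"
      using approx_right[OF refl ses_Hom(3)[OF s]] .
    obtain P i' p' t q' where P: "ses C i' p' Q P M" "ses C t q' U P V" using ses_pushout2[OF s s'] .
    have "P \<in> perp" using perp_extension[OF P(2)] U W_perp Q by blast
    then show ?thesis
      using P(1) Q(1) unfolding ses_def Hom_iff by (intro exI[of _ i'] exI[of _ p']) simp
  qed
  have "T = {Y \<in> Obj C. \<forall>X \<in> perp. ext_zero C X Y}"
  proof
    show "T \<subseteq> {Y \<in> Obj C. \<forall>X \<in> perp. ext_zero C X Y}" using T_sub perpD by blast
    show "{Y \<in> Obj C. \<forall>X \<in> perp. ext_zero C X Y} \<subseteq> T"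
    proof clarify
      fix Y assume Y: "Y \<in> Obj C" "\<forall>X \<in> perp. ext_zero C X Y"
      \<comment> \<open>As V is in \<open>perp\<close>, this approximation of Y splits, and Y is a
        retract of Q in T.\<close>
      obtain x q Q V where s: "ses C x q Y Q V" and Q: "Q \<in> T" "V \<in> perp" using approx_right[OF refl Y(1)] .
      obtain r where r: "r \<in> Hom C Q Y" "r \<cdot> x = Id C Y"
        using ext_extend[OF _ s Id_in_Hom[OF Y(1)]] Y(2) Q(2) by blast
      then have "sretract Y Q"
        unfolding sretract_def using ses_Hom(1)[OF s] steq_refl[OF Id_in_Hom[OF Y(1)]] by metis
      then show "Y \<in> T" using T_sretract Q(1) Y(1) by blast
    qed
  qed
  then have T: "T = {Y \<in> Obj C. \<forall>X \<in> perp. Ext1_vanishes C X Y}"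
    using Ext1_vanishes_iff perpD(2) by blast
  have "perp = {X \<in> Obj C. \<forall>Y \<in> T. Ext1_vanishes C X Y}"
    unfolding perp_def using Ext1_vanishes_iff T_sub(3) by blast
  then show ?thesis
    unfolding injective_cotorsion_pair_def complete_cotorsion_pair_def cotorsion_pair_def
    using T L R perp_T perp_thick by blast
qed

end

section \<open>The right orthogonal of T inside the given class, and coreflections\<close>

context stable_thick_class
begin

text \<open>In stable terms these are the objects of \<open>\<F>\<close> that receive only null
  arrows from T; \<open>coperp_null\<close> and \<open>coperpI\<close> are the two
  directions.\<close>

definition coperp :: "'a set" where
  "coperp = {Y \<in> \<F>. \<forall>X \<in> T. ext_zero C X Y}"

lemma coperpD: "Y \<in> coperp \<Longrightarrow> Y \<in> \<F>" "Y \<in> coperp \<Longrightarrow> X \<in> T \<Longrightarrow> ext_zero C X Y"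
  by (simp_all add: coperp_def)

lemma coperp_null:
  assumes "Y \<in> coperp" "X \<in> T" "f \<in> Hom C X Y"
  shows "null f"
  using T_susp[OF assms(2)] null_if_ext_zero[OF _ _ coperpD(2)[OF assms(1)] assms(3)] by metis

text \<open>Desuspend X to K within T: then Ext(X, Y) vanishes once all arrows from K to Y are
  null.\<close>

lemma coperpI:
  assumes Y: "Y \<in> \<F>" and n: "\<And>X f. X \<in> T \<Longrightarrow> f \<in> Hom C X Y \<Longrightarrow> null f"
  shows "Y \<in> coperp"
  unfolding coperp_def
proof (intro CollectI conjI ballI Y)
  fix X assume X: "X \<in> T"
  obtain \<kappa> \<tau> K J where k: "ses C \<kappa> \<tau> K J X" "injective_object C J" "K \<in> T" using T_desusp[OF X] .
  show "ext_zero C X Y" using ext_zero_if_null[OF k(1) injective_ext[OF Y k(2)] n[OF k(3)]] .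
qed

lemma stable_thick_coperp: "stable_thick \<F> coperp"
  unfolding stable_thick_def
proof (intro conjI allI ballI impI)
  show "coperp \<subseteq> \<F>" by (auto simp: coperp_def)
next
  fix I assume "injective_object C I"
  then show "I \<in> coperp"
    using icp_injective(2)[OF pair] ext_zero_injective unfolding coperp_def by blast
next
  fix X Y assume "X \<in> \<F>" "Y \<in> coperp" "sretract X Y"
  then show "X \<in> coperp" using ext_zero_sretract unfolding coperp_def by blast
next
  fix \<iota> \<pi> X I S assume s: "ses C \<iota> \<pi> X I S" "injective_object C I" and XS: "X \<in> \<F>" "S \<in> \<F>"
  show "X \<in> coperp \<longleftrightarrow> S \<in> coperp"
  proof
    assume X: "X \<in> coperp"
    show "S \<in> coperp" using coperpI[OF XS(2)] null_if_ext_zero'[OF s coperpD(2)[OF X]] by blast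
  next
    assume S: "S \<in> coperp"
    have "ext_zero C t X" if t: "t \<in> T" for t
      using ext_zero_if_null'[OF s injective_ext[OF XS(1)] coperp_null[OF S t]] .
    then show "X \<in> coperp" using XS(1) unfolding coperp_def by blast
  qed
qed

text \<open>The cone of a coreflection; \<open>Q\<close> is stably isomorphic to \<open>X\<close>.\<close>

lemma coreflection_cone:
  assumes X: "X \<in> \<F>" and co: "coreflection T X G e"
  obtains m q Q D r j where "ses C m q G Q D" "D \<in> coperp"
    "r \<in> Hom C Q X" "j \<in> Hom C X Q" "r \<cdot> j = Id C X" "steq Q Q (Id C Q) (j \<cdot> r)"
proof -
  have G: "G \<in> T" "e \<in> Hom C G X"
    and ex: "\<And>Y f. Y \<in> T \<Longrightarrow> f \<in> Hom C Y X \<Longrightarrow> \<exists>g \<in> Hom C Y G. steq Y X (e \<cdot> g) f"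
    and nu: "\<And>Y g. Y \<in> T \<Longrightarrow> g \<in> Hom C Y G \<Longrightarrow> null (e \<cdot> g) \<Longrightarrow> null g"
    using co unfolding coreflection_def by blast+
  obtain Q m r j where m: "m \<in> Hom C G Q" "mono_arr C m" and rj: "r \<in> Hom C Q X" "j \<in> Hom C X Q"
    "r \<cdot> m = e" "r \<cdot> j = Id C X" "steq Q Q (Id C Q) (j \<cdot> r)"
    using mono_replacement[OF G(2)] .
  have Q: "Q \<in> \<F>" using icp_sretract[OF pair _ X] rj Hom_Obj unfolding sretract_def by blast
  obtain q D where s: "ses C m q G Q D" using mono_ses[OF m(2,1)] .
  note h = ses_Hom[OF s]
  have D: "D \<in> \<F>" using icp_right_cokernel[OF pair s T_sub(2)[OF G(1)] Q] .
  have "D \<in> coperp"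
  proof (rule coperpI[OF D])
    fix t f assume t: "t \<in> T" and f: "f \<in> Hom C t D"
    obtain \<kappa> \<tau> K J where k: "ses C \<kappa> \<tau> K J t" and J: "injective_object C J" and K: "K \<in> T"
      using T_desusp[OF t] .
    note hk = ses_Hom[OF k]
    \<comment> \<open>The aim is to lift f along q. On J the composite f \<tau> lifts to n, whose
      restriction to K comes from some y : K -> G. Since e y factors through J, it is null; so y is
      null and extends to J, which lets the lift descend to t.\<close>
    obtain n where n: "n \<in> Hom C J Q" "q \<cdot> n = f \<cdot> \<tau>"
      using ext_lift[OF injective_ext[OF T_sub(2)[OF G(1)] J] s Comp_in_Hom[OF hk(2) f]] .
    have ext: "\<exists>z \<in> Hom C J G. z \<cdot> \<kappa> = y" if y: "y \<in> Hom C K G" "m \<cdot> y = n \<cdot> \<kappa>" for y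
    proof -
      have "e \<cdot> y = r \<cdot> (n \<cdot> \<kappa>)" using Comp_assoc[OF y(1) m(1) rj(1)] rj(3) y(2) by simp
      then have "null (e \<cdot> y)"
        using null_comp[OF nullI[OF J hk(1) n(1)] Comp_in_Hom[OF hk(1) n(1)] rj(1)] by simp
      then show ?thesis using null_extend[OF nu[OF K y(1)] y(1) hk(1) ses_mono[OF k]] by metis
    qed
    obtain u where u: "u \<in> Hom C t Q" "q \<cdot> u = f" using lift_descends[OF k s f n ext] .
    have ru: "r \<cdot> u \<in> Hom C t X" using Comp_in_Hom u rj by blast
    \<comment> \<open>An arrow from T to X factors stably through e. As r is a stable isomorphism, u
      agrees with m g, and q kills m.\<close>
    obtain g where g: "g \<in> Hom C t G" "steq t X (e \<cdot> g) (r \<cdot> u)" using ex[OF t ru] by blast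
    have eg: "e \<cdot> g = r \<cdot> (m \<cdot> g)" using Comp_assoc[OF g(1) m(1) rj(1)] rj(3) by simp
    have mg: "m \<cdot> g \<in> Hom C t Q" using Comp_in_Hom g m by blast
    have jr: "steq t Q x (j \<cdot> (r \<cdot> x))" if x: "x \<in> Hom C t Q" for x
      using steq_right[OF rj(5) x] Id_left[OF x] Comp_assoc[OF x rj(1,2)] by simp
    have "steq t Q (j \<cdot> (r \<cdot> u)) (j \<cdot> (r \<cdot> (m \<cdot> g)))" using steq_left[OF steq_sym[OF g(2)] rj(2)] eg by simp
    then have "steq t Q u (m \<cdot> g)" using steq_trans jr[OF u(1)] steq_sym[OF jr[OF mg]] by metis
    then have "steq t D f (q \<cdot> (m \<cdot> g))" using steq_left[OF _ h(2)] u(2) by metis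
    moreover have "q \<cdot> (m \<cdot> g) = Zero C t D"
      using Comp_assoc[OF g(1) h(1,2)] ses_zero[OF s] g(1) h by (simp add: Hom_iff)
    ultimately show "null f" using steq_Zero_iff[OF f] by simp
  qed
  then show ?thesis using that s rj by blast
qed

end

locale coreflective_class = stable_thick_class +
  assumes coreflective: "\<And>X. X \<in> \<F> \<Longrightarrow> \<exists>G e. coreflection T X G e"

text \<open>The same theory for \<open>coperp\<close> in place of T. The class
  \<open>co.perp\<close>, its left orthogonal in \<open>C\<close>, becomes the left-hand class of
  the second cotorsion pair.\<close>

sublocale coreflective_class \<subseteq> co: stable_thick_class C \<W> \<F> coperp
  by unfold_locales (rule pair, rule stable_thick_coperp)

context coreflective_class
begin

text \<open>The universal arrow is X -> Q -> D. Arrows from G to \<open>coperp\<close> are null and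
  extend over Q by null arrows; after subtraction of such an extension, f r vanishes on G and
  factors through D.\<close>

lemma coperp_reflection:
  assumes X: "X \<in> \<F>"
  shows "\<exists>L e. reflection coperp X L e"
proof -
  obtain G e where co: "coreflection T X G e" using coreflective[OF X] by blast
  have G: "G \<in> T" using co unfolding coreflection_def by simp
  obtain m q Q D r j where s: "ses C m q G Q D" and D: "D \<in> coperp"
    and rj: "r \<in> Hom C Q X" "j \<in> Hom C X Q" "r \<cdot> j = Id C X" "steq Q Q (Id C Q) (j \<cdot> r)"
    using coreflection_cone[OF X co] .
  note h = ses_Hom[OF s]
  have qj: "q \<cdot> j \<in> Hom C X D" using Comp_in_Hom h rj by blast
  have ext: "\<exists>z \<in> Hom C Q Y. z \<cdot> m = y" if "Y \<in> coperp" "y \<in> Hom C G Y" for Y y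
    using null_extend[OF coperp_null[OF that(1) G that(2)] that(2) h(1) ses_mono[OF s]] by metis
  have "\<exists>g \<in> Hom C D Y. steq X Y (g \<cdot> (q \<cdot> j)) f" if Y: "Y \<in> coperp" and f: "f \<in> Hom C X Y" for Y f
  proof -
    have fr: "f \<cdot> r \<in> Hom C Q Y" "(f \<cdot> r) \<cdot> m \<in> Hom C G Y" using Comp_in_Hom f rj h by blast+
    obtain k where k: "k \<in> Hom C Q Y" "null k" "k \<cdot> m = (f \<cdot> r) \<cdot> m"
      using null_extend[OF coperp_null[OF Y G fr(2)] fr(2) h(1) ses_mono[OF s]] .
    obtain g where g: "g \<in> Hom C D Y" "f \<cdot> r = k \<oplus> g \<cdot> q"
      using ses_colift_diff[OF s fr(1) k(1) k(3)[symmetric]] .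
    have gqj: "g \<cdot> (q \<cdot> j) \<in> Hom C X Y" "k \<cdot> j \<in> Hom C X Y" using Comp_in_Hom[OF qj g(1)] Comp_in_Hom[OF rj(2) k(1)] .
    have "f = (k \<oplus> g \<cdot> q) \<cdot> j"
      using Comp_assoc[OF rj(2,1) f] rj(3) Id_right[OF f] g(2) by simp
    also have "\<dots> = k \<cdot> j \<oplus> g \<cdot> (q \<cdot> j)" using k(1) g(1) h rj(2) by (simp add: Hom_iff)
    also have "\<dots> = g \<cdot> (q \<cdot> j) \<oplus> k \<cdot> j" using gqj by (intro Add_commute) (simp_all add: Hom_iff)
    finally have "steq X Y f (g \<cdot> (q \<cdot> j))" using steqI gqj null_comp'[OF k(2,1) rj(2)] by blast
    then show ?thesis using steq_sym g(1) by blast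
  qed
  moreover have "null g" if Y: "Y \<in> coperp" and g: "g \<in> Hom C D Y" and n: "null (g \<cdot> (q \<cdot> j))" for Y g
  proof -
    have gq: "g \<cdot> q \<in> Hom C Q Y" using Comp_in_Hom g h by blast
    have "(g \<cdot> q) \<cdot> (j \<cdot> r) = (g \<cdot> (q \<cdot> j)) \<cdot> r" using g h rj(1,2) by (simp add: Hom_iff)
    then have "steq Q Y (g \<cdot> q) ((g \<cdot> (q \<cdot> j)) \<cdot> r)" using steq_left[OF rj(4) gq] Id_right[OF gq] by simp
    then have gqn: "null (g \<cdot> q)" using steq_null null_comp'[OF n Comp_in_Hom[OF qj g] rj(1)] by blast
    \<comment> \<open>That g q is null has to be transferred to g. With Y desuspended within
      \<open>coperp\<close>, g q lifts to J, and the lift descends to D because arrows from G to K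
      extend over Q.\<close>
    obtain \<kappa> \<tau> K J where k: "ses C \<kappa> \<tau> K J Y" and J: "injective_object C J" and K: "K \<in> coperp"
      using co.T_desusp[OF Y] .
    obtain n where "n \<in> Hom C Q J" "\<tau> \<cdot> n = g \<cdot> q"
      using null_lift[OF gqn gq k injective_ext[OF coperpD(1)[OF K]]] .
    then obtain l where "l \<in> Hom C D J" "\<tau> \<cdot> l = g" using lift_descends[OF s k g _ _ ext[OF K]] by metis
    then show "null g" using nullI[OF J _ ses_Hom(2)[OF k]] by blast
  qed
  ultimately have "reflection coperp X D (q \<cdot> j)" unfolding reflection_def using D qj by blast
  then show ?thesis by blast
qed

lemma coperp_icp: "icp co.perp coperp"
  using co.reflective_icp coperp_reflection by blast

text \<open>For X in the double orthogonal the arrow to the cone D is null, hence so is q. The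
  identity of Q is then m u up to a null arrow, so Q is a stable retract of G, and X of Q.\<close>

lemma perp_coperp: "co.perp \<inter> \<F> = T"
proof
  show "T \<subseteq> co.perp \<inter> \<F>" using T_sub coperpD(2) unfolding co.perp_def by blast
  show "co.perp \<inter> \<F> \<subseteq> T"
  proof clarify
    fix X assume Xp: "X \<in> co.perp" and X: "X \<in> \<F>"
    obtain G e where co: "coreflection T X G e" using coreflective[OF X] by blast
    have G: "G \<in> T" using co unfolding coreflection_def by simp
    obtain m q Q D r j where s: "ses C m q G Q D" and D: "D \<in> coperp"
      and rj: "r \<in> Hom C Q X" "j \<in> Hom C X Q" "r \<cdot> j = Id C X" "steq Q Q (Id C Q) (j \<cdot> r)"
      using coreflection_cone[OF X co] .
    note h = ses_Hom[OF s]
    have qj: "q \<cdot> j \<in> Hom C X D" using Comp_in_Hom h rj by blast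
    have "(q \<cdot> j) \<cdot> r = q \<cdot> (j \<cdot> r)" using h rj(1,2) by (simp add: Hom_iff)
    then have "steq Q D q ((q \<cdot> j) \<cdot> r)" using steq_left[OF rj(4) h(2)] Id_right[OF h(2)] by simp
    moreover have "null ((q \<cdot> j) \<cdot> r)" using null_comp'[OF co.perp_null[OF Xp D qj] qj rj(1)] .
    ultimately have "null q" using steq_null by blast
    then obtain n where n: "n \<in> Hom C Q Q" "null n" "q \<cdot> n = q"
      using null_lift[OF _ h(2) s injective_ext[OF T_sub(2)[OF G]]] by metis
    have "q \<cdot> Id C Q = q \<cdot> n" using n(3) Id_right[OF h(2)] by simp
    then obtain u where u: "u \<in> Hom C Q G" "Id C Q = n \<oplus> m \<cdot> u"
      using ses_lift_diff[OF s Id_in_Hom[OF h(4)] n(1)] by blast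
    have mu: "m \<cdot> u \<in> Hom C Q Q" using Comp_in_Hom u h by blast
    have "Id C Q = m \<cdot> u \<oplus> n"
      unfolding u(2) using n(1) mu by (intro Add_commute) (simp_all add: Hom_iff)
    then have "sretract Q G" unfolding sretract_def using steqI[OF _ mu n(1,2)] u(1) h(1) by blast
    moreover have "steq X X (Id C X) (r \<cdot> j)"
      using steq_refl[OF Id_in_Hom[OF Hom_Obj(1)[OF rj(2)]]] rj(3) by simp
    then have "sretract X Q" unfolding sretract_def using rj(1,2) by blast
    ultimately show "X \<in> T" using T_sretract[OF sretract_trans G] Hom_Obj(1)[OF rj(2)] by blast
  qed
qed

end

section \<open>Adjoints of inclusions of full subcategories\<close>

lemma full_subcat_simps [simp]:
  "Obj (full_subcat S T) = T" "Dom (full_subcat S T) = Dom S" "Cod (full_subcat S T) = Cod S"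
  "Id (full_subcat S T) = Id S" "Comp (full_subcat S T) = Comp S"
  "Arr (full_subcat S T) = {f \<in> Arr S. Dom S f \<in> T \<and> Cod S f \<in> T}"
  by (simp_all add: full_subcat_def)

lemma Hom_full_subcat [simp]:
  "X \<in> T \<Longrightarrow> Y \<in> T \<Longrightarrow> Hom (full_subcat S T) X Y = Hom S X Y"
  by (auto simp: Hom_def)

context category
begin

lemma inclusion_functor: "T \<subseteq> Obj C \<Longrightarrow> is_functor (full_subcat C T) C (\<lambda>X. X) (\<lambda>f. f)"
  unfolding is_functor_def by (auto simp: Hom_iff)

text \<open>The unit e is the image of an identity under the bijection; naturality in the second
  variable turns the bijection into composition with e.\<close>

lemma left_adjoint_reflection:
  assumes "T \<subseteq> Obj C" "has_left_adjoint (full_subcat C T) C (\<lambda>X. X) (\<lambda>f. f)" "X \<in> Obj C"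
  shows "\<exists>L \<in> T. \<exists>e \<in> Hom C X L. \<forall>Y \<in> T. \<forall>f \<in> Hom C X Y. \<exists>!g. g \<in> Hom C L Y \<and> g \<cdot> e = f"
proof -
  obtain Fo Fa where "adjoint_pair C (full_subcat C T) Fo Fa (\<lambda>X. X) (\<lambda>f. f)"
    using assms(2) unfolding has_left_adjoint_def by blast
  then obtain \<phi> where F: "is_functor C (full_subcat C T) Fo Fa"
    and bij: "\<And>X Y. X \<in> Obj C \<Longrightarrow> Y \<in> T \<Longrightarrow>
          bij_betw (\<phi> X Y) (Hom (full_subcat C T) (Fo X) Y) (Hom C X Y)"
    and nat: "\<And>f g h. f \<in> Arr C \<Longrightarrow> g \<in> Arr (full_subcat C T) \<Longrightarrow>
          h \<in> Hom (full_subcat C T) (Fo (Cod C f)) (Dom C g) \<Longrightarrow>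
          \<phi> (Dom C f) (Cod C g) (g \<cdot> (h \<cdot> Fa f)) = g \<cdot> (\<phi> (Cod C f) (Dom C g) h \<cdot> f)"
    unfolding adjoint_pair_def full_subcat_simps(1-5) by blast
  define L where "L = Fo X"
  have L: "L \<in> T" "Fa (Id C X) = Id C L" "L \<in> Obj C"
    using F assms(1,3) unfolding is_functor_def L_def by auto
  define e where "e = \<phi> X L (Id C L)"
  have e: "e \<in> Hom C X L"
    using bij_betwE[OF bij[OF assms(3) L(1)]] Id_in_Hom[OF L(3)] L(1) unfolding e_def L_def by simp
  have "\<exists>!g. g \<in> Hom C L Y \<and> g \<cdot> e = f" if Y: "Y \<in> T" and f: "f \<in> Hom C X Y" for Y f
  proof -
    have ph: "\<phi> X Y g = g \<cdot> e" if g: "g \<in> Hom C L Y" for g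
    proof -
      have "\<phi> (Dom C (Id C X)) (Cod C g) (g \<cdot> (Id C L \<cdot> Fa (Id C X))) =
          g \<cdot> (\<phi> (Cod C (Id C X)) (Dom C g) (Id C L) \<cdot> Id C X)"
        using g L assms(3) Y L_def Id_in_Hom[OF L(3)] by (intro nat) (simp_all add: Hom_iff)
      then show ?thesis
        using g L(2,3) assms(3) e e_def by (simp add: Hom_iff)
    qed
    have b: "bij_betw (\<phi> X Y) (Hom C L Y) (Hom C X Y)"
      using bij[OF assms(3) Y] L(1) Y unfolding L_def[symmetric] by simp
    then obtain g where "g \<in> Hom C L Y" "\<phi> X Y g = f"
      using f unfolding bij_betw_def by (metis imageE)
    moreover have "g = g'" if "g \<in> Hom C L Y" "g' \<in> Hom C L Y" "g \<cdot> e = g' \<cdot> e" for g g'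
      using b that ph unfolding bij_betw_def inj_on_def by metis
    ultimately show ?thesis using ph by metis
  qed
  then show ?thesis using L(1) e by blast
qed

text \<open>The counit e is the preimage of an identity; naturality in the first variable shows that
  composition with e inverts the bijection.\<close>

lemma right_adjoint_coreflection:
  assumes "T \<subseteq> Obj C" "has_right_adjoint (full_subcat C T) C (\<lambda>X. X) (\<lambda>f. f)" "X \<in> Obj C"
  shows "\<exists>G \<in> T. \<exists>e \<in> Hom C G X. \<forall>Y \<in> T. \<forall>f \<in> Hom C Y X. \<exists>!g. g \<in> Hom C Y G \<and> e \<cdot> g = f"
proof -
  obtain Go Ga where "adjoint_pair (full_subcat C T) C (\<lambda>X. X) (\<lambda>f. f) Go Ga"
    using assms(2) unfolding has_right_adjoint_def by blast
  then obtain \<phi> where F: "is_functor C (full_subcat C T) Go Ga"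
    and bij: "\<And>X Y. X \<in> T \<Longrightarrow> Y \<in> Obj C \<Longrightarrow>
          bij_betw (\<phi> X Y) (Hom C X Y) (Hom (full_subcat C T) X (Go Y))"
    and nat: "\<And>f g h. f \<in> Arr (full_subcat C T) \<Longrightarrow> g \<in> Arr C \<Longrightarrow>
          h \<in> Hom C (Cod C f) (Dom C g) \<Longrightarrow>
          \<phi> (Dom C f) (Cod C g) (g \<cdot> (h \<cdot> f)) = Ga g \<cdot> (\<phi> (Cod C f) (Dom C g) h \<cdot> f)"
    unfolding adjoint_pair_def full_subcat_simps(1-5) by blast
  define G where "G = Go X"
  have G: "G \<in> T" "Ga (Id C X) = Id C G" "G \<in> Obj C"
    using F assms(1,3) unfolding is_functor_def G_def by auto
  have bij': "bij_betw (\<phi> Y X) (Hom C Y X) (Hom C Y G)" if "Y \<in> T" for Y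
    using bij[OF that assms(3)] that G(1) unfolding G_def[symmetric] by simp
  obtain e where e: "e \<in> Hom C G X" "\<phi> G X e = Id C G"
    using bij'[OF G(1)] Id_in_Hom[OF G(3)] unfolding bij_betw_def by (metis imageE)
  have "\<exists>!g. g \<in> Hom C Y G \<and> e \<cdot> g = f" if Y: "Y \<in> T" and f: "f \<in> Hom C Y X" for Y f
  proof -
    have ph: "\<phi> Y X (e \<cdot> g) = g" if g: "g \<in> Hom C Y G" for g
    proof -
      have "\<phi> (Dom C g) (Cod C (Id C X)) (Id C X \<cdot> (e \<cdot> g)) =
          Ga (Id C X) \<cdot> (\<phi> (Cod C g) (Dom C (Id C X)) e \<cdot> g)"
        using g e Y G assms(3) by (intro nat) (simp_all add: Hom_iff)
      then show ?thesis using g e G(2,3) assms(3) by (simp add: Hom_iff)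
    qed
    have g: "\<phi> Y X f \<in> Hom C Y G" using bij_betwE[OF bij'[OF Y]] f by blast
    then have "e \<cdot> \<phi> Y X f = f"
      using bij'[OF Y] ph[OF g] f Comp_in_Hom[OF g e(1)] unfolding bij_betw_def inj_on_def by blast
    then show ?thesis using g ph by metis
  qed
  then show ?thesis using G(1) e by blast
qed

text \<open>It is enough to choose a reflection for every object: unique factorization forces the
  values on arrows and makes them functorial.\<close>

lemma reflection_left_adjoint:
  assumes T: "T \<subseteq> Obj C"
    and refl: "\<And>X. X \<in> Obj C \<Longrightarrow>
      \<exists>L \<in> T. \<exists>e \<in> Hom C X L. \<forall>Y \<in> T. \<forall>f \<in> Hom C X Y. \<exists>!g. g \<in> Hom C L Y \<and> g \<cdot> e = f"
  shows "has_left_adjoint (full_subcat C T) C (\<lambda>X. X) (\<lambda>f. f)"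
proof -
  obtain L e where L: "\<And>X. X \<in> Obj C \<Longrightarrow> L X \<in> T" "\<And>X. X \<in> Obj C \<Longrightarrow> e X \<in> Hom C X (L X)"
    and un: "\<And>X Y f. X \<in> Obj C \<Longrightarrow> Y \<in> T \<Longrightarrow> f \<in> Hom C X Y \<Longrightarrow> \<exists>!g. g \<in> Hom C (L X) Y \<and> g \<cdot> e X = f"
    using refl by metis
  define La where "La f = (THE g. g \<in> Hom C (L (Dom C f)) (L (Cod C f)) \<and>
      g \<cdot> e (Dom C f) = e (Cod C f) \<cdot> f)" for f
  have La: "La f \<in> Hom C (L X) (L Y)" "La f \<cdot> e X = e Y \<cdot> f" if f: "f \<in> Hom C X Y" for f X Y
  proof -
    note O = Hom_Obj[OF f]
    have d: "Dom C f = X" "Cod C f = Y" using f by (simp_all add: Hom_iff)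
    have "La f \<in> Hom C (L X) (L Y) \<and> La f \<cdot> e X = e Y \<cdot> f"
      unfolding La_def d
      using un[OF O(1) L(1)[OF O(2)] Comp_in_Hom[OF f L(2)[OF O(2)]]] by (rule theI')
    then show "La f \<in> Hom C (L X) (L Y)" "La f \<cdot> e X = e Y \<cdot> f" by auto
  qed
  have eq: "g = g'" if "X \<in> Obj C" "Y \<in> T" "g \<in> Hom C (L X) Y" "g' \<in> Hom C (L X) Y" "g \<cdot> e X = g' \<cdot> e X"
    for g g' X Y
    using un[OF that(1,2) Comp_in_Hom[OF L(2)[OF that(1)] that(4)]] that by blast
  have "La (Id C X) = Id C (L X)" if X: "X \<in> Obj C" for X
  proof (rule eq[OF X L(1)[OF X]])
    have LX: "L X \<in> Obj C" using L(1)[OF X] T by blast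
    show "Id C (L X) \<in> Hom C (L X) (L X)" using Id_in_Hom[OF LX] .
    show "La (Id C X) \<in> Hom C (L X) (L X)" using La(1)[OF Id_in_Hom[OF X]] .
    show "La (Id C X) \<cdot> e X = Id C (L X) \<cdot> e X"
      using La(2)[OF Id_in_Hom[OF X]] Id_left[OF L(2)[OF X]] Id_right[OF L(2)[OF X]] by simp
  qed
  moreover have "La (g \<cdot> f) = La g \<cdot> La f" if f: "f \<in> Hom C X Y" and g: "g \<in> Hom C Y Z" for f g X Y Z
  proof (rule eq[OF Hom_Obj(1)[OF f] L(1)[OF Hom_Obj(2)[OF g]]])
    note gf = Comp_in_Hom[OF f g]
    note eX = L(2)[OF Hom_Obj(1)[OF f]] and eY = L(2)[OF Hom_Obj(2)[OF f]] and eZ = L(2)[OF Hom_Obj(2)[OF g]]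
    show "La (g \<cdot> f) \<in> Hom C (L X) (L Z)" using La(1)[OF gf] .
    show "La g \<cdot> La f \<in> Hom C (L X) (L Z)" using Comp_in_Hom[OF La(1)[OF f] La(1)[OF g]] .
    have "(La g \<cdot> La f) \<cdot> e X = La g \<cdot> (e Y \<cdot> f)"
      using Comp_assoc[OF eX La(1)[OF f] La(1)[OF g]] La(2)[OF f] by simp
    also have "\<dots> = e Z \<cdot> (g \<cdot> f)"
      using Comp_assoc[OF f eY La(1)[OF g]] Comp_assoc[OF f g eZ] La(2)[OF g] by simp
    finally show "La (g \<cdot> f) \<cdot> e X = (La g \<cdot> La f) \<cdot> e X" using La(2)[OF gf] by simp
  qed
  then have "La (g \<cdot> f) = La g \<cdot> La f" if "f \<in> Arr C" "g \<in> Arr C" "Cod C f = Dom C g" for f g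
    using that by (simp add: Hom_iff)
  ultimately have F: "is_functor C (full_subcat C T) L La"
    unfolding is_functor_def using L(1) La(1) Arr_in_Hom by (simp add: HomI)
  define \<phi> where "\<phi> X Y h = h \<cdot> e X" for X and Y :: 'o and h
  have "bij_betw (\<phi> X Y) (Hom (full_subcat C T) (L X) Y) (Hom C X Y)" if "X \<in> Obj C" "Y \<in> T" for X Y
  proof -
    have "bij_betw (\<phi> X Y) (Hom C (L X) Y) (Hom C X Y)"
      unfolding bij_betw_def inj_on_def \<phi>_def
      using eq[OF that] un[OF that] Comp_in_Hom[OF L(2)[OF that(1)]] by (auto simp: image_iff; metis)
    then show ?thesis using L(1) that by simp
  qed
  moreover have "\<phi> (Dom C f) (Cod C g) (g \<cdot> (h \<cdot> La f)) = g \<cdot> (\<phi> (Cod C f) (Dom C g) h \<cdot> f)"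
    if f: "f \<in> Arr C" and g: "g \<in> Arr (full_subcat C T)"
      and h: "h \<in> Hom (full_subcat C T) (L (Cod C f)) (Dom C g)" for f g h
  proof -
    note f' = Arr_in_Hom[OF f]
    have g': "g \<in> Hom C (Dom C g) (Cod C g)" using g by (simp add: Hom_iff)
    have h': "h \<in> Hom C (L (Cod C f)) (Dom C g)" using h by (simp add: Hom_iff)
    note a = L(2)[OF Hom_Obj(1)[OF f']] L(2)[OF Hom_Obj(2)[OF f']] La(1)[OF f']
    have "(g \<cdot> (h \<cdot> La f)) \<cdot> e (Dom C f) = g \<cdot> (h \<cdot> (La f \<cdot> e (Dom C f)))"
      using g' h' a by (simp add: Hom_iff)
    also have "\<dots> = g \<cdot> ((h \<cdot> e (Cod C f)) \<cdot> f)"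
      unfolding La(2)[OF f'] using Comp_assoc[OF f' a(2) h'] by simp
    finally show ?thesis unfolding \<phi>_def .
  qed
  ultimately have "adjoint_pair C (full_subcat C T) L La (\<lambda>X. X) (\<lambda>f. f)"
    unfolding adjoint_pair_def using F inclusion_functor[OF T]
    by (intro conjI exI[of _ \<phi>]) (auto simp del: full_subcat_simps(6))
  then show ?thesis unfolding has_left_adjoint_def by blast
qed

text \<open>The bijection in \<open>adjoint_pair\<close> sends arrows into X to arrows into G X,
  against composition with the counit, so \<phi> is taken as the inverse of that
  composition.\<close>

lemma coreflection_right_adjoint:
  assumes T: "T \<subseteq> Obj C"
    and corefl: "\<And>X. X \<in> Obj C \<Longrightarrow>
      \<exists>G \<in> T. \<exists>e \<in> Hom C G X. \<forall>Y \<in> T. \<forall>f \<in> Hom C Y X. \<exists>!g. g \<in> Hom C Y G \<and> e \<cdot> g = f"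
  shows "has_right_adjoint (full_subcat C T) C (\<lambda>X. X) (\<lambda>f. f)"
proof -
  obtain G e where G: "\<And>X. X \<in> Obj C \<Longrightarrow> G X \<in> T" "\<And>X. X \<in> Obj C \<Longrightarrow> e X \<in> Hom C (G X) X"
    and un: "\<And>X Y f. X \<in> Obj C \<Longrightarrow> Y \<in> T \<Longrightarrow> f \<in> Hom C Y X \<Longrightarrow> \<exists>!g. g \<in> Hom C Y (G X) \<and> e X \<cdot> g = f"
    using corefl by metis
  define \<phi> where "\<phi> X Y f = (THE g. g \<in> Hom C X (G Y) \<and> e Y \<cdot> g = f)" for X Y f
  have \<phi>: "\<phi> Y X f \<in> Hom C Y (G X)" "e X \<cdot> \<phi> Y X f = f"
    if "X \<in> Obj C" "Y \<in> T" "f \<in> Hom C Y X" for X Y f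
    using theI'[OF un[OF that]] unfolding \<phi>_def by auto
  have eq: "g = g'" if "X \<in> Obj C" "Y \<in> T" "g \<in> Hom C Y (G X)" "g' \<in> Hom C Y (G X)" "e X \<cdot> g = e X \<cdot> g'"
    for g g' X Y
    using un[OF that(1,2) Comp_in_Hom[OF that(4) G(2)[OF that(1)]]] that by blast
  define Ga where "Ga f = \<phi> (G (Dom C f)) (Cod C f) (f \<cdot> e (Dom C f))" for f
  have Ga: "Ga f \<in> Hom C (G X) (G Y)" "e Y \<cdot> Ga f = f \<cdot> e X" if f: "f \<in> Hom C X Y" for f X Y
  proof -
    note O = Hom_Obj[OF f]
    have "Ga f = \<phi> (G X) Y (f \<cdot> e X)" using f unfolding Ga_def Hom_iff by simp
    then show "Ga f \<in> Hom C (G X) (G Y)" "e Y \<cdot> Ga f = f \<cdot> e X"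
      using \<phi>[OF O(2) G(1)[OF O(1)] Comp_in_Hom[OF G(2)[OF O(1)] f]] by simp_all
  qed
  have "Ga (Id C X) = Id C (G X)" if X: "X \<in> Obj C" for X
  proof (rule eq[OF X G(1)[OF X]])
    have GX: "G X \<in> Obj C" using G(1)[OF X] T by blast
    show "Id C (G X) \<in> Hom C (G X) (G X)" using Id_in_Hom[OF GX] .
    show "Ga (Id C X) \<in> Hom C (G X) (G X)" using Ga(1)[OF Id_in_Hom[OF X]] .
    show "e X \<cdot> Ga (Id C X) = e X \<cdot> Id C (G X)"
      using Ga(2)[OF Id_in_Hom[OF X]] Id_left[OF G(2)[OF X]] Id_right[OF G(2)[OF X]] by simp
  qed
  moreover have "Ga (g \<cdot> f) = Ga g \<cdot> Ga f" if f: "f \<in> Hom C X Y" and g: "g \<in> Hom C Y Z" for f g X Y Z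
  proof (rule eq[OF Hom_Obj(2)[OF g] G(1)[OF Hom_Obj(1)[OF f]]])
    note gf = Comp_in_Hom[OF f g]
    note eX = G(2)[OF Hom_Obj(1)[OF f]] and eY = G(2)[OF Hom_Obj(2)[OF f]] and eZ = G(2)[OF Hom_Obj(2)[OF g]]
    show "Ga (g \<cdot> f) \<in> Hom C (G X) (G Z)" using Ga(1)[OF gf] .
    show "Ga g \<cdot> Ga f \<in> Hom C (G X) (G Z)" using Comp_in_Hom[OF Ga(1)[OF f] Ga(1)[OF g]] .
    have "e Z \<cdot> (Ga g \<cdot> Ga f) = g \<cdot> (e Y \<cdot> Ga f)"
      using Comp_assoc[OF Ga(1)[OF f] Ga(1)[OF g] eZ] Comp_assoc[OF Ga(1)[OF f] eY g] Ga(2)[OF g] by simp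
    also have "\<dots> = (g \<cdot> f) \<cdot> e X" using Comp_assoc[OF eX f g] Ga(2)[OF f] by simp
    finally show "e Z \<cdot> Ga (g \<cdot> f) = e Z \<cdot> (Ga g \<cdot> Ga f)" using Ga(2)[OF gf] by simp
  qed
  then have "Ga (g \<cdot> f) = Ga g \<cdot> Ga f" if "f \<in> Arr C" "g \<in> Arr C" "Cod C f = Dom C g" for f g
    using that by (simp add: Hom_iff)
  ultimately have F: "is_functor C (full_subcat C T) G Ga"
    unfolding is_functor_def using G(1) Ga(1) Arr_in_Hom by (simp add: HomI)
  have "bij_betw (\<phi> Y X) (Hom C Y X) (Hom (full_subcat C T) Y (G X))" if "Y \<in> T" "X \<in> Obj C" for X Y
  proof -
    have "bij_betw (\<phi> Y X) (Hom C Y X) (Hom C Y (G X))"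
    proof (rule bij_betw_byWitness[where f' = "\<lambda>g. e X \<cdot> g"])
      show "\<forall>f \<in> Hom C Y X. e X \<cdot> \<phi> Y X f = f" using \<phi> that by blast
      show "\<forall>g \<in> Hom C Y (G X). \<phi> Y X (e X \<cdot> g) = g"
      proof
        fix g assume g: "g \<in> Hom C Y (G X)"
        show "\<phi> Y X (e X \<cdot> g) = g"
          using eq[OF that(2,1) _ g] \<phi>[OF that(2,1) Comp_in_Hom[OF g G(2)[OF that(2)]]] by blast
      qed
      show "\<phi> Y X ` Hom C Y X \<subseteq> Hom C Y (G X)" using \<phi>(1) that by blast
      show "(\<lambda>g. e X \<cdot> g) ` Hom C Y (G X) \<subseteq> Hom C Y X" using Comp_in_Hom[OF _ G(2)[OF that(2)]] by blast
    qed
    then show ?thesis using G(1) that by simp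
  qed
  moreover have "\<phi> (Dom C f) (Cod C g) (g \<cdot> (h \<cdot> f)) = Ga g \<cdot> (\<phi> (Cod C f) (Dom C g) h \<cdot> f)"
    if f: "f \<in> Arr (full_subcat C T)" and g: "g \<in> Arr C" and h: "h \<in> Hom C (Cod C f) (Dom C g)" for f g h
  proof -
    note g' = Arr_in_Hom[OF g]
    have f': "f \<in> Hom C (Dom C f) (Cod C f)" "Dom C f \<in> T" "Cod C f \<in> T" using f by (simp_all add: Hom_iff)
    note O = Hom_Obj[OF g']
    note ph = \<phi>[OF O(1) f'(3) h]
    have gh: "g \<cdot> (h \<cdot> f) \<in> Hom C (Dom C f) (Cod C g)" using Comp_in_Hom[OF Comp_in_Hom[OF f'(1) h] g'] .
    note pf = Comp_in_Hom[OF f'(1) ph(1)]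
    show ?thesis
    proof (rule eq[OF O(2) f'(2) \<phi>(1)[OF O(2) f'(2) gh] Comp_in_Hom[OF pf Ga(1)[OF g']]])
      have "e (Cod C g) \<cdot> (Ga g \<cdot> (\<phi> (Cod C f) (Dom C g) h \<cdot> f)) =
          g \<cdot> (e (Dom C g) \<cdot> (\<phi> (Cod C f) (Dom C g) h \<cdot> f))"
        using Comp_assoc[OF pf Ga(1)[OF g'] G(2)[OF O(2)]] Comp_assoc[OF pf G(2)[OF O(1)] g'] Ga(2)[OF g']
        by simp
      also have "\<dots> = g \<cdot> (h \<cdot> f)" using Comp_assoc[OF f'(1) ph(1) G(2)[OF O(1)]] ph(2) by simp
      finally show "e (Cod C g) \<cdot> \<phi> (Dom C f) (Cod C g) (g \<cdot> (h \<cdot> f)) =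
          e (Cod C g) \<cdot> (Ga g \<cdot> (\<phi> (Cod C f) (Dom C g) h \<cdot> f))"
        using \<phi>(2)[OF O(2) f'(2) gh] by simp
    qed
  qed
  ultimately have "adjoint_pair (full_subcat C T) C (\<lambda>X. X) (\<lambda>f. f) G Ga"
    unfolding adjoint_pair_def using F inclusion_functor[OF T]
    by (intro conjI exI[of _ \<phi>]) (auto simp del: full_subcat_simps(6))
  then show ?thesis unfolding has_right_adjoint_def by blast
qed

end

section \<open>The stable category\<close>

lemma stable_category_simps [simp]:
  "Obj (stable_category C \<F>) = \<F>"
  "Dom (stable_category C \<F>) \<alpha> = Dom C (rep \<alpha>)" "Cod (stable_category C \<F>) \<alpha> = Cod C (rep \<alpha>)"
  "Id (stable_category C \<F>) X = stable_class C (Id C X)"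
  "\<beta> \<cdot>\<^bsub>stable_category C \<F>\<^esub> \<alpha> = stable_class C (rep \<beta> \<cdot>\<^bsub>C\<^esub> rep \<alpha>)"
  by (simp_all add: stable_category_def)

context abelian_inj
begin

lemma stable_class_iff:
  assumes "f \<in> Hom C X Y"
  shows "g \<in> stable_class C f \<longleftrightarrow> steq X Y g f"
proof -
  have "Dom C f = X" "Cod C f = Y" using assms by (simp_all add: Hom_iff)
  then show ?thesis using assms unfolding stable_class_def steq_def by blast
qed

lemma stable_class_eq:
  assumes "f \<in> Hom C X Y" "g \<in> Hom C X Y"
  shows "stable_class C f = stable_class C g \<longleftrightarrow> steq X Y f g"
proof
  assume "stable_class C f = stable_class C g"
  then show "steq X Y f g" using stable_class_iff assms steq_refl by blast
next
  assume "steq X Y f g"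
  then show "stable_class C f = stable_class C g"
    using stable_class_iff[OF assms(1)] stable_class_iff[OF assms(2)] steq_trans steq_sym by blast
qed

lemma rep_stable_class:
  assumes "f \<in> Hom C X Y"
  shows "steq X Y (rep (stable_class C f)) f"
proof -
  have "f \<in> stable_class C f" using stable_class_iff[OF assms] steq_refl[OF assms] by simp
  then have "rep (stable_class C f) \<in> stable_class C f" unfolding rep_def by (rule someI)
  then show ?thesis using stable_class_iff[OF assms] by simp
qed

lemma rep_Hom: "f \<in> Hom C X Y \<Longrightarrow> rep (stable_class C f) \<in> Hom C X Y"
  using rep_stable_class steqD(1) by blast

text \<open>\<open>Dom\<close> and \<open>Cod\<close> of a class are those of \<open>rep\<close>,
  which is congruent to every representative and thus parallel to it.\<close>

lemma Hom_stable_iff: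
  "\<alpha> \<in> Hom (stable_category C \<F>) X Y \<longleftrightarrow> X \<in> \<F> \<and> Y \<in> \<F> \<and> (\<exists>f \<in> Hom C X Y. \<alpha> = stable_class C f)"
proof
  assume "\<alpha> \<in> Hom (stable_category C \<F>) X Y"
  then obtain f where f: "\<alpha> = stable_class C f" "f \<in> Arr C" "Dom C f \<in> \<F>" "Cod C f \<in> \<F>"
    and XY: "Dom C (rep \<alpha>) = X" "Cod C (rep \<alpha>) = Y"
    by (auto simp: Hom_def stable_category_def)
  have "Dom C f = X" "Cod C f = Y"
    using rep_Hom[OF Arr_in_Hom[OF f(2)]] XY f(1) by (simp_all add: Hom_iff)
  then show "X \<in> \<F> \<and> Y \<in> \<F> \<and> (\<exists>f \<in> Hom C X Y. \<alpha> = stable_class C f)"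
    using f by (auto simp: Hom_iff)
next
  assume "X \<in> \<F> \<and> Y \<in> \<F> \<and> (\<exists>f \<in> Hom C X Y. \<alpha> = stable_class C f)"
  then obtain f where f: "X \<in> \<F>" "Y \<in> \<F>" "f \<in> Hom C X Y" "\<alpha> = stable_class C f" by blast
  then have "rep \<alpha> \<in> Hom C X Y" using rep_Hom by blast
  moreover have "\<alpha> \<in> Arr (stable_category C \<F>)"
    using f by (auto simp: stable_category_def Hom_iff)
  ultimately show "\<alpha> \<in> Hom (stable_category C \<F>) X Y" by (simp add: Hom_iff)
qed

lemma stable_class_Hom:
  "X \<in> \<F> \<Longrightarrow> Y \<in> \<F> \<Longrightarrow> f \<in> Hom C X Y \<Longrightarrow> stable_class C f \<in> Hom (stable_category C \<F>) X Y"
  using Hom_stable_iff by blast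

lemma stable_Comp:
  assumes "f \<in> Hom C X Y" "g \<in> Hom C Y Z"
  shows "stable_class C g \<cdot>\<^bsub>stable_category C \<F>\<^esub> stable_class C f = stable_class C (g \<cdot> f)"
  using stable_class_eq[OF Comp_in_Hom[OF rep_Hom rep_Hom] Comp_in_Hom[OF assms]]
    steq_comp[OF rep_stable_class rep_stable_class] assms by simp

lemma stable_category_category:
  assumes "\<F> \<subseteq> Obj C"
  shows "category (stable_category C \<F>)"
proof
  let ?S = "stable_category C \<F>"
  show "Dom ?S \<alpha> \<in> Obj ?S" "Cod ?S \<alpha> \<in> Obj ?S" if "\<alpha> \<in> Arr ?S" for \<alpha>
  proof -
    have "\<alpha> \<in> Hom ?S (Dom ?S \<alpha>) (Cod ?S \<alpha>)" using that by (simp add: Hom_def)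
    then show "Dom ?S \<alpha> \<in> Obj ?S" "Cod ?S \<alpha> \<in> Obj ?S" unfolding Hom_stable_iff by simp_all
  qed
  show "Id ?S X \<in> Hom ?S X X" if "X \<in> Obj ?S" for X
    using that stable_class_Hom[of X \<F> X] Id_in_Hom assms by auto
  show "\<beta> \<cdot>\<^bsub>?S\<^esub> \<alpha> \<in> Hom ?S X Z" if "\<alpha> \<in> Hom ?S X Y" "\<beta> \<in> Hom ?S Y Z" for \<alpha> \<beta> X Y Z
    using that stable_Comp Comp_in_Hom unfolding Hom_stable_iff by metis
  show "\<gamma> \<cdot>\<^bsub>?S\<^esub> (\<beta> \<cdot>\<^bsub>?S\<^esub> \<alpha>) = (\<gamma> \<cdot>\<^bsub>?S\<^esub> \<beta>) \<cdot>\<^bsub>?S\<^esub> \<alpha>"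
    if h: "\<alpha> \<in> Hom ?S X Y" "\<beta> \<in> Hom ?S Y Z" "\<gamma> \<in> Hom ?S Z W" for \<alpha> \<beta> \<gamma> X Y Z W
  proof -
    obtain f g k where f: "f \<in> Hom C X Y" "g \<in> Hom C Y Z" "k \<in> Hom C Z W"
      "\<alpha> = stable_class C f" "\<beta> = stable_class C g" "\<gamma> = stable_class C k"
      using h unfolding Hom_stable_iff by blast
    show ?thesis
      unfolding f(4-6) stable_Comp[OF f(1,2)] stable_Comp[OF f(2,3)]
        stable_Comp[OF Comp_in_Hom[OF f(1,2)] f(3)] stable_Comp[OF f(1) Comp_in_Hom[OF f(2,3)]]
        Comp_assoc[OF f(1-3)] ..
  qed
  show "Id ?S Y \<cdot>\<^bsub>?S\<^esub> \<alpha> = \<alpha>" "\<alpha> \<cdot>\<^bsub>?S\<^esub> Id ?S X = \<alpha>" if \<alpha>: "\<alpha> \<in> Hom ?S X Y" for \<alpha> X Y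
  proof -
    obtain f where f: "f \<in> Hom C X Y" "\<alpha> = stable_class C f" using \<alpha> unfolding Hom_stable_iff by blast
    note O = Hom_Obj[OF f(1)]
    show "Id ?S Y \<cdot>\<^bsub>?S\<^esub> \<alpha> = \<alpha>"
      unfolding stable_category_simps(4) f(2) stable_Comp[OF f(1) Id_in_Hom[OF O(2)]] Id_left[OF f(1)] ..
    show "\<alpha> \<cdot>\<^bsub>?S\<^esub> Id ?S X = \<alpha>"
      unfolding stable_category_simps(4) f(2) stable_Comp[OF Id_in_Hom[OF O(1)] f(1)] Id_right[OF f(1)] ..
  qed
qed

lemma retract_of_stable_iff:
  assumes "X \<in> \<F>" "Y \<in> \<F>"
  shows "retract_of (stable_category C \<F>) X Y \<longleftrightarrow> sretract X Y"
proof -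
  have *: "stable_class C r \<cdot>\<^bsub>stable_category C \<F>\<^esub> stable_class C i = stable_class C (Id C X) \<longleftrightarrow>
      steq X X (Id C X) (r \<cdot> i)" if "i \<in> Hom C X Y" "r \<in> Hom C Y X" for i r
    unfolding stable_Comp[OF that]
    using stable_class_eq[OF Comp_in_Hom[OF that] Id_in_Hom[OF Hom_Obj(1)[OF that(1)]]] steq_sym by blast
  show ?thesis
  proof
    assume "retract_of (stable_category C \<F>) X Y"
    then obtain \<alpha> \<beta> where "\<alpha> \<in> Hom (stable_category C \<F>) X Y" "\<beta> \<in> Hom (stable_category C \<F>) Y X"
      "\<beta> \<cdot>\<^bsub>stable_category C \<F>\<^esub> \<alpha> = stable_class C (Id C X)"
      unfolding retract_of_def stable_category_simps(4) by blast
    then show "sretract X Y" unfolding Hom_stable_iff sretract_def using * by blast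
  next
    assume "sretract X Y"
    then obtain i r where "i \<in> Hom C X Y" "r \<in> Hom C Y X" "steq X X (Id C X) (r \<cdot> i)"
      unfolding sretract_def by blast
    then show "retract_of (stable_category C \<F>) X Y"
      unfolding retract_of_def stable_category_simps(4)
      using * stable_class_Hom[OF assms] stable_class_Hom[OF assms(2,1)] by blast
  qed
qed

lemma iso_arr_sretract:
  assumes "\<alpha> \<in> Hom (stable_category C \<F>) X Y" "iso_arr (stable_category C \<F>) \<alpha>"
  shows "sretract X Y" "sretract Y X"
proof -
  have XY: "X \<in> \<F>" "Y \<in> \<F>" using assms(1) unfolding Hom_stable_iff by simp_all
  have d: "Dom (stable_category C \<F>) \<alpha> = X" "Cod (stable_category C \<F>) \<alpha> = Y"
    using assms(1) unfolding Hom_iff by simp_all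
  obtain \<beta> where "\<beta> \<in> Hom (stable_category C \<F>) Y X"
    "\<beta> \<cdot>\<^bsub>stable_category C \<F>\<^esub> \<alpha> = Id (stable_category C \<F>) X"
    "\<alpha> \<cdot>\<^bsub>stable_category C \<F>\<^esub> \<beta> = Id (stable_category C \<F>) Y"
    using assms(2) unfolding iso_arr_def d by blast
  then have "retract_of (stable_category C \<F>) X Y" "retract_of (stable_category C \<F>) Y X"
    unfolding retract_of_def using assms(1) by blast+
  then show "sretract X Y" "sretract Y X" using retract_of_stable_iff XY by blast+
qed

text \<open>Uniqueness of factorizations and detection of null arrows are equivalent by additivity:
  one way, apply detection to the difference of two solutions; the other way, compare a solution
  with the zero arrow.\<close>

lemma reflection_stable_iff:
  assumes T: "T \<subseteq> \<F>" and X: "X \<in> \<F>"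
  shows "(\<exists>L e. reflection T X L e) \<longleftrightarrow>
    (\<exists>L \<in> T. \<exists>\<epsilon> \<in> Hom (stable_category C \<F>) X L. \<forall>Y \<in> T. \<forall>\<phi> \<in> Hom (stable_category C \<F>) X Y.
       \<exists>!\<gamma>. \<gamma> \<in> Hom (stable_category C \<F>) L Y \<and> \<gamma> \<cdot>\<^bsub>stable_category C \<F>\<^esub> \<epsilon> = \<phi>)"
    (is "_ \<longleftrightarrow> ?R")
proof
  assume "\<exists>L e. reflection T X L e"
  then obtain L e where L: "L \<in> T" "e \<in> Hom C X L"
    and ex: "\<And>Y f. Y \<in> T \<Longrightarrow> f \<in> Hom C X Y \<Longrightarrow> \<exists>g \<in> Hom C L Y. steq X Y (g \<cdot> e) f"
    and nu: "\<And>Y g. Y \<in> T \<Longrightarrow> g \<in> Hom C L Y \<Longrightarrow> null (g \<cdot> e) \<Longrightarrow> null g"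
    unfolding reflection_def by blast
  have LF: "L \<in> \<F>" using L T by blast
  have "\<exists>!\<gamma>. \<gamma> \<in> Hom (stable_category C \<F>) L Y \<and> \<gamma> \<cdot>\<^bsub>stable_category C \<F>\<^esub> stable_class C e = \<phi>"
    if Y: "Y \<in> T" and \<phi>: "\<phi> \<in> Hom (stable_category C \<F>) X Y" for Y \<phi>
  proof -
    have YF: "Y \<in> \<F>" using Y T by blast
    obtain f where f: "f \<in> Hom C X Y" "\<phi> = stable_class C f" using \<phi> unfolding Hom_stable_iff by blast
    obtain g where g: "g \<in> Hom C L Y" "steq X Y (g \<cdot> e) f" using ex[OF Y f(1)] by blast
    have c: "stable_class C h \<cdot>\<^bsub>stable_category C \<F>\<^esub> stable_class C e = \<phi> \<longleftrightarrow> steq X Y (h \<cdot> e) f"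
      if "h \<in> Hom C L Y" for h
      unfolding stable_Comp[OF L(2) that] f(2) using stable_class_eq[OF Comp_in_Hom[OF L(2) that] f(1)] .
    show ?thesis
    proof (rule ex1I[of _ "stable_class C g"])
      show "stable_class C g \<in> Hom (stable_category C \<F>) L Y \<and>
          stable_class C g \<cdot>\<^bsub>stable_category C \<F>\<^esub> stable_class C e = \<phi>"
        using c[OF g(1)] g stable_class_Hom[OF LF YF] by blast
      fix \<gamma> assume \<gamma>: "\<gamma> \<in> Hom (stable_category C \<F>) L Y \<and>
          \<gamma> \<cdot>\<^bsub>stable_category C \<F>\<^esub> stable_class C e = \<phi>"
      then obtain h where h: "h \<in> Hom C L Y" "\<gamma> = stable_class C h" unfolding Hom_stable_iff by blast
      then have "steq X Y (h \<cdot> e) (g \<cdot> e)" using c[OF h(1)] \<gamma> steq_trans steq_sym g(2) by blast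
      then have "null (Diff C h g \<cdot> e)" using Comp_Diff(2)[OF h(1) g(1) L(2)] unfolding steq_def by simp
      then have "steq L Y h g" unfolding steq_def using nu[OF Y] Add_Diff(1)[OF h(1) g(1)] h(1) g(1) by blast
      then show "\<gamma> = stable_class C g" using stable_class_eq[OF h(1) g(1)] h(2) by simp
    qed
  qed
  then show ?R using L stable_class_Hom[OF X LF] by blast
next
  assume ?R
  then obtain L \<epsilon> where L: "L \<in> T" "\<epsilon> \<in> Hom (stable_category C \<F>) X L"
    and un: "\<forall>Y \<in> T. \<forall>\<phi> \<in> Hom (stable_category C \<F>) X Y.
       \<exists>!\<gamma>. \<gamma> \<in> Hom (stable_category C \<F>) L Y \<and> \<gamma> \<cdot>\<^bsub>stable_category C \<F>\<^esub> \<epsilon> = \<phi>"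
    by (elim bexE) (rule that; assumption)
  obtain e where e: "e \<in> Hom C X L" "\<epsilon> = stable_class C e" using L(2) unfolding Hom_stable_iff by blast
  have LF: "L \<in> \<F>" using L T by blast
  have "\<exists>g \<in> Hom C L Y. steq X Y (g \<cdot> e) f" if Y: "Y \<in> T" and f: "f \<in> Hom C X Y" for Y f
  proof -
    have YF: "Y \<in> \<F>" using Y T by blast
    obtain \<gamma> where \<gamma>: "\<gamma> \<in> Hom (stable_category C \<F>) L Y"
      "\<gamma> \<cdot>\<^bsub>stable_category C \<F>\<^esub> \<epsilon> = stable_class C f"
      using un[rule_format, OF Y stable_class_Hom[OF X YF f]] by blast
    obtain g where g: "g \<in> Hom C L Y" "\<gamma> = stable_class C g" using \<gamma>(1) unfolding Hom_stable_iff by blast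
    show ?thesis
      using \<gamma>(2) stable_class_eq[OF Comp_in_Hom[OF e(1) g(1)] f] g(1)
      unfolding g(2) e(2) stable_Comp[OF e(1) g(1)] by blast
  qed
  moreover have "null g" if Y: "Y \<in> T" and g: "g \<in> Hom C L Y" and n: "null (g \<cdot> e)" for Y g
  proof -
    have YF: "Y \<in> \<F>" using Y T by blast
    have z: "Zero C L Y \<in> Hom C L Y" using Hom_Obj[OF g] by (simp add: Hom_iff)
    have "Zero C L Y \<cdot> e = Zero C X Y" using e(1) Hom_Obj[OF g] by (simp add: Hom_iff)
    then have "stable_class C (g \<cdot> e) = stable_class C (Zero C L Y \<cdot> e)"
      using stable_class_eq[OF Comp_in_Hom[OF e(1) g] Comp_in_Hom[OF e(1) z]]
        steq_Zero_iff[OF Comp_in_Hom[OF e(1) g]] n by simp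
    then have "stable_class C g = stable_class C (Zero C L Y)"
      using un[rule_format, OF Y stable_class_Hom[OF X YF Comp_in_Hom[OF e(1) g]]]
        stable_class_Hom[OF LF YF g] stable_class_Hom[OF LF YF z]
        stable_Comp[OF e(1) g, of \<F>] stable_Comp[OF e(1) z, of \<F>] unfolding e(2) by metis
    then show "null g" using stable_class_eq[OF g z] steq_Zero_iff[OF g] by simp
  qed
  ultimately show "\<exists>L e. reflection T X L e" unfolding reflection_def using L(1) e(1) by blast
qed

lemma coreflection_stable_iff:
  assumes T: "T \<subseteq> \<F>" and X: "X \<in> \<F>"
  shows "(\<exists>G e. coreflection T X G e) \<longleftrightarrow>
    (\<exists>G \<in> T. \<exists>\<epsilon> \<in> Hom (stable_category C \<F>) G X. \<forall>Y \<in> T. \<forall>\<phi> \<in> Hom (stable_category C \<F>) Y X.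
       \<exists>!\<gamma>. \<gamma> \<in> Hom (stable_category C \<F>) Y G \<and> \<epsilon> \<cdot>\<^bsub>stable_category C \<F>\<^esub> \<gamma> = \<phi>)"
    (is "_ \<longleftrightarrow> ?R")
proof
  assume "\<exists>G e. coreflection T X G e"
  then obtain G e where G: "G \<in> T" "e \<in> Hom C G X"
    and ex: "\<And>Y f. Y \<in> T \<Longrightarrow> f \<in> Hom C Y X \<Longrightarrow> \<exists>g \<in> Hom C Y G. steq Y X (e \<cdot> g) f"
    and nu: "\<And>Y g. Y \<in> T \<Longrightarrow> g \<in> Hom C Y G \<Longrightarrow> null (e \<cdot> g) \<Longrightarrow> null g"
    unfolding coreflection_def by blast
  have GF: "G \<in> \<F>" using G T by blast
  have "\<exists>!\<gamma>. \<gamma> \<in> Hom (stable_category C \<F>) Y G \<and> stable_class C e \<cdot>\<^bsub>stable_category C \<F>\<^esub> \<gamma> = \<phi>"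
    if Y: "Y \<in> T" and \<phi>: "\<phi> \<in> Hom (stable_category C \<F>) Y X" for Y \<phi>
  proof -
    have YF: "Y \<in> \<F>" using Y T by blast
    obtain f where f: "f \<in> Hom C Y X" "\<phi> = stable_class C f" using \<phi> unfolding Hom_stable_iff by blast
    obtain g where g: "g \<in> Hom C Y G" "steq Y X (e \<cdot> g) f" using ex[OF Y f(1)] by blast
    have c: "stable_class C e \<cdot>\<^bsub>stable_category C \<F>\<^esub> stable_class C h = \<phi> \<longleftrightarrow> steq Y X (e \<cdot> h) f"
      if "h \<in> Hom C Y G" for h
      unfolding stable_Comp[OF that G(2)] f(2) using stable_class_eq[OF Comp_in_Hom[OF that G(2)] f(1)] .
    show ?thesis
    proof (rule ex1I[of _ "stable_class C g"])
      show "stable_class C g \<in> Hom (stable_category C \<F>) Y G \<and>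
          stable_class C e \<cdot>\<^bsub>stable_category C \<F>\<^esub> stable_class C g = \<phi>"
        using c[OF g(1)] g stable_class_Hom[OF YF GF] by blast
      fix \<gamma> assume \<gamma>: "\<gamma> \<in> Hom (stable_category C \<F>) Y G \<and>
          stable_class C e \<cdot>\<^bsub>stable_category C \<F>\<^esub> \<gamma> = \<phi>"
      then obtain h where h: "h \<in> Hom C Y G" "\<gamma> = stable_class C h" unfolding Hom_stable_iff by blast
      then have "steq Y X (e \<cdot> h) (e \<cdot> g)" using c[OF h(1)] \<gamma> steq_trans steq_sym g(2) by blast
      then have "null (e \<cdot> Diff C h g)" using Comp_Diff(1)[OF h(1) g(1) G(2)] unfolding steq_def by simp
      then have "steq Y G h g" unfolding steq_def using nu[OF Y] Add_Diff(1)[OF h(1) g(1)] h(1) g(1) by blast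
      then show "\<gamma> = stable_class C g" using stable_class_eq[OF h(1) g(1)] h(2) by simp
    qed
  qed
  then show ?R using G stable_class_Hom[OF GF X] by blast
next
  assume ?R
  then obtain G \<epsilon> where G: "G \<in> T" "\<epsilon> \<in> Hom (stable_category C \<F>) G X"
    and un: "\<forall>Y \<in> T. \<forall>\<phi> \<in> Hom (stable_category C \<F>) Y X.
       \<exists>!\<gamma>. \<gamma> \<in> Hom (stable_category C \<F>) Y G \<and> \<epsilon> \<cdot>\<^bsub>stable_category C \<F>\<^esub> \<gamma> = \<phi>"
    by (elim bexE) (rule that; assumption)
  obtain e where e: "e \<in> Hom C G X" "\<epsilon> = stable_class C e" using G(2) unfolding Hom_stable_iff by blast
  have GF: "G \<in> \<F>" using G T by blast
  have "\<exists>g \<in> Hom C Y G. steq Y X (e \<cdot> g) f" if Y: "Y \<in> T" and f: "f \<in> Hom C Y X" for Y f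
  proof -
    have YF: "Y \<in> \<F>" using Y T by blast
    obtain \<gamma> where \<gamma>: "\<gamma> \<in> Hom (stable_category C \<F>) Y G"
      "\<epsilon> \<cdot>\<^bsub>stable_category C \<F>\<^esub> \<gamma> = stable_class C f"
      using un[rule_format, OF Y stable_class_Hom[OF YF X f]] by blast
    obtain g where g: "g \<in> Hom C Y G" "\<gamma> = stable_class C g" using \<gamma>(1) unfolding Hom_stable_iff by blast
    show ?thesis
      using \<gamma>(2) stable_class_eq[OF Comp_in_Hom[OF g(1) e(1)] f] g(1)
      unfolding g(2) e(2) stable_Comp[OF g(1) e(1)] by blast
  qed
  moreover have "null g" if Y: "Y \<in> T" and g: "g \<in> Hom C Y G" and n: "null (e \<cdot> g)" for Y g
  proof -
    have YF: "Y \<in> \<F>" using Y T by blast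
    have z: "Zero C Y G \<in> Hom C Y G" using Hom_Obj[OF g] by (simp add: Hom_iff)
    have "e \<cdot> Zero C Y G = Zero C Y X" using e(1) Hom_Obj[OF g] by (simp add: Hom_iff)
    then have "stable_class C (e \<cdot> g) = stable_class C (e \<cdot> Zero C Y G)"
      using stable_class_eq[OF Comp_in_Hom[OF g e(1)] Comp_in_Hom[OF z e(1)]]
        steq_Zero_iff[OF Comp_in_Hom[OF g e(1)]] n by simp
    then have "stable_class C g = stable_class C (Zero C Y G)"
      using un[rule_format, OF Y stable_class_Hom[OF YF X Comp_in_Hom[OF g e(1)]]]
        stable_class_Hom[OF YF GF g] stable_class_Hom[OF YF GF z]
        stable_Comp[OF g e(1), of \<F>] stable_Comp[OF z e(1), of \<F>] unfolding e(2) by metis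
    then show "null g" using stable_class_eq[OF g z] steq_Zero_iff[OF g] by simp
  qed
  ultimately show "\<exists>G e. coreflection T X G e" unfolding coreflection_def using G(1) e(1) by blast
qed

lemma has_left_adjoint_stable_iff:
  assumes F: "\<F> \<subseteq> Obj C" and T: "T \<subseteq> \<F>"
  shows "has_left_adjoint (full_subcat (stable_category C \<F>) T) (stable_category C \<F>) (\<lambda>X. X) (\<lambda>\<alpha>. \<alpha>)
     \<longleftrightarrow> (\<forall>X \<in> \<F>. \<exists>L e. reflection T X L e)"
proof -
  interpret S: category "stable_category C \<F>" by (rule stable_category_category[OF F])
  have T': "T \<subseteq> Obj (stable_category C \<F>)" using T by simp
  show ?thesis
  proof
    assume adj: "has_left_adjoint (full_subcat (stable_category C \<F>) T) (stable_category C \<F>) (\<lambda>X. X) (\<lambda>\<alpha>. \<alpha>)"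
    show "\<forall>X \<in> \<F>. \<exists>L e. reflection T X L e"
    proof
      fix X assume X: "X \<in> \<F>"
      then have "X \<in> Obj (stable_category C \<F>)" by simp
      from S.left_adjoint_reflection[OF T' adj this] show "\<exists>L e. reflection T X L e"
        unfolding reflection_stable_iff[OF T X] .
    qed
  next
    assume r: "\<forall>X \<in> \<F>. \<exists>L e. reflection T X L e"
    show "has_left_adjoint (full_subcat (stable_category C \<F>) T) (stable_category C \<F>) (\<lambda>X. X) (\<lambda>\<alpha>. \<alpha>)"
    proof (rule S.reflection_left_adjoint[OF T'])
      fix X assume "X \<in> Obj (stable_category C \<F>)"
      then have X: "X \<in> \<F>" by simp
      from r[rule_format, OF X, unfolded reflection_stable_iff[OF T X]]
      show "\<exists>L \<in> T. \<exists>e \<in> Hom (stable_category C \<F>) X L. \<forall>Y \<in> T.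
          \<forall>f \<in> Hom (stable_category C \<F>) X Y. \<exists>!g. g \<in> Hom (stable_category C \<F>) L Y \<and>
            g \<cdot>\<^bsub>stable_category C \<F>\<^esub> e = f" .
    qed
  qed
qed

lemma has_right_adjoint_stable_iff:
  assumes F: "\<F> \<subseteq> Obj C" and T: "T \<subseteq> \<F>"
  shows "has_right_adjoint (full_subcat (stable_category C \<F>) T) (stable_category C \<F>) (\<lambda>X. X) (\<lambda>\<alpha>. \<alpha>)
     \<longleftrightarrow> (\<forall>X \<in> \<F>. \<exists>G e. coreflection T X G e)"
proof -
  interpret S: category "stable_category C \<F>" by (rule stable_category_category[OF F])
  have T': "T \<subseteq> Obj (stable_category C \<F>)" using T by simp
  show ?thesis
  proof
    assume adj: "has_right_adjoint (full_subcat (stable_category C \<F>) T) (stable_category C \<F>) (\<lambda>X. X) (\<lambda>\<alpha>. \<alpha>)"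
    show "\<forall>X \<in> \<F>. \<exists>G e. coreflection T X G e"
    proof
      fix X assume X: "X \<in> \<F>"
      then have "X \<in> Obj (stable_category C \<F>)" by simp
      from S.right_adjoint_coreflection[OF T' adj this] show "\<exists>G e. coreflection T X G e"
        unfolding coreflection_stable_iff[OF T X] .
    qed
  next
    assume r: "\<forall>X \<in> \<F>. \<exists>G e. coreflection T X G e"
    show "has_right_adjoint (full_subcat (stable_category C \<F>) T) (stable_category C \<F>) (\<lambda>X. X) (\<lambda>\<alpha>. \<alpha>)"
    proof (rule S.coreflection_right_adjoint[OF T'])
      fix X assume "X \<in> Obj (stable_category C \<F>)"
      then have X: "X \<in> \<F>" by simp
      from r[rule_format, OF X, unfolded coreflection_stable_iff[OF T X]]
      show "\<exists>L \<in> T. \<exists>e \<in> Hom (stable_category C \<F>) L X. \<forall>Y \<in> T.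
          \<forall>f \<in> Hom (stable_category C \<F>) Y X. \<exists>!g. g \<in> Hom (stable_category C \<F>) Y L \<and>
            e \<cdot>\<^bsub>stable_category C \<F>\<^esub> g = f" .
    qed
  qed
qed

section \<open>Thick subcategories of the stable category as stably thick classes\<close>

lemma susp_ses:
  assumes c: "icp \<W> \<F>" and X: "X \<in> \<F>"
  obtains \<iota> \<pi> I where "ses C \<iota> \<pi> X I (susp C \<F> X)" "injective_object C I" "susp C \<F> X \<in> \<F>"
proof -
  obtain \<iota> \<pi> I S where s: "ses C \<iota> \<pi> X I S" "injective_object C I" "S \<in> \<F>" using icp_susp[OF c X] .
  define P where "P = (\<lambda>(i, p). short_exact C i p \<and> Dom C i = X \<and> injective_object C (Dom C p) \<and> Cod C p \<in> \<F>)"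
  have "P (\<iota>, \<pi>)" using s unfolding P_def ses_def Hom_iff by simp
  then have "P (susp_seq C \<F> X)" unfolding susp_seq_def P_def[symmetric] by (rule someI)
  then have *: "short_exact C (susp_in C \<F> X) (susp_pr C \<F> X)" "Dom C (susp_in C \<F> X) = X"
    "injective_object C (Dom C (susp_pr C \<F> X))" "susp C \<F> X \<in> \<F>"
    unfolding P_def susp_in_def susp_pr_def susp_def by (simp_all add: case_prod_beta)
  have "ses C (susp_in C \<F> X) (susp_pr C \<F> X) X (Dom C (susp_pr C \<F> X)) (susp C \<F> X)"
    using *(1,2) unfolding short_exact_ses susp_def by simp
  then show ?thesis using that *(3,4) by blast
qed

text \<open>Closure under suspension is given for the chosen sequences. By \<open>schanuel\<close>
  the end terms of two sequences X -> I -> S are stable retracts of each other, which carries it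
  over to all sequences.\<close>

lemma stable_thick_subcategoryD:
  assumes c: "icp \<W> \<F>" and D: "stable_thick_subcategory C \<F> D"
  obtains T where "D = full_subcat (stable_category C \<F>) T" "stable_thick \<F> T"
proof -
  let ?S = "stable_category C \<F>"
  have "full_triangulated_subcategory ?S (susp C \<F>) (distinguished_triangles C \<F>) D"
    and thick: "\<forall>Y \<in> Obj D. \<forall>X \<in> Obj ?S. retract_of ?S X Y \<longrightarrow> X \<in> Obj D"
    using D unfolding stable_thick_subcategory_def thick_subcategory_def by - (elim conjE, assumption)+
  then obtain T where "T \<subseteq> Obj ?S" and "D = full_subcat ?S T"
    and Z: "\<exists>Z \<in> T. zero_object ?S Z" and "\<forall>X \<in> Obj ?S. X \<in> T \<longleftrightarrow> susp C \<F> X \<in> T"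
    unfolding full_triangulated_subcategory_def by (elim exE conjE) (rule that; assumption)
  then have T: "T \<subseteq> \<F>" "D = full_subcat ?S T" and su: "\<forall>X \<in> \<F>. X \<in> T \<longleftrightarrow> susp C \<F> X \<in> T"
    unfolding stable_category_simps(1) by - assumption+
  have re: "X \<in> T" if "Y \<in> T" "X \<in> \<F>" "sretract X Y" for X Y
  proof -
    have "Y \<in> \<F>" using that(1) T(1) by blast
    then have "retract_of ?S X Y" using retract_of_stable_iff[OF that(2)] that(3) by simp
    then show ?thesis
      using thick that(1,2) unfolding T(2) full_subcat_simps(1) stable_category_simps(1) by blast
  qed
  have inj: "I \<in> T" if I: "injective_object C I" for I
  proof -
    have IF: "I \<in> \<F>" using icp_injective(2)[OF c I] .
    obtain Z where Z: "Z \<in> T" "zero_object ?S Z" using Z by blast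
    then obtain \<alpha> \<beta> where "\<alpha> \<in> Hom ?S I Z" "\<beta> \<in> Hom ?S Z I"
      using IF unfolding zero_object_def stable_category_simps(1) by blast
    then obtain i r where ir: "i \<in> Hom C I Z" "r \<in> Hom C Z I" unfolding Hom_stable_iff by blast
    note ri = Comp_in_Hom[OF ir] and id = Id_in_Hom[OF injective_Obj[OF I]]
    \<comment> \<open>Both arrows start at an injective object, so both are null; this makes I a
      stable retract of the zero object Z.\<close>
    have "steq I I (Id C I) (r \<cdot> i)"
      using null_steq[OF null_injective_Dom[OF I id] null_injective_Dom[OF I ri] id ri] .
    then have "sretract I Z" unfolding sretract_def using ir by blast
    then show ?thesis using re Z(1) IF by blast
  qed
  have "X \<in> T \<longleftrightarrow> S \<in> T"
    if s: "ses C \<iota> \<pi> X I S" "injective_object C I" and XS: "X \<in> \<F>" "S \<in> \<F>" for \<iota> \<pi> X I S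
  proof -
    obtain \<iota>' \<pi>' I' where s': "ses C \<iota>' \<pi>' X I' (susp C \<F> X)" "injective_object C I'"
      and F: "susp C \<F> X \<in> \<F>"
      using susp_ses[OF c XS(1)] .
    show ?thesis using su XS F re schanuel[OF s s'] schanuel[OF s' s] by blast
  qed
  then have "stable_thick \<F> T" unfolding stable_thick_def using T(1) inj re by blast
  then show ?thesis using that T(2) by blast
qed

lemma zero_object_injective:
  assumes "zero_object C Z"
  shows "injective_object C Z"
proof -
  have Z: "Z \<in> Obj C" "\<And>X. X \<in> Obj C \<Longrightarrow> \<exists>!f. f \<in> Hom C X Z"
    using assms unfolding zero_object_def by blast+
  have "\<exists>g \<in> Hom C (Cod C m) Z. g \<cdot> m = f" if m: "mono_arr C m" and f: "f \<in> Hom C (Dom C m) Z" for m f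
  proof -
    have m': "m \<in> Hom C (Dom C m) (Cod C m)" using m unfolding mono_arr_def Hom_iff by blast
    obtain g where g: "g \<in> Hom C (Cod C m) Z" using Z(2)[OF Hom_Obj(2)[OF m']] by blast
    have "g \<cdot> m = f" using Z(2)[OF Hom_Obj(1)[OF m']] Comp_in_Hom[OF m' g] f by blast
    then show ?thesis using g by blast
  qed
  then show ?thesis unfolding injective_object_def using Z(1) by blast
qed

lemma zero_object_stable:
  assumes "\<F> \<subseteq> Obj C" "zero_object C Z" "Z \<in> \<F>"
  shows "zero_object (stable_category C \<F>) Z"
proof -
  have "(\<exists>!\<alpha>. \<alpha> \<in> Hom (stable_category C \<F>) X Z) \<and> (\<exists>!\<alpha>. \<alpha> \<in> Hom (stable_category C \<F>) Z X)"
    if X: "X \<in> \<F>" for X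
  proof -
    have "\<exists>!f. f \<in> Hom C X Z" "\<exists>!f. f \<in> Hom C Z X"
      using assms(1,2) X unfolding zero_object_def by blast+
    then show ?thesis unfolding Hom_stable_iff using X assms(3) by blast
  qed
  then show ?thesis unfolding zero_object_def using assms(3) by simp
qed

text \<open>In a standard triangle on u the cone is an extension of the suspension of
  \<open>Dom C u\<close> by \<open>Cod C u\<close>, so closure under extensions gives closure under
  cones. Isomorphisms of triangles are absorbed by closure under stable retracts.\<close>

lemma stable_thick_subcategoryI:
  assumes c: "icp \<W> \<F>" and T: "stable_thick \<F> T"
    and ext: "\<And>i p X Y Z. ses C i p X Y Z \<Longrightarrow> X \<in> T \<Longrightarrow> Z \<in> T \<Longrightarrow> Y \<in> T"
  shows "stable_thick_subcategory C \<F> (full_subcat (stable_category C \<F>) T)"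
proof -
  let ?S = "stable_category C \<F>"
  interpret stable_thick_class C \<W> \<F> T by unfold_locales (rule c, rule T)
  note FO = icp_Obj(2)[OF c]
  have su: "X \<in> T \<longleftrightarrow> susp C \<F> X \<in> T" if X: "X \<in> \<F>" for X
    using susp_ses[OF c X] T_susp_iff X by metis
  have re: "X \<in> T" if "sretract X Y" "Y \<in> T" "X \<in> \<F>" for X Y using T_sretract that FO by blast
  have iso: "Y \<in> T" if X: "X \<in> T" and Y: "isomorphic ?S X Y" for X Y
  proof -
    obtain \<alpha> where a: "\<alpha> \<in> Hom ?S X Y" "iso_arr ?S \<alpha>" using Y unfolding isomorphic_def by blast
    have "Y \<in> \<F>" using a(1) unfolding Hom_stable_iff by simp
    then show ?thesis using re iso_arr_sretract(2)[OF a] X by blast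
  qed
  have zero: "\<exists>Z \<in> T. zero_object ?S Z"
  proof -
    obtain Z where Z: "zero_object C Z" using ex_zero_object by blast
    have "Z \<in> T" using T_injective zero_object_injective[OF Z] by blast
    then show ?thesis using zero_object_stable[OF FO Z] T_sub(2) by blast
  qed
  have tri: "Dom ?S \<gamma> \<in> T"
    if d: "(\<alpha>, \<beta>, \<gamma>) \<in> distinguished_triangles C \<F>" and ab: "Dom ?S \<alpha> \<in> T" "Dom ?S \<beta> \<in> T" for \<alpha> \<beta> \<gamma>
  proof -
    obtain u v w a b k where st: "standard_triangle C \<F> u v w"
      and a: "a \<in> Hom ?S (Dom ?S \<alpha>) (Dom C u)" "iso_arr ?S a"
      and b: "b \<in> Hom ?S (Dom ?S \<beta>) (Dom C v)" "iso_arr ?S b"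
      and k: "k \<in> Hom ?S (Dom ?S \<gamma>) (Dom C w)" "iso_arr ?S k"
      using d unfolding distinguished_triangles_def Let_def by blast
    have s: "ses C v w (Dom C v) (Cod C v) (susp C \<F> (Dom C u))" "Dom C w = Cod C v"
      using st unfolding standard_triangle_def short_exact_ses by auto
    have "Dom C u \<in> T" using iso[OF ab(1)] a unfolding isomorphic_def by blast
    then have "susp C \<F> (Dom C u) \<in> T" using su T_sub(2) by blast
    moreover have "Dom C v \<in> T" using iso[OF ab(2)] b unfolding isomorphic_def by blast
    ultimately have "Dom C w \<in> T" using ext[OF s(1)] s(2) by simp
    moreover have "Dom ?S \<gamma> \<in> \<F>" using k(1) unfolding Hom_stable_iff by simp
    ultimately show ?thesis using re iso_arr_sretract(1)[OF k] by blast
  qed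
  have "full_triangulated_subcategory ?S (susp C \<F>) (distinguished_triangles C \<F>) (full_subcat ?S T)"
    unfolding full_triangulated_subcategory_def stable_category_simps(1)
  proof (intro exI[of _ T] conjI refl T_sub(1) zero)
    show "\<forall>X \<in> T. \<forall>Y \<in> \<F>. isomorphic ?S X Y \<longrightarrow> Y \<in> T" using iso by blast
    show "\<forall>X \<in> \<F>. X \<in> T \<longleftrightarrow> susp C \<F> X \<in> T" using su by blast
    show "\<forall>(\<alpha>, \<beta>, \<gamma>) \<in> distinguished_triangles C \<F>.
        Dom ?S \<alpha> \<in> T \<and> Dom ?S \<beta> \<in> T \<longrightarrow> Dom ?S \<gamma> \<in> T"
    proof
      fix t assume t: "t \<in> distinguished_triangles C \<F>"
      obtain \<alpha> \<beta> \<gamma> where "t = (\<alpha>, \<beta>, \<gamma>)" by (cases t)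
      then show "case t of (\<alpha>, \<beta>, \<gamma>) \<Rightarrow> Dom ?S \<alpha> \<in> T \<and> Dom ?S \<beta> \<in> T \<longrightarrow> Dom ?S \<gamma> \<in> T"
        using tri[of \<alpha> \<beta> \<gamma>] t by (simp only: prod.case) blast
    qed
  qed
  moreover have "\<forall>Y \<in> T. \<forall>X \<in> \<F>. retract_of ?S X Y \<longrightarrow> X \<in> T"
    using re retract_of_stable_iff T_sub(2) by blast
  ultimately show ?thesis
    unfolding stable_thick_subcategory_def thick_subcategory_def full_subcat_simps(1) stable_category_simps(1)
    by (rule conjI)
qed


section \<open>Admissible subcategories\<close>

lemma left_admissible_iff:
  assumes c: "icp \<W> \<F>"
  shows "left_admissible C \<F> D \<longleftrightarrow>
    (\<exists>\<W>' \<F>'. icp \<W>' \<F>' \<and> \<F>' \<subseteq> \<F> \<and> D = full_subcat (stable_category C \<F>) \<F>')"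
proof
  note FO = icp_Obj(2)[OF c]
  assume D: "left_admissible C \<F> D"
  then obtain T where T: "D = full_subcat (stable_category C \<F>) T" "stable_thick \<F> T"
    using stable_thick_subcategoryD[OF c] unfolding left_admissible_def by blast
  interpret stable_thick_class C \<W> \<F> T by unfold_locales (rule c, rule T)
  have "icp perp T"
    using D reflective_icp has_left_adjoint_stable_iff[OF FO T_sub(1)]
    unfolding left_admissible_def T(1) by blast
  then show "\<exists>\<W>' \<F>'. icp \<W>' \<F>' \<and> \<F>' \<subseteq> \<F> \<and> D = full_subcat (stable_category C \<F>) \<F>'"
    using T(1) T_sub(1) by blast
next
  assume "\<exists>\<W>' \<F>'. icp \<W>' \<F>' \<and> \<F>' \<subseteq> \<F> \<and> D = full_subcat (stable_category C \<F>) \<F>'"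
  then obtain \<W>' \<F>' where p: "icp \<W>' \<F>'" "\<F>' \<subseteq> \<F>" "D = full_subcat (stable_category C \<F>) \<F>'" by blast
  have "\<exists>L e. reflection \<F>' X L e" if "X \<in> \<F>" for X
    using icp_reflection[OF p(1)] that icp_Obj(2)[OF c] by blast
  then have "has_left_adjoint D (stable_category C \<F>) (\<lambda>X. X) (\<lambda>\<alpha>. \<alpha>)"
    unfolding p(3) using has_left_adjoint_stable_iff[OF icp_Obj(2)[OF c] p(2)] by blast
  moreover have "stable_thick_subcategory C \<F> D"
    unfolding p(3)
    by (rule stable_thick_subcategoryI[OF c icp_stable_thick[OF c p(1,2)]])
      (rule icp_right_extension[OF p(1)])
  ultimately show "left_admissible C \<F> D" unfolding left_admissible_def by blast
qed

text \<open>From left to right the second pair is \<open>co.perp\<close> with \<open>coperp\<close>,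
  and \<open>perp_coperp\<close> is the equation it has to satisfy. From right to left the
  coreflections are left approximations for the second pair.\<close>

lemma admissible_iff:
  assumes c: "icp \<W> \<F>"
  shows "admissible C \<F> D \<longleftrightarrow>
    (\<exists>\<W>' \<F>' \<W>'' \<F>''. icp \<W>' \<F>' \<and> icp \<W>'' \<F>'' \<and> \<F>'' \<subseteq> \<F> \<and> \<W>'' \<inter> \<F> = \<F>' \<and>
       D = full_subcat (stable_category C \<F>) \<F>')" (is "_ \<longleftrightarrow> ?R")
proof
  note FO = icp_Obj(2)[OF c]
  assume D: "admissible C \<F> D"
  then have "left_admissible C \<F> D" unfolding admissible_def left_admissible_def by blast
  then obtain \<W>' T where p: "icp \<W>' T" "T \<subseteq> \<F>" "D = full_subcat (stable_category C \<F>) T"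
    using left_admissible_iff[OF c] by blast
  have corefl: "\<exists>G e. coreflection T X G e" if "X \<in> \<F>" for X
    using D that has_right_adjoint_stable_iff[OF FO p(2)] unfolding admissible_def p(3) by blast
  interpret coreflective_class C \<W> \<F> T
    by unfold_locales (rule c, rule icp_stable_thick[OF c p(1,2)], rule corefl)
  show ?R using p(1,3) coperp_icp perp_coperp coperpD(1) by blast
next
  assume ?R
  then obtain \<W>' \<F>' \<W>'' \<F>'' where p: "icp \<W>' \<F>'" "icp \<W>'' \<F>''" "\<F>'' \<subseteq> \<F>" "\<W>'' \<inter> \<F> = \<F>'"
    "D = full_subcat (stable_category C \<F>) \<F>'" by blast
  have sub: "\<F>' \<subseteq> \<F>" using p(4) by blast
  have "left_admissible C \<F> D" using left_admissible_iff[OF c] p(1,5) sub by blast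
  moreover have "\<exists>G e. coreflection \<F>' X G e" if "X \<in> \<F>" for X
    using icp_coreflection[OF c p(2,3) that] unfolding p(4) by blast
  then have "has_right_adjoint D (stable_category C \<F>) (\<lambda>X. X) (\<lambda>\<alpha>. \<alpha>)"
    unfolding p(5) using has_right_adjoint_stable_iff[OF icp_Obj(2)[OF c] sub] by blast
  ultimately show "admissible C \<F> D" unfolding admissible_def left_admissible_def by blast
qed

section \<open>Uniqueness of the cotorsion pairs and the two bijections\<close>

lemma icp_left_unique: "icp \<W> \<F> \<Longrightarrow> icp \<W>' \<F> \<Longrightarrow> \<W> = \<W>'"
  using icp_left_eq by metis

lemma icp_right_unique: "icp \<W> \<F> \<Longrightarrow> icp \<W> \<F>' \<Longrightarrow> \<F> = \<F>'"
  using icp_right_eq by metis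

text \<open>Both left-hand classes contain \<open>\<W>\<close>, since the right-hand ones lie in
  \<open>\<F>\<close>. Embed X in Y from \<open>\<F>\<close> with cokernel in \<open>\<W>\<close>:
  by two-out-of-three, X and Y belong to either class together, and for Y the two classes
  agree.\<close>

lemma icp_left_determined:
  assumes c: "icp \<W> \<F>" and p: "icp \<W>1 \<F>1" "icp \<W>2 \<F>2" "\<F>1 \<subseteq> \<F>" "\<F>2 \<subseteq> \<F>" "\<W>1 \<inter> \<F> = \<W>2 \<inter> \<F>"
  shows "\<W>1 \<subseteq> \<W>2"
proof
  have W: "\<W> \<subseteq> \<W>1" "\<W> \<subseteq> \<W>2" using icp_left_eq[OF c] icp_left_eq[OF p(1)] icp_left_eq[OF p(2)] p(3,4) by blast+
  fix X assume X: "X \<in> \<W>1"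
  then have "X \<in> Obj C" using icp_Obj[OF p(1)] by blast
  then obtain i q Y V where s: "ses C i q X Y V" "Y \<in> \<F>" "V \<in> \<W>" using icp_approx_right[OF c] by blast
  have "Y \<in> \<W>1" using icp_thick(2)[OF p(1) s(1) X] s(3) W by blast
  then have "Y \<in> \<W>2" using s(2) p(5) by blast
  then show "X \<in> \<W>2" using icp_thick(3)[OF p(2) s(1)] s(3) W by blast
qed

end

lemma full_subcat_inject: "full_subcat S T = full_subcat S T' \<Longrightarrow> T = T'"
  by (metis full_subcat_simps(1))

text \<open>The maps run from cotorsion pairs to subcategories, where the assignment is explicit.
  Surjectivity is the construction of the pairs, injectivity their uniqueness.\<close>

theorem corollary4p16:
  fixes A :: "('o, 'm) add_cat" and \<W> \<F> :: "'o set"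
  assumes "abelian_category A"
    and "enough_injectives A"
    and "injective_cotorsion_pair A \<W> \<F>"
  shows "bij_betw (\<lambda>(\<W>', \<F>'). full_subcat (stable_category A \<F>) \<F>')
           {(\<W>', \<F>'). injective_cotorsion_pair A \<W>' \<F>' \<and> \<F>' \<subseteq> \<F>}
           {\<D>. left_admissible A \<F> \<D>} \<and>
         bij_betw (\<lambda>((\<W>', \<F>'), (\<W>'', \<F>'')). full_subcat (stable_category A \<F>) \<F>')
           {((\<W>', \<F>'), (\<W>'', \<F>'')).
              injective_cotorsion_pair A \<W>' \<F>' \<and> injective_cotorsion_pair A \<W>'' \<F>'' \<and>
              \<F>'' \<subseteq> \<F> \<and> \<W>'' \<inter> \<F> = \<F>'}
           {\<D>. admissible A \<F> \<D>}"
proof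
  interpret abelian_inj A
    using assms(1,2) by (intro abelian_inj.intro abelian_inj_axioms.intro)
  let ?f = "\<lambda>(\<W>' :: 'o set, \<F>'). full_subcat (stable_category A \<F>) \<F>'"
  let ?P = "{(\<W>', \<F>'). injective_cotorsion_pair A \<W>' \<F>' \<and> \<F>' \<subseteq> \<F>}"
  show "bij_betw ?f ?P {\<D>. left_admissible A \<F> \<D>}"
    unfolding bij_betw_def
  proof
    show "inj_on ?f ?P"
      unfolding inj_on_def using full_subcat_inject icp_left_unique by fast
    show "?f ` ?P = {\<D>. left_admissible A \<F> \<D>}"
      using left_admissible_iff[OF assms(3)] by (auto simp: image_iff)
  qed
  let ?g = "\<lambda>((\<W>' :: 'o set, \<F>'), (\<W>'' :: 'o set, \<F>'' :: 'o set)). full_subcat (stable_category A \<F>) \<F>'"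
  let ?Q = "{((\<W>', \<F>'), (\<W>'', \<F>'')).
      injective_cotorsion_pair A \<W>' \<F>' \<and> injective_cotorsion_pair A \<W>'' \<F>'' \<and>
      \<F>'' \<subseteq> \<F> \<and> \<W>'' \<inter> \<F> = \<F>'}"
  show "bij_betw ?g ?Q {\<D>. admissible A \<F> \<D>}"
    unfolding bij_betw_def
  proof
    show "inj_on ?g ?Q"
    proof (rule inj_onI)
      fix x y assume xy: "x \<in> ?Q" "y \<in> ?Q" "?g x = ?g y"
      obtain U T U' T' V S V' S' where x: "x = ((U, T), (U', T'))" and y: "y = ((V, S), (V', S'))"
        by (metis surj_pair)
      have p: "icp U T" "icp U' T'" "T' \<subseteq> \<F>" "U' \<inter> \<F> = T"
        and q: "icp V S" "icp V' S'" "S' \<subseteq> \<F>" "V' \<inter> \<F> = S"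
        using xy(1,2) unfolding x y by simp_all
      \<comment> \<open>A full subcategory remembers its class of objects. This fixes the first
        pair, and the intersection with \<open>\<F>\<close> of the left-hand class of the
        second.\<close>
      have TS: "T = S" using xy(3) full_subcat_inject unfolding x y prod.case by blast
      have "U' \<inter> \<F> = V' \<inter> \<F>" using p(4) q(4) TS by simp
      then have "U' = V'"
        using icp_left_determined[OF assms(3) p(2) q(2) p(3) q(3)]
          icp_left_determined[OF assms(3) q(2) p(2) q(3) p(3)] by blast
      then show "x = y"
        unfolding x y
        using icp_left_unique[OF p(1)] icp_right_unique[OF p(2)] q(1,2) TS by blast
    qed
    show "?g ` ?Q = {\<D>. admissible A \<F> \<D>}"
    proof (intro equalityI subsetI)
      fix D assume "D \<in> ?g ` ?Q"
      then obtain x where x: "x \<in> ?Q" "D = ?g x" by blast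
      obtain U T U' T' where "x = ((U, T), (U', T'))" by (metis surj_pair)
      then have "icp U T \<and> icp U' T' \<and> T' \<subseteq> \<F> \<and> U' \<inter> \<F> = T \<and>
          D = full_subcat (stable_category A \<F>) T"
        using x by simp
      then show "D \<in> {\<D>. admissible A \<F> \<D>}" using admissible_iff[OF assms(3)] by blast
    next
      fix D assume "D \<in> {\<D>. admissible A \<F> \<D>}"
      then obtain U T U' T' where p: "icp U T" "icp U' T'" "T' \<subseteq> \<F>" "U' \<inter> \<F> = T"
        "D = full_subcat (stable_category A \<F>) T"
        using admissible_iff[OF assms(3)] by blast
      show "D \<in> ?g ` ?Q"
        by (rule image_eqI[of _ _ "((U, T), (U', T'))"]) (simp_all add: p)
    qed
  qed
qed

end
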